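(* Let $d\in\mathbb{N}_+$, $T>0$, and let $f\colon\mathbb{R}^d\times[0,T]\to\mathbb{R}^d$ be continuous in $t$ and such that there exists $L>0$ with $\|f(x,t)-f(y,t)\|\le L\|x-y\|$ for all $x,y\in\mathbb{R}^d$, $t\in[0,T]$. Assume there exists $k>(d+1)/2+2$ with $f\in\mathcal{H}^k_{\mathrm{loc}}(\mathbb{R}^d\times[0,T];\mathbb{R}^d)$. Let $\rho_0$ be a probability measure supported in a compact set $K\subseteq\mathbb{R}^d$ which is absolutely continuous with respect to Lebesgue measure with density in $L^2(K)$. Then there is a constant $C_{T,f,\rho_0}$, independent of $P$, such that for every $P\in\mathbb{N}_+$ there exist parameters $\Theta=\{(W_i,A_i^1,A_i^2,B_i)\}_{i=1}^P\subset\mathbb{R}^d\times\mathbb{R}^{d\times d}\times\mathbb{R}^d\times\mathbb{R}^d$ such that $$\sup_{t\in[0,T]}\mathbb{W}_1(\rho(\cdot,t),\rho_\Theta(\cdot,t))\le\frac{C_{T,f,\rho_0}}{\sqrt P},$$ where $\rho$ is the solution of the transport equation $\partial_t\rho+\mathrm{div}_x(f(x,t)\rho)=0$ on $\mathbb{R}^d\times[0,T]$, $\rho(\cdot,0)=\rho_0$, and $\rho_\Theta$ is the solution of $\partial_t\rho+\mathrm{div}_x\big(\big(\sum_{i=1}^PW_i\circ\boldsymbol{\sigma}(A_i^1x+A_i^2t+B_i)\big)\rho\big)=0$ on $\mathbb{R}^d\times[0,T]$, $\rho(\cdot,0)=\rho_0$.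
   Context: $\|\cdot\|$ is the Euclidean norm; $\circ$ is the Hadamard product; $\sigma(s)=\max\{s,0\}$ and $\boldsymbol{\sigma}$ applies it componentwise. $\mathcal{H}^k_{\mathrm{loc}}(\mathbb{R}^d\times[0,T];\mathbb{R}^d)$ is the set of functions whose restriction to every compact subset $X$ of $\mathbb{R}^d\times[0,T]$ lies in the Sobolev space $W^{k,2}(X)$. Solutions of the transport equations are understood in the distributional (measure-valued) sense; they are given by $\rho(\cdot,t)=\phi_t\#\rho_0$ and $\rho_\Theta(\cdot,t)=\phi_{\Theta,t}\#\rho_0$, where $\phi_t$ (resp. $\phi_{\Theta,t}$) maps an initial state to the time-$t$ value of the solution of $\dot{\mathbf z}=f(\mathbf z,t)$ (resp. $\dot{\mathbf x}=\sum_iW_i\circ\boldsymbol{\sigma}(A_i^1\mathbf x+A_i^2t+B_i)$) and $\#$ is the push-forward. $\mathbb{W}_1$ is the Wasserstein-1 distance between probability measures. *)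

theory Defs
  imports "HOL-Analysis.Analysis" "HOL-Probability.Probability"
begin

fun iter_dderiv :: "('a::euclidean_space \<Rightarrow> real) \<Rightarrow> 'a list \<Rightarrow> 'a \<Rightarrow> real" where
  "iter_dderiv \<phi> [] = \<phi>"
| "iter_dderiv \<phi> (v # vs) = (\<lambda>z. frechet_derivative (iter_dderiv \<phi> vs) (at z) v)"

definition smooth_fun :: "('a::euclidean_space \<Rightarrow> real) \<Rightarrow> bool" where
  "smooth_fun \<phi> \<longleftrightarrow> (\<forall>vs \<in> lists Basis.
      (\<forall>z. iter_dderiv \<phi> vs differentiable (at z)) \<and> continuous_on UNIV (iter_dderiv \<phi> vs))"

definition test_fun :: "'a::euclidean_space set \<Rightarrow> ('a \<Rightarrow> real) \<Rightarrow> bool" where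
  "test_fun U \<phi> \<longleftrightarrow> smooth_fun \<phi> \<and> compact (closure {z. \<phi> z \<noteq> 0}) \<and> closure {z. \<phi> z \<noteq> 0} \<subseteq> U"

text \<open>f : R^d x [0,T] -> R^d lies in H^k_loc iff for every multi-index of order at most k
  (represented by a list of coordinate directions) there is a weak derivative in the
  interior R^d x (0,T), and f and all these weak derivatives are square-integrable on every
  compact subset of R^d x [0,T].\<close>
definition H_loc :: "nat \<Rightarrow> real \<Rightarrow> (real^'n \<Rightarrow> real \<Rightarrow> real^'n) \<Rightarrow> bool" where
  "H_loc k T f \<longleftrightarrow>
     (\<forall>vs \<in> lists (Basis :: ((real^'n) \<times> real) set). length vs \<le> k \<longrightarrow>
        (\<exists>g :: (real^'n) \<times> real \<Rightarrow> real^'n.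
           g \<in> borel_measurable lborel \<and>
           (\<forall>X. compact X \<and> X \<subseteq> UNIV \<times> {0..T} \<longrightarrow>
               set_integrable lborel X (\<lambda>z. (norm (g z))\<^sup>2) \<and>
               set_integrable lborel X (\<lambda>z. (norm (f (fst z) (snd z)))\<^sup>2)) \<and>
           (\<forall>\<phi>. test_fun (UNIV \<times> {0<..<T}) \<phi> \<longrightarrow>
               (LINT z|lborel. iter_dderiv \<phi> vs z *\<^sub>R f (fst z) (snd z))
                 = ((-1) ^ length vs) *\<^sub>R (LINT z|lborel. \<phi> z *\<^sub>R g z))))"

definition is_flow :: "real \<Rightarrow> (real^'n \<Rightarrow> real \<Rightarrow> real^'n) \<Rightarrow> (real \<Rightarrow> real^'n \<Rightarrow> real^'n) \<Rightarrow> bool" where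
  "is_flow T F \<phi> \<longleftrightarrow> (\<forall>x. \<phi> 0 x = x \<and>
      (\<forall>t\<in>{0..T}. ((\<lambda>s. \<phi> s x) has_vector_derivative F (\<phi> t x) t) (at t within {0..T})))"

definition relu_vec :: "real^'n \<Rightarrow> real^'n" where
  "relu_vec y = (\<chi> j. max (y $ j) 0)"

definition hadamard :: "real^'n \<Rightarrow> real^'n \<Rightarrow> real^'n" where
  "hadamard u v = (\<chi> j. u $ j * v $ j)"

definition net_field ::
  "nat \<Rightarrow> (nat \<Rightarrow> real^'n) \<Rightarrow> (nat \<Rightarrow> real^'n^'n) \<Rightarrow> (nat \<Rightarrow> real^'n) \<Rightarrow> (nat \<Rightarrow> real^'n)
     \<Rightarrow> real^'n \<Rightarrow> real \<Rightarrow> real^'n" where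
  "net_field P W A1 A2 B x t = (\<Sum>i<P. hadamard (W i) (relu_vec (A1 i *v x + t *\<^sub>R A2 i + B i)))"

definition W1 :: "(real^'n) measure \<Rightarrow> (real^'n) measure \<Rightarrow> ennreal" where
  "W1 \<mu> \<nu> = (INF \<pi> \<in> {\<pi> :: ((real^'n) \<times> (real^'n)) measure.
        prob_space \<pi> \<and> sets \<pi> = sets borel \<and>
        distr \<pi> borel fst = \<mu> \<and> distr \<pi> borel snd = \<nu>}.
      \<integral>\<^sup>+ z. ennreal (dist (fst z) (snd z)) \<partial>\<pi>)"

end

theory Submission
  imports Defs
begin

text \<open>Both solutions are push-forwards of \<open>\<rho>0\<close>, so \<open>W1\<close> is at most the \<open>\<rho>0\<close>-mean distance of the two flows.
  By Gronwall's inequality, applied with the Lipschitz constant of the network, this distance is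
  controlled by the \<open>L\<^sup>1\<close> error of the network with respect to one fixed measure \<open>\<mu>\<close>, the law of
  \<open>(\<phi>\<^sub>t x, t)\<close> for \<open>x\<close> distributed by \<open>\<rho>0\<close> and \<open>t\<close> uniform on \<open>[0, T]\<close>. Each component of \<open>f\<close> is then
  approximated in \<open>L\<^sup>2(\<mu>)\<close> with error \<open>O(1 / sqrt P)\<close> by Maurey's argument, with outer weights
  \<open>O(1 / P)\<close> and unit inner weights, which keeps the Lipschitz constants bounded independently of \<open>P\<close>.

  Maurey's argument needs \<open>f\<close> to lie in a multiple of the closed convex hull of the ReLU ridge
  functions. This is used in dual form: if \<open>h\<close> has integral at most \<open>\<kappa>\<close> against every ridge function,
  then it has integral at most \<open>C (1 + norm \<xi>)\<^sup>2 \<kappa>\<close> against \<open>cos (\<xi> \<bullet> z + c)\<close>, by Taylor's formula in one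
  variable. After a cutoff in space and a Hestenes reflection at the ends of \<open>[0, T]\<close>, \<open>f\<close> is a limit
  of smoothed Fourier sums whose coefficients satisfy \<open>\<Sum> (1 + norm \<xi>)\<^sup>2 \<bar>coefficient\<bar> < \<infinity>\<close>, by Bessel's
  inequality for the \<open>k\<close>-th weak derivatives and Cauchy-Schwarz; here \<open>k > (d + 1) / 2 + 2\<close> enters.
  Both the cutoff and the reflection are put on the test functions, so that \<open>f\<close> itself
  is never extended.\<close>

section \<open>Smooth functions of one variable\<close>

text \<open>The obstacle is that the weak derivatives live in the open slab only, with nothing known
  at its ends, while Bessel's inequality concerns functions on a full period. Reflecting the
  trigonometric functions instead of \<open>f\<close> resolves this: with slopes
  \<open>1 - 2 * j\<close> and signed binomial weights, the reflected sum is, up to a power of the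
  frequency, the \<open>k\<close>-th derivative of a function vanishing to order \<open>k\<close> at
  the end, so \<open>k\<close> integrations by parts leave no boundary term. A reflection serves one
  end only, hence a partition of unity in time. The threshold for \<open>k\<close> comes from D = d
  + 1 variables: Cauchy-Schwarz bounds the sum of (1 + |xi|)^2 |c| by the square roots of the sums
  of (1 + |xi|)^(4 - 2k) and of (1 + |xi|)^(2k) c^2, and the first sum is finite because 2k - 4 > D.
  The measure has to be known before the network is built. Gronwall's inequality is therefore
  arranged so that the defect is evaluated along trajectories of \<open>f\<close>, at the price of
  the Lipschitz constant of the network in the exponent; this is why the sizes of the weights are
  tracked throughout.\<close>

definition smooth1 :: "(real \<Rightarrow> real) \<Rightarrow> bool" where
  "smooth1 p \<longleftrightarrow> (\<forall>n x. (deriv ^^ n) p differentiable (at x))"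

lemma deriv_funpow_family:
  fixes D :: "nat \<Rightarrow> real \<Rightarrow> real"
  assumes "\<And>n x. (D n has_real_derivative D (Suc n) x) (at x)"
  shows "(deriv ^^ n) (D m) = D (m + n)"
proof (induction n)
  case (Suc n)
  have "deriv (D (m + n)) = D (Suc (m + n))"
    using assms by (intro ext DERIV_imp_deriv)
  with Suc show ?case by simp
qed simp

lemma smooth1_family:
  fixes D :: "nat \<Rightarrow> real \<Rightarrow> real"
  assumes "\<And>n x. (D n has_real_derivative D (Suc n) x) (at x)"
  shows "smooth1 (D m)"
  unfolding smooth1_def deriv_funpow_family[of D, OF assms]
  using assms real_differentiable_def by blast

text \<open>Closure under one differentiation suffices, so no formula for the n-th derivative has to
  be guessed.\<close>

lemma smooth1_coinduct:
  assumes "p \<in> X" and "\<And>p. p \<in> X \<Longrightarrow> \<exists>p'\<in>X. \<forall>x. (p has_real_derivative p' x) (at x)"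
  shows "smooth1 p"
proof -
  have *: "p \<in> X \<Longrightarrow> deriv p \<in> X \<and> (\<forall>x. (p has_real_derivative deriv p x) (at x))" for p
  proof -
    assume "p \<in> X"
    then obtain p' where p': "p' \<in> X" "\<forall>x. (p has_real_derivative p' x) (at x)"
      using assms(2) by blast
    then have "deriv p = p'" by (auto intro!: ext DERIV_imp_deriv)
    then show ?thesis using p' by simp
  qed
  have "(deriv ^^ n) p \<in> X" for n
    by (induction n) (use assms(1) * in auto)
  then show ?thesis
    unfolding smooth1_def using * real_differentiable_def by blast
qed

lemma smooth1_has_deriv:
  assumes "smooth1 p" shows "((deriv ^^ n) p has_real_derivative (deriv ^^ Suc n) p x) (at x)"
  using assms unfolding smooth1_def
  by (simp add: DERIV_deriv_iff_real_differentiable)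

lemma smooth1_has_deriv0:
  assumes "smooth1 p" shows "(p has_real_derivative deriv p x) (at x)"
  using smooth1_has_deriv[OF assms, of 0] by simp

lemma smooth1_deriv_iter: "smooth1 p \<Longrightarrow> smooth1 ((deriv ^^ n) p)"
  unfolding smooth1_def by (metis funpow_add comp_apply)

lemma smooth1_deriv: "smooth1 p \<Longrightarrow> smooth1 (deriv p)"
  using smooth1_deriv_iter[of p 1] by simp

lemma smooth1_continuous: "smooth1 p \<Longrightarrow> continuous_on A p"
  by (meson DERIV_isCont continuous_at_imp_continuous_on smooth1_has_deriv0)

text \<open>For products the n-th derivative would need Leibniz's rule. The algebra generated by
  smooth functions is closed under a single differentiation, and \<open>smooth1_coinduct\<close>
  does the rest.\<close>

inductive_set smooth_alg :: "(real \<Rightarrow> real) set" where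
  base: "smooth1 p \<Longrightarrow> p \<in> smooth_alg"
| add: "p \<in> smooth_alg \<Longrightarrow> q \<in> smooth_alg \<Longrightarrow> (\<lambda>x. p x + q x) \<in> smooth_alg"
| mult: "p \<in> smooth_alg \<Longrightarrow> q \<in> smooth_alg \<Longrightarrow> (\<lambda>x. p x * q x) \<in> smooth_alg"

lemma smooth_alg_deriv:
  "p \<in> smooth_alg \<Longrightarrow> \<exists>p'\<in>smooth_alg. \<forall>x. (p has_real_derivative p' x) (at x)"
proof (induction rule: smooth_alg.induct)
  case (base p)
  then show ?case using smooth1_has_deriv0 smooth1_deriv smooth_alg.base by blast
next
  case (add p q)
  then obtain p' q' where "p' \<in> smooth_alg" "q' \<in> smooth_alg"
    "\<forall>x. (p has_real_derivative p' x) (at x)" "\<forall>x. (q has_real_derivative q' x) (at x)" by blast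
  then show ?case
    by (intro bexI[of _ "\<lambda>x. p' x + q' x"]) (auto intro!: derivative_eq_intros smooth_alg.add)
next
  case (mult p q)
  then obtain p' q' where *: "p' \<in> smooth_alg" "q' \<in> smooth_alg"
    "\<forall>x. (p has_real_derivative p' x) (at x)" "\<forall>x. (q has_real_derivative q' x) (at x)" by blast
  show ?case
  proof (intro bexI[of _ "\<lambda>x. p' x * q x + q' x * p x"] allI)
    show "((\<lambda>x. p x * q x) has_real_derivative p' x * q x + q' x * p x) (at x)" for x
      using * by (auto intro!: derivative_eq_intros)
    show "(\<lambda>x. p' x * q x + q' x * p x) \<in> smooth_alg"
      using * mult.hyps smooth_alg.add[OF smooth_alg.mult[of p' q] smooth_alg.mult[of q' p]] by simp
  qed
qed

lemma smooth1_alg: "p \<in> smooth_alg \<Longrightarrow> smooth1 p"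
  using smooth1_coinduct smooth_alg_deriv by blast

lemma smooth1_add: "smooth1 p \<Longrightarrow> smooth1 q \<Longrightarrow> smooth1 (\<lambda>x. p x + q x)"
  and smooth1_mult: "smooth1 p \<Longrightarrow> smooth1 q \<Longrightarrow> smooth1 (\<lambda>x. p x * q x)"
  using smooth1_alg smooth_alg.intros by simp_all

lemma smooth1_const: "smooth1 (\<lambda>x. c)"
  using smooth1_family[of "\<lambda>n x. if n = 0 then c else 0" 0] by simp

lemma smooth1_affine:
  assumes "smooth1 p" shows "smooth1 (\<lambda>x. p (c * x + d))"
proof -
  define D where "D = (\<lambda>n x. c ^ n * (deriv ^^ n) p (c * x + d))"
  have "(D n has_real_derivative D (Suc n) x) (at x)" for n x
  proof -
    have "((\<lambda>x. (deriv ^^ n) p (c * x + d)) has_real_derivative (deriv ^^ Suc n) p (c * x + d) * c) (at x)"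
      by (rule DERIV_chain2[OF smooth1_has_deriv[OF assms]]) (auto intro!: derivative_eq_intros)
    from DERIV_cmult[OF this, of "c ^ n"] show ?thesis
      by (simp add: D_def mult_ac)
  qed
  from smooth1_family[of D 0, OF this] show ?thesis by (simp add: D_def)
qed

lemma smooth1_diff_const: "smooth1 p \<Longrightarrow> smooth1 (\<lambda>x. c - p x)"
  using smooth1_add[OF smooth1_const smooth1_mult[OF smooth1_const[of "-1"]], of p c] by simp

text \<open>The flat function exp (-1/x), with a polynomial in 1/x as a factor: this family is
  closed under differentiation, the polynomial \<open>[:0,0,1:]\<close> below being the y^2 that the
  derivative of y = 1/x produces.\<close>

definition flat_exp :: "real poly \<Rightarrow> real \<Rightarrow> real" where
  "flat_exp P x = (if x > 0 then poly P (1 / x) * exp (- (1 / x)) else 0)"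

lemma poly_exp_tendsto_0: "((\<lambda>y. poly P y * exp (- y)) \<longlongrightarrow> (0::real)) at_top"
proof -
  have "((\<lambda>y. \<Sum>i\<le>degree P. coeff P i * (y ^ i / exp y)) \<longlongrightarrow> (\<Sum>i\<le>degree P. coeff P i * 0)) at_top"
    by (intro tendsto_intros tendsto_power_div_exp_0)
  moreover have "(\<lambda>y. \<Sum>i\<le>degree P. coeff P i * (y ^ i / exp y)) = (\<lambda>y. poly P y * exp (- y))"
    by (intro ext) (simp add: poly_altdef sum_distrib_right exp_minus divide_inverse mult.assoc)
  ultimately show ?thesis by simp
qed

lemma flat_exp_deriv:
  "(flat_exp P has_real_derivative flat_exp ([:0,0,1:] * (P - pderiv P)) x) (at x)"
proof -
  consider "x > 0" | "x < 0" | "x = 0" by linarith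
  then show ?thesis
  proof cases
    case 1
    have "((\<lambda>x. poly P (1 / x) * exp (- (1 / x))) has_real_derivative flat_exp ([:0,0,1:] * (P - pderiv P)) x) (at x)"
    proof -
      have "((\<lambda>x. poly P (1 / x)) has_real_derivative poly (pderiv P) (1 / x) * (- 1 / x\<^sup>2)) (at x)"
        using 1 by (intro DERIV_chain2[OF poly_DERIV])
          (auto intro!: derivative_eq_intros simp: power2_eq_square)
      moreover have "((\<lambda>x. exp (- (1 / x))) has_real_derivative exp (- (1 / x)) * (1 / x\<^sup>2)) (at x)"
        using 1 by (auto intro!: derivative_eq_intros simp: power2_eq_square)
      ultimately show ?thesis
        by (rule DERIV_mult[THEN DERIV_cong])
          (use 1 in \<open>simp add: flat_exp_def power2_eq_square algebra_simps\<close>)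
    qed
    moreover have "\<forall>\<^sub>F y in nhds x. flat_exp P y = poly P (1 / y) * exp (- (1 / y))"
      using eventually_nhds_in_open[of "{0<..}" x] 1 by (auto elim!: eventually_mono simp: flat_exp_def)
    ultimately show ?thesis by (subst DERIV_cong_ev[OF refl _ refl])
  next
    case 2
    have "\<forall>\<^sub>F y in nhds x. flat_exp P y = 0"
      using eventually_nhds_in_open[of "{..<0}" x] 2 by (auto elim!: eventually_mono simp: flat_exp_def)
    from DERIV_cong_ev[OF refl this refl] show ?thesis using 2 by (simp add: flat_exp_def[of _ x])
  next
    case 3
    have "((\<lambda>h. flat_exp P h / h) \<longlongrightarrow> 0) (at_left 0)"
      by (rule tendsto_eventually, unfold eventually_at_left_field, intro exI[of _ "-1"])
         (simp add: flat_exp_def)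
    moreover have "((\<lambda>h. flat_exp P h / h) \<longlongrightarrow> 0) (at_right 0)"
    proof -
      \<comment> \<open>Dividing by \<open>h\<close> multiplies the polynomial by its variable 1/h,
        hence \<open>pCons 0 P\<close>.\<close>
      have "((\<lambda>h. poly (pCons 0 P) (inverse h) * exp (- inverse h)) \<longlongrightarrow> (0::real)) (at_right 0)"
        using poly_exp_tendsto_0[of "pCons 0 P"] filterlim_inverse_at_top_right
        by (rule filterlim_compose)
      moreover have "\<forall>\<^sub>F h in at_right 0. poly (pCons 0 P) (inverse h) * exp (- inverse h) = flat_exp P h / h"
        unfolding eventually_at_right_field
        by (intro exI[of _ 1]) (simp add: flat_exp_def inverse_eq_divide)
      ultimately show ?thesis by (rule Lim_transform_eventually)
    qed
    ultimately have "((\<lambda>h. flat_exp P h / h) \<longlongrightarrow> 0) (at 0)"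
      by (simp add: filterlim_split_at)
    then show ?thesis unfolding DERIV_def using 3 by (simp add: flat_exp_def)
  qed
qed

lemma smooth1_flat_exp: "smooth1 (flat_exp P)"
  by (rule smooth1_coinduct[where X = "range flat_exp"]) (use flat_exp_deriv in blast)+

text \<open>A normalised primitive of the bump exp (-1/x) exp (-1/(1-x)) on (0, 1).\<close>

lemma smooth_step_exists:
  "\<exists>s. smooth1 s \<and> (\<forall>x\<le>0. s x = 0) \<and> (\<forall>x\<ge>1. s x = 1) \<and> (\<forall>x. 0 \<le> s x \<and> s x \<le> 1)"
proof -
  define b where "b = (\<lambda>x. flat_exp 1 x * flat_exp 1 ((-1) * x + 1))"
  have sb: "smooth1 b"
    unfolding b_def by (intro smooth1_mult smooth1_flat_exp smooth1_affine[OF smooth1_flat_exp, of 1 "-1" 1])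
  have b_nonneg: "b x \<ge> 0" for x by (auto simp: b_def flat_exp_def)
  have b_zero: "x \<le> 0 \<or> x \<ge> 1 \<Longrightarrow> b x = 0" for x by (auto simp: b_def flat_exp_def)
  have "\<exists>g. \<forall>x. (g has_real_derivative b x) (at x)"
  proof -
    have "\<exists>g. \<forall>x. (g has_vector_derivative b x) (at x)"
      using einterval_antiderivative[of "-\<infinity>" "\<infinity>" b] smooth1_continuous[OF sb, of UNIV]
      by (force simp: continuous_on_eq_continuous_at)
    then show ?thesis by (simp add: has_real_derivative_iff_has_vector_derivative)
  qed
  then obtain g where g: "\<And>x. (g has_real_derivative b x) (at x)" by blast
  have sg: "smooth1 g"
    by (rule smooth1_coinduct[where X = "insert g (Collect smooth1)"])
       (use g sb smooth1_has_deriv0 smooth1_deriv in blast)+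
  have mono: "g x \<le> g y" if "x \<le> y" for x y
    using DERIV_nonneg_imp_nondecreasing[OF that, of g] g b_nonneg by blast
  have const: "g x = g y" if "x \<le> y" "y \<le> 0 \<or> x \<ge> 1" for x y
  proof (cases "x = y")
    case False
    then have "x < y" using that by simp
    have "\<exists>z. z > x \<and> z < y \<and> g y - g x = (y - x) * b z"
      using MVT2[OF \<open>x < y\<close>, of g b] g by blast
    then obtain z where "x < z" "z < y" "g y - g x = (y - x) * b z" by blast
    moreover from this have "b z = 0" using b_zero[of z] that by linarith
    ultimately show ?thesis by simp
  qed simp
  have "g 0 < g 1"
  proof -
    have "\<exists>z. z > 1/4 \<and> z < 3/4 \<and> g (3/4) - g (1/4) = (3/4 - 1/4) * b z"
      using MVT2[of "1/4" "3/4::real" g b] g by simp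
    then obtain z where z: "z > 1/4" "z < 3/4" "g (3/4) - g (1/4) = (3/4 - 1/4) * b z" by blast
    have "b z > 0" using z by (auto simp: b_def flat_exp_def)
    then have "g (3/4) - g (1/4) > 0" using z by simp
    then show ?thesis using mono[of 0 "1/4"] mono[of "3/4" 1] by simp
  qed
  define s where "s = (\<lambda>x. (1 / (g 1 - g 0)) * (g x + (- g 0)))"
  have "smooth1 s" unfolding s_def by (intro smooth1_mult smooth1_add smooth1_const sg)
  moreover have "\<forall>x\<le>0. s x = 0" 
  proof (intro allI impI)
    fix x :: real assume "x \<le> 0"
    then have "g x = g 0" using const[of x 0] by simp
    then show "s x = 0" by (simp add: s_def)
  qed
  moreover have "\<forall>x\<ge>1. s x = 1" 
  proof (intro allI impI)
    fix x :: real assume "x \<ge> 1"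
    then have "g x = g 1" using const[of 1 x] by simp
    then show "s x = 1" using \<open>g 0 < g 1\<close> by (simp add: s_def)
  qed
  moreover have "\<forall>x. 0 \<le> s x \<and> s x \<le> 1"
  proof
    fix x
    have "g 0 \<le> g x" using mono[of 0 x] const[of x 0] by linarith
    moreover have "g x \<le> g 1" using mono[of x 1] const[of 1 x] by linarith
    ultimately show "0 \<le> s x \<and> s x \<le> 1" using \<open>g 0 < g 1\<close> by (simp add: s_def field_simps)
  qed
  ultimately show ?thesis by blast
qed

lemma smooth1_bounded_interval:
  assumes "smooth1 p" and "\<And>x. x < lo \<or> x > hi \<Longrightarrow> p x = 0"
  shows "\<exists>C\<ge>0. \<forall>x. \<bar>p x\<bar> \<le> C"
proof -
  have "compact (p ` {lo..hi})"
    by (intro compact_continuous_image smooth1_continuous assms(1)) simp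
  then obtain C where "\<forall>y\<in>p ` {lo..hi}. norm y \<le> C"
    using compact_imp_bounded bounded_iff by blast
  then have *: "\<forall>y\<in>p ` {lo..hi}. \<bar>y\<bar> \<le> C" by simp
  have "\<bar>p x\<bar> \<le> max C 0" for x
  proof (cases "x < lo \<or> x > hi")
    case False
    then have "p x \<in> p ` {lo..hi}" by auto
    with * have "\<bar>p x\<bar> \<le> C" by blast
    then show ?thesis by simp
  qed (use assms(2) in auto)
  then show ?thesis by (meson max.cobounded2)
qed

lemma smooth1_deriv_supp:
  assumes "smooth1 p" and "\<And>x. x < lo \<or> x > hi \<Longrightarrow> p x = 0" and "x < lo \<or> x > hi"
  shows "deriv p x = 0"
proof -
  have "open {x. x < lo \<or> x > hi}"
    using open_Un[OF open_lessThan[of lo] open_greaterThan[of hi]] by (simp add: lessThan_def greaterThan_def Un_def)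
  then have "\<forall>\<^sub>F y in nhds x. p y = 0"
    using eventually_nhds_in_open[of "{x. x < lo \<or> x > hi}" x] assms(2,3)
    by (auto elim!: eventually_mono)
  from DERIV_cong_ev[OF refl this refl, of 0] have "(p has_real_derivative 0) (at x)" by simp
  then show ?thesis by (rule DERIV_imp_deriv)
qed

section \<open>Tensor products of smooth functions and weak derivatives\<close>

text \<open>Test functions of product form are the only ones ever inserted into the weak
  formulation: partial derivatives act on a single factor, and integrals over boxes
  factorise.\<close>

definition tens :: "('a::euclidean_space \<Rightarrow> real \<Rightarrow> real) \<Rightarrow> 'a \<Rightarrow> real" where
  "tens p z = (\<Prod>b\<in>Basis. p b (z \<bullet> b))"

lemma tens_upd:
  assumes "b \<in> Basis"
  shows "tens (p(b := q)) z = q (z \<bullet> b) * (\<Prod>c\<in>Basis - {b}. p c (z \<bullet> c))"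
proof -
  have "tens (p(b := q)) z = q (z \<bullet> b) * (\<Prod>c\<in>Basis - {b}. (p(b := q)) c (z \<bullet> c))"
    unfolding tens_def by (subst prod.remove[OF finite_Basis assms]) simp
  also have "(\<Prod>c\<in>Basis - {b}. (p(b := q)) c (z \<bullet> c)) = (\<Prod>c\<in>Basis - {b}. p c (z \<bullet> c))"
    by (rule prod.cong) auto
  finally show ?thesis .
qed

lemma tens_cong: "(\<And>b. b \<in> Basis \<Longrightarrow> p b = q b) \<Longrightarrow> tens p = tens q"
  unfolding tens_def by (auto intro!: ext prod.cong)

lemma tens_mult_upd:
  assumes "b \<in> Basis"
  shows "tens (p(b := \<lambda>x. u x * q x)) z = u (z \<bullet> b) * tens (p(b := q)) z"
  using assms by (simp add: tens_upd)

lemma tens_has_derivative: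
  assumes "\<And>b. b \<in> Basis \<Longrightarrow> smooth1 (p b)"
  shows "(tens p has_derivative
    (\<lambda>h. \<Sum>b\<in>Basis. deriv (p b) (z \<bullet> b) * (h \<bullet> b) * (\<Prod>c\<in>Basis - {b}. p c (z \<bullet> c)))) (at z)"
proof -
  have "((\<lambda>z. p b (z \<bullet> b)) has_derivative (\<lambda>h. deriv (p b) (z \<bullet> b) * (h \<bullet> b))) (at z)" if "b \<in> Basis" for b
  proof -
    have "((\<lambda>z. z \<bullet> b) has_derivative (\<lambda>h. h \<bullet> b)) (at z)"
      by (intro derivative_eq_intros) auto
    moreover have "(p b has_derivative (*) (deriv (p b) (z \<bullet> b))) (at (z \<bullet> b))"
      using smooth1_has_deriv0[OF assms[OF that]] by (simp add: has_field_derivative_def)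
    ultimately show ?thesis
      by (rule has_derivative_compose)
  qed
  from has_derivative_prod[of Basis "\<lambda>b z. p b (z \<bullet> b)", OF this] show ?thesis
    unfolding tens_def[abs_def] by simp
qed

lemma tens_frechet:
  assumes "\<And>b. b \<in> Basis \<Longrightarrow> smooth1 (p b)" and "v \<in> Basis"
  shows "frechet_derivative (tens p) (at z) v = tens (p(v := deriv (p v))) z"
proof -
  have "frechet_derivative (tens p) (at z) =
    (\<lambda>h. \<Sum>b\<in>Basis. deriv (p b) (z \<bullet> b) * (h \<bullet> b) * (\<Prod>c\<in>Basis - {b}. p c (z \<bullet> c)))"
    using tens_has_derivative[OF assms(1)] by (rule frechet_derivative_at[symmetric])
  then have "frechet_derivative (tens p) (at z) v =
    (\<Sum>b\<in>Basis. deriv (p b) (z \<bullet> b) * (v \<bullet> b) * (\<Prod>c\<in>Basis - {b}. p c (z \<bullet> c)))" by simp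
  also have "\<dots> = (\<Sum>b\<in>Basis. if b = v then deriv (p v) (z \<bullet> v) * (\<Prod>c\<in>Basis - {v}. p c (z \<bullet> c)) else 0)"
    using assms(2) by (intro sum.cong) (auto simp: inner_Basis)
  also have "\<dots> = tens (p(v := deriv (p v))) z"
    using assms(2) by (simp add: tens_upd)
  finally show ?thesis .
qed

lemma tens_continuous:
  assumes "\<And>b. b \<in> Basis \<Longrightarrow> smooth1 (p b)"
  shows "continuous_on A (tens p)"
  by (meson assms continuous_at_imp_continuous_on has_derivative_continuous tens_has_derivative)

lemma iter_dderiv_tens:
  assumes "\<And>b. b \<in> Basis \<Longrightarrow> smooth1 (p b)" and "vs \<in> lists Basis"
  shows "iter_dderiv (tens p) vs = tens (\<lambda>b. (deriv ^^ count_list vs b) (p b))"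
  using assms(2)
proof (induction vs)
  case (Cons v vs)
  let ?q = "\<lambda>b. (deriv ^^ count_list vs b) (p b)"
  have "v \<in> Basis" "iter_dderiv (tens p) vs = tens ?q" using Cons by auto
  then have "iter_dderiv (tens p) (v # vs) = tens (?q(v := deriv (?q v)))"
    using assms(1) by (auto intro!: ext tens_frechet smooth1_deriv_iter)
  also have "\<dots> = tens (\<lambda>b. (deriv ^^ count_list (v # vs) b) (p b))"
    by (intro tens_cong) auto
  finally show ?case .
qed simp

lemma smooth_fun_tens:
  assumes "\<And>b. b \<in> Basis \<Longrightarrow> smooth1 (p b)"
  shows "smooth_fun (tens p)"
  unfolding smooth_fun_def
proof (intro ballI conjI allI)
  fix vs :: "'a list" assume vs: "vs \<in> lists Basis"
  have s: "b \<in> Basis \<Longrightarrow> smooth1 ((deriv ^^ count_list vs b) (p b))" for b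
    using assms by (simp add: smooth1_deriv_iter)
  let ?q = "\<lambda>b. (deriv ^^ count_list vs b) (p b)"
  have eq: "iter_dderiv (tens p) vs = tens ?q"
    using iter_dderiv_tens[OF assms vs] .
  show "iter_dderiv (tens p) vs differentiable at z" for z
    unfolding eq differentiable_def using tens_has_derivative[of ?q z, OF s] by blast
  show "continuous_on UNIV (iter_dderiv (tens p) vs)"
    unfolding eq using tens_continuous[of ?q, OF s] by blast
qed

text \<open>Carrying an explicit box instead of the support makes the distance to the ends of the
  slab readable from \<open>lo\<close> and \<open>hi\<close>.\<close>

definition smooth_box :: "('a::euclidean_space \<Rightarrow> real \<Rightarrow> real) \<Rightarrow> 'a \<Rightarrow> 'a \<Rightarrow> bool" where
  "smooth_box p lo hi \<longleftrightarrow>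
    (\<forall>b\<in>Basis. smooth1 (p b) \<and> (\<forall>x. x < lo \<bullet> b \<or> x > hi \<bullet> b \<longrightarrow> p b x = 0))"

lemma tens_zero: "smooth_box p lo hi \<Longrightarrow> z \<notin> cbox lo hi \<Longrightarrow> tens p z = 0"
  unfolding tens_def smooth_box_def mem_box by (rule prod_zero) (auto simp: not_le)

lemma tens_measurable:
  "smooth_box p lo hi \<Longrightarrow> tens p \<in> borel_measurable borel"
  by (intro borel_measurable_continuous_onI tens_continuous) (auto simp: smooth_box_def)

lemma test_fun_tens:
  assumes "smooth_box p lo hi" "cbox lo hi \<subseteq> U"
  shows "test_fun U (tens p)"
proof -
  have "{z. tens p z \<noteq> 0} \<subseteq> cbox lo hi" using tens_zero[OF assms(1)] by blast
  then have "closure {z. tens p z \<noteq> 0} \<subseteq> cbox lo hi"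
    by (simp add: closure_minimal closed_cbox)
  moreover from this have "compact (closure {z. tens p z \<noteq> 0})"
    by (meson bounded_cbox bounded_subset closed_closure compact_eq_bounded_closed)
  ultimately show ?thesis
    using assms smooth_fun_tens[of p] unfolding test_fun_def smooth_box_def by blast
qed

lemma smooth_box_upd:
  assumes "smooth_box p lo hi" "smooth1 q" "\<And>x. x < lo \<bullet> b \<or> x > hi \<bullet> b \<Longrightarrow> q x = 0"
  shows "smooth_box (p(b := q)) lo hi"
  using assms by (auto simp: smooth_box_def)

lemma smooth_box_deriv:
  assumes "smooth_box p lo hi" "b \<in> Basis"
  shows "smooth_box (p(b := deriv (p b))) lo hi"
proof (rule smooth_box_upd[OF assms(1)])
  have sm: "smooth1 (p b)" and z: "\<And>x. x < lo \<bullet> b \<or> x > hi \<bullet> b \<Longrightarrow> p b x = 0"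
    using assms by (auto simp: smooth_box_def)
  then show "smooth1 (deriv (p b))" by (simp add: smooth1_deriv)
  show "deriv (p b) x = 0" if "x < lo \<bullet> b \<or> x > hi \<bullet> b" for x
    using smooth1_deriv_supp[OF sm z that] .
qed

lemma smooth_box_bounded:
  assumes "smooth_box p lo hi" "b \<in> Basis"
  shows "\<exists>C\<ge>0. \<forall>x. \<bar>p b x\<bar> \<le> C"
proof (rule smooth1_bounded_interval)
  show "smooth1 (p b)" "x < lo \<bullet> b \<or> x > hi \<bullet> b \<Longrightarrow> p b x = 0" for x
    using assms by (auto simp: smooth_box_def)
qed

lemma tens_bounded:
  assumes "smooth_box p lo hi"
  shows "\<exists>C\<ge>0. \<forall>z. \<bar>tens p z\<bar> \<le> C"
proof -
  have "compact (tens p ` cbox lo hi)"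
    by (intro compact_continuous_image tens_continuous compact_cbox)
       (use assms in \<open>auto simp: smooth_box_def\<close>)
  then obtain C where C: "\<forall>y\<in>tens p ` cbox lo hi. norm y \<le> C"
    using compact_imp_bounded bounded_iff by blast
  have "\<bar>tens p z\<bar> \<le> max C 0" for z
  proof (cases "z \<in> cbox lo hi")
    case True
    with C have "norm (tens p z) \<le> C" by blast
    then show ?thesis by simp
  qed (use tens_zero[OF assms] in auto)
  then show ?thesis by (meson max.cobounded2)
qed

lemma deriv_eq_0_open:
  fixes p :: "real \<Rightarrow> real"
  assumes "open U" "x \<in> U" "\<And>y. y \<in> U \<Longrightarrow> p y = c"
  shows "deriv p x = 0"
proof -
  have "\<forall>\<^sub>F y in nhds x. p y = c"
    using eventually_nhds_in_open[OF assms(1,2)] assms(3) by (auto elim!: eventually_mono)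
  from DERIV_cong_ev[OF refl this refl, of 0] show ?thesis by (intro DERIV_imp_deriv) simp
qed

text \<open>A smooth step of width 1/n placed at distance 1/n from \<open>a\<close>, on the side
  chosen by the sign \<sigma>. Its derivative is of size n, but lives only where n |x - a| lies
  between 1 and 2, so it stays bounded after multiplication by |x - a|.\<close>

lemma endpoint_cutoff:
  fixes a \<sigma> :: real
  assumes \<sigma>: "\<sigma> = 1 \<or> \<sigma> = - 1"
  obtains \<kappa> C where "\<And>n. smooth1 (\<kappa> n)" "\<And>n x. \<bar>\<kappa> n x\<bar> \<le> (1::real)" "C \<ge> 0"
    "\<And>n x. \<bar>deriv (\<kappa> n) x\<bar> * \<bar>x - a\<bar> \<le> C"
    "\<And>n x. \<sigma> * (x - a) \<le> 1 / real (Suc n) \<Longrightarrow> \<kappa> n x = 0"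
    "\<And>x. \<sigma> * (x - a) > 0 \<Longrightarrow> \<forall>\<^sub>F n in sequentially. \<kappa> n x = 1 \<and> deriv (\<kappa> n) x = 0"
proof -
  obtain s where s: "smooth1 s" "\<And>x. x \<le> 0 \<Longrightarrow> s x = 0" "\<And>x. x \<ge> 1 \<Longrightarrow> s x = 1"
    "\<And>x. 0 \<le> s x \<and> s x \<le> 1"
    using smooth_step_exists by blast
  have ds: "deriv s x = 0" if "x < 0 \<or> x > 1" for x
    using that deriv_eq_0_open[of "{..<0}" x s 0] deriv_eq_0_open[of "{1<..}" x s 1] s by auto
  obtain C0 where C0: "C0 \<ge> 0" "\<And>x. \<bar>deriv s x\<bar> \<le> C0"
    using smooth1_bounded_interval[OF smooth1_deriv[OF s(1)], of 0 1] ds by blast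
  define \<kappa> where "\<kappa> = (\<lambda>n x. s (real (Suc n) * \<sigma> * x + (- real (Suc n) * \<sigma> * a - 1)))"
  have \<kappa>_alt: "\<kappa> n x = s (real (Suc n) * (\<sigma> * (x - a)) - 1)" for n x
    by (simp add: \<kappa>_def algebra_simps)
  have dk: "deriv (\<kappa> n) x = deriv s (real (Suc n) * (\<sigma> * (x - a)) - 1) * (real (Suc n) * \<sigma>)" for n x
  proof -
    have "(\<kappa> n has_real_derivative deriv s (real (Suc n) * (\<sigma> * (x - a)) - 1) * (real (Suc n) * \<sigma>)) (at x)"
      unfolding \<kappa>_alt[abs_def]
      by (rule DERIV_chain2[OF smooth1_has_deriv0[OF s(1)]]) (auto intro!: derivative_eq_intros)
    then show ?thesis by (rule DERIV_imp_deriv)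
  qed
  show thesis
  proof (rule that[of \<kappa> "2 * C0"])
    show "smooth1 (\<kappa> n)" for n unfolding \<kappa>_def by (rule smooth1_affine[OF s(1)])
    show "\<bar>\<kappa> n x\<bar> \<le> 1" for n x unfolding \<kappa>_def using s(4) by (smt (verit))
    show "2 * C0 \<ge> 0" using C0 by simp
    show "\<bar>deriv (\<kappa> n) x\<bar> * \<bar>x - a\<bar> \<le> 2 * C0" for n x
    proof (cases "real (Suc n) * (\<sigma> * (x - a)) - 1 < 0 \<or> real (Suc n) * (\<sigma> * (x - a)) - 1 > 1")
      case True
      then show ?thesis using ds C0 by (simp add: dk del: of_nat_Suc)
    next
      case False
      then have "0 \<le> real (Suc n) * (\<sigma> * (x - a))" "real (Suc n) * (\<sigma> * (x - a)) \<le> 2" by linarith+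
      moreover have "real (Suc n) * \<bar>x - a\<bar> = \<bar>real (Suc n) * (\<sigma> * (x - a))\<bar>"
        using \<sigma> by (auto simp: abs_mult)
      ultimately have *: "real (Suc n) * \<bar>x - a\<bar> \<le> 2" by linarith
      have "\<bar>deriv (\<kappa> n) x\<bar> * \<bar>x - a\<bar> =
          \<bar>deriv s (real (Suc n) * (\<sigma> * (x - a)) - 1)\<bar> * (real (Suc n) * \<bar>x - a\<bar>)"
        using \<sigma> by (auto simp: dk abs_mult)
      also have "\<dots> \<le> C0 * 2" using * C0 by (intro mult_mono) auto
      finally show ?thesis by simp
    qed
    show "\<kappa> n x = 0" if "\<sigma> * (x - a) \<le> 1 / real (Suc n)" for n x
    proof -
      have "real (Suc n) * (\<sigma> * (x - a)) \<le> 1"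
        using that by (simp add: pos_le_divide_eq mult.commute del: of_nat_Suc)
      then show ?thesis unfolding \<kappa>_alt by (intro s(2)) simp
    qed
    show "\<forall>\<^sub>F n in sequentially. \<kappa> n x = 1 \<and> deriv (\<kappa> n) x = 0" if pos: "\<sigma> * (x - a) > 0" for x
    proof -
      obtain N where N: "real N * (\<sigma> * (x - a)) > 2" using reals_Archimedean3[OF pos] by blast
      have "\<kappa> n x = 1 \<and> deriv (\<kappa> n) x = 0" if n: "n \<ge> N" for n
      proof -
        have "real (Suc n) * (\<sigma> * (x - a)) \<ge> real N * (\<sigma> * (x - a))"
          using n pos by (intro mult_right_mono) simp_all
        then have *: "real (Suc n) * (\<sigma> * (x - a)) > 2" using N by linarith
        then show ?thesis unfolding \<kappa>_alt dk 
          by (intro conjI) (intro s(3), linarith, subst ds, linarith, simp)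
      qed
      then show ?thesis unfolding eventually_sequentially by blast
    qed
  qed
qed

text \<open>\<open>G b l\<close> is the weak \<open>l\<close>-th derivative in direction \<open>b\<close> of a function on the slab \<open>0 < z \<bullet> \<tau> < T\<close>,
  extended by zero. Pure derivatives suffice, since they control all Fourier coefficients.\<close>
locale slab_sobolev =
  fixes \<tau> :: "'a::euclidean_space" and T :: real and k :: nat and G :: "'a \<Rightarrow> nat \<Rightarrow> 'a \<Rightarrow> real"
  assumes tau: "\<tau> \<in> Basis" and T_pos: "0 < T"
    and G_meas: "\<And>b l. b \<in> Basis \<Longrightarrow> l \<le> k \<Longrightarrow> G b l \<in> borel_measurable borel"
    and G_supp: "\<And>b l z. \<not> (0 < z \<bullet> \<tau> \<and> z \<bullet> \<tau> < T) \<Longrightarrow> G b l z = 0"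
    and G_sq: "\<And>b l c d. b \<in> Basis \<Longrightarrow> l \<le> k \<Longrightarrow>
      integrable lborel (\<lambda>z. indicator (cbox c d) z * (G b l z)\<^sup>2)"
    and G_ibp: "\<And>b l p lo hi. b \<in> Basis \<Longrightarrow> l < k \<Longrightarrow> smooth_box p lo hi \<Longrightarrow>
      0 < lo \<bullet> \<tau> \<Longrightarrow> hi \<bullet> \<tau> < T \<Longrightarrow>
      (\<integral>z. tens (p(b := deriv (p b))) z * G b l z \<partial>lborel) = - (\<integral>z. tens p z * G b (Suc l) z \<partial>lborel)"
begin

section \<open>Integration by parts up to one end of the slab\<close>

lemma G_int1:
  assumes "b \<in> Basis" "l \<le> k"
  shows "integrable lborel (\<lambda>z. indicator (cbox c d) z * \<bar>G b l z\<bar>)"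
proof (rule Bochner_Integration.integrable_bound)
  show "integrable lborel (\<lambda>z. indicator (cbox c d) z + indicator (cbox c d) z * (G b l z)\<^sup>2)"
    using G_sq[OF assms] by (intro Bochner_Integration.integrable_add) (auto simp: emeasure_lborel_cbox_eq)
  show "(\<lambda>z. indicator (cbox c d) z * \<bar>G b l z\<bar>) \<in> borel_measurable lborel"
    using G_meas[OF assms] by measurable
  have "\<bar>x\<bar> \<le> 1 + x\<^sup>2" for x :: real
    using zero_le_power2[of "\<bar>x\<bar> - 1/2"] by (simp add: power2_eq_square algebra_simps)
  then show "AE z in lborel. norm (indicator (cbox c d) z * \<bar>G b l z\<bar>)
      \<le> norm (indicator (cbox c d) z + indicator (cbox c d) z * (G b l z)\<^sup>2)"
    by (auto simp: indicator_def intro!: AE_I2)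
qed

lemma G_int:
  assumes "b \<in> Basis" "l \<le> k" "u \<in> borel_measurable borel" "\<And>z. \<bar>u z\<bar> \<le> C"
    "\<And>z. z \<notin> cbox c d \<Longrightarrow> u z = 0"
  shows "integrable lborel (\<lambda>z. u z * G b l z)"
proof (rule Bochner_Integration.integrable_bound)
  show "integrable lborel (\<lambda>z. C * (indicator (cbox c d) z * \<bar>G b l z\<bar>))"
    using G_int1[OF assms(1,2)] by simp
  show "(\<lambda>z. u z * G b l z) \<in> borel_measurable lborel"
    using G_meas[OF assms(1,2)] assms(3) by measurable
  have "\<bar>u z\<bar> * \<bar>G b l z\<bar> \<le> \<bar>C\<bar> * (indicator (cbox c d) z * \<bar>G b l z\<bar>)" for z
    using assms(4)[of z] assms(5)[of z] by (cases "z \<in> cbox c d") (auto intro!: mult_right_mono)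
  then show "AE z in lborel. norm (u z * G b l z) \<le> norm (C * (indicator (cbox c d) z * \<bar>G b l z\<bar>))"
    by (auto simp: abs_mult intro!: AE_I2)
qed

lemma G_int_tens:
  assumes "b \<in> Basis" "l \<le> k" "smooth_box p lo hi"
  shows "integrable lborel (\<lambda>z. tens p z * G b l z)"
  using G_int[OF assms(1,2) tens_measurable[OF assms(3)]] tens_bounded[OF assms(3)] tens_zero[OF assms(3)]
  by blast

text \<open>Dominated convergence. Bound and convergence are demanded inside the slab only: beyond
  the end the cut-off functions vanish and do not approach the original test function, but
  \<open>G\<close> is zero there.\<close>

lemma G_limit:
  assumes b: "b \<in> Basis" "l \<le> k" and m: "\<And>n. w n \<in> borel_measurable borel" and m': "w' \<in> borel_measurable borel"
    and bd: "\<And>n z. 0 < z \<bullet> \<tau> \<Longrightarrow> z \<bullet> \<tau> < T \<Longrightarrow> \<bar>w n z\<bar> \<le> C"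
    and z: "\<And>n z. z \<notin> cbox c d \<Longrightarrow> w n z = 0"
    and lim: "\<And>z. 0 < z \<bullet> \<tau> \<Longrightarrow> z \<bullet> \<tau> < T \<Longrightarrow> (\<lambda>n. w n z) \<longlonglongrightarrow> w' z"
  shows "(\<lambda>n. \<integral>z. w n z * G b l z \<partial>lborel) \<longlonglongrightarrow> (\<integral>z. w' z * G b l z \<partial>lborel)"
proof (rule integral_dominated_convergence)
  show "(\<lambda>z. w' z * G b l z) \<in> borel_measurable lborel" "(\<lambda>z. w n z * G b l z) \<in> borel_measurable lborel" for n
    using G_meas[OF b] m m' by (auto intro!: borel_measurable_times)
  show "integrable lborel (\<lambda>z. C * (indicator (cbox c d) z * \<bar>G b l z\<bar>))"
    using G_int1[OF b] by simp
  show "AE z in lborel. (\<lambda>n. w n z * G b l z) \<longlonglongrightarrow> w' z * G b l z"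
  proof (rule AE_I2)
    fix z show "(\<lambda>n. w n z * G b l z) \<longlonglongrightarrow> w' z * G b l z"
      using lim[of z] G_supp[of z b l] by (cases "0 < z \<bullet> \<tau> \<and> z \<bullet> \<tau> < T") (auto intro!: tendsto_intros)
  qed
  have "\<bar>w n z\<bar> * \<bar>G b l z\<bar> \<le> C * (indicator (cbox c d) z * \<bar>G b l z\<bar>)" for n z
    using bd[of z n] z[of z n] G_supp[of z b l]
    by (cases "0 < z \<bullet> \<tau> \<and> z \<bullet> \<tau> < T"; cases "z \<in> cbox c d") (auto intro!: mult_right_mono)
  then show "AE z in lborel. norm (w n z * G b l z) \<le> C * (indicator (cbox c d) z * \<bar>G b l z\<bar>)" for n
    by (auto simp: abs_mult intro!: AE_I2)
qed

text \<open>The test function is cut off near the endpoint \<open>a\<close> by \<open>\<kappa> n\<close>. In the direction \<open>\<tau>\<close> this produces an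
  error term \<open>deriv (\<kappa> n) * p \<tau>\<close>, which is bounded because \<open>p \<tau>\<close> vanishes at \<open>a\<close> and tends to zero pointwise.\<close>
lemma ibp_boundary:
  assumes b: "b \<in> Basis" "l < k" and p: "smooth_box p lo hi"
    and a: "a = 0 \<and> \<sigma> = 1 \<or> a = T \<and> \<sigma> = -1"
    and far: "\<And>x. \<sigma> * (x - a) \<ge> e \<Longrightarrow> p \<tau> x = 0" and e: "0 < e" "e < T"
    and van: "b = \<tau> \<Longrightarrow> p \<tau> a = 0"
  shows "(\<integral>z. tens (p(b := deriv (p b))) z * G b l z \<partial>lborel) = - (\<integral>z. tens p z * G b (Suc l) z \<partial>lborel)"
proof -
  obtain \<kappa> C where \<kappa>: "\<And>n. smooth1 (\<kappa> n)" "\<And>n x. \<bar>\<kappa> n x\<bar> \<le> (1::real)" "C \<ge> 0"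
    "\<And>n x. \<bar>deriv (\<kappa> n) x\<bar> * \<bar>x - a\<bar> \<le> C"
    "\<And>n x. \<sigma> * (x - a) \<le> 1 / real (Suc n) \<Longrightarrow> \<kappa> n x = 0"
    "\<And>x. \<sigma> * (x - a) > 0 \<Longrightarrow> \<forall>\<^sub>F n in sequentially. \<kappa> n x = 1 \<and> deriv (\<kappa> n) x = 0"
  proof (rule endpoint_cutoff)
    show "\<sigma> = 1 \<or> \<sigma> = - 1" using a by auto
  qed (rule that)
  have sm: "smooth1 (p c)" if "c \<in> Basis" for c using p that by (auto simp: smooth_box_def)
  define p\<kappa> where "p\<kappa> = (\<lambda>n. p(\<tau> := \<lambda>x. \<kappa> n x * p \<tau> x))"
  have tens_p\<kappa>: "tens (p\<kappa> n) z = \<kappa> n (z \<bullet> \<tau>) * tens p z" for n z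
    using tens_mult_upd[OF tau, of p "\<kappa> n" "p \<tau>"] by (simp add: p\<kappa>_def)
  define r where "r = (\<lambda>n z. if b = \<tau> then deriv (\<kappa> n) (z \<bullet> \<tau>) * tens p z else 0)"
  have d\<kappa>: "tens ((p\<kappa> n)(b := deriv (p\<kappa> n b))) z = \<kappa> n (z \<bullet> \<tau>) * tens (p(b := deriv (p b))) z + r n z" for n z
  proof (cases "b = \<tau>")
    case True
    have "deriv (\<lambda>x. \<kappa> n x * p \<tau> x) = (\<lambda>x. deriv (\<kappa> n) x * p \<tau> x + deriv (p \<tau>) x * \<kappa> n x)"
      by (intro ext DERIV_imp_deriv DERIV_mult smooth1_has_deriv0 \<kappa>(1) sm tau)
    then show ?thesis
      using True tens_upd[OF tau, of p "p \<tau>" z]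
      by (simp add: p\<kappa>_def r_def tens_upd[OF tau] algebra_simps)
  next
    case False
    then have "(p\<kappa> n)(b := deriv (p\<kappa> n b)) = (p(b := deriv (p b)))(\<tau> := \<lambda>x. \<kappa> n x * (p(b := deriv (p b))) \<tau> x)"
      by (auto simp: p\<kappa>_def fun_eq_iff)
    then show ?thesis
      using False tens_mult_upd[OF tau, of "p(b := deriv (p b))" "\<kappa> n" "(p(b := deriv (p b))) \<tau>" z]
      by (simp only: r_def if_False fun_upd_triv add_0_right)
  qed
  have step: "(\<integral>z. tens ((p\<kappa> n)(b := deriv (p\<kappa> n b))) z * G b l z \<partial>lborel) = - (\<integral>z. tens (p\<kappa> n) z * G b (Suc l) z \<partial>lborel)" for n
  proof -
    define m where "m = min (1 / real (Suc n)) (T/2)"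
    have m: "0 < m" "m \<le> 1 / real (Suc n)" "m < T" using T_pos by (auto simp: m_def)
    \<comment> \<open>The time support is shrunk to a compact part of (0, T): the cutoff keeps
      distance \<open>m\<close> from the end \<open>a\<close>, and \<open>far\<close> bounds the
      distance from \<open>a\<close> by \<open>e\<close>. The interior rule \<open>G_ibp\<close>
      then applies.\<close>
    define L where "L = (if \<sigma> = 1 then m else T - e)"
    define H where "H = (if \<sigma> = 1 then e else T - m)"
    define lo' where "lo' = lo + (L - lo \<bullet> \<tau>) *\<^sub>R \<tau>"
    define hi' where "hi' = hi + (H - hi \<bullet> \<tau>) *\<^sub>R \<tau>"
    have lo': "c \<in> Basis \<Longrightarrow> lo' \<bullet> c = (if c = \<tau> then L else lo \<bullet> c)" for c
      using tau by (auto simp: lo'_def inner_add_left inner_Basis)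
    have hi': "c \<in> Basis \<Longrightarrow> hi' \<bullet> c = (if c = \<tau> then H else hi \<bullet> c)" for c
      using tau by (auto simp: hi'_def inner_add_left inner_Basis)
    have z: "\<kappa> n x * p \<tau> x = 0" if "x < L \<or> x > H" for x
    proof -
      have "\<sigma> * (x - a) \<le> m \<or> \<sigma> * (x - a) \<ge> e"
        using a that m e by (auto simp: L_def H_def)
      then show ?thesis using \<kappa>(5)[of x n] far[of x] m by auto
    qed
    have "smooth_box (p\<kappa> n) lo' hi'"
      using p z \<kappa>(1)[of n] by (auto simp: smooth_box_def p\<kappa>_def lo' hi' intro!: smooth1_mult)
    moreover have "0 < lo' \<bullet> \<tau>" "hi' \<bullet> \<tau> < T" using a m e T_pos by (auto simp: lo' hi' tau L_def H_def)
    ultimately show ?thesis using G_ibp[OF b] by blast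
  qed
  obtain B where B: "B \<ge> 0" "\<And>z. \<bar>tens p z\<bar> \<le> B" using tens_bounded[OF p] by blast
  obtain B' where B': "B' \<ge> 0" "\<And>z. \<bar>tens (p(b := deriv (p b))) z\<bar> \<le> B'"
    using tens_bounded[OF smooth_box_deriv[OF p b(1)]] by blast
  have in_slab: "\<sigma> * (t - a) > 0" if "0 < t" "t < T" for t using a that by auto
  have m\<kappa>: "(\<lambda>z. \<kappa> n (z \<bullet> \<tau>)) \<in> borel_measurable borel" "(\<lambda>z. deriv (\<kappa> n) (z \<bullet> \<tau>)) \<in> borel_measurable borel" for n
  proof -
    have "(\<lambda>z. q (z \<bullet> \<tau>)) \<in> borel_measurable borel" if "smooth1 q" for q
      by (intro borel_measurable_continuous_onI continuous_on_compose2[OF smooth1_continuous[OF that, of UNIV]])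
         (auto intro!: continuous_intros)
    then show "(\<lambda>z. \<kappa> n (z \<bullet> \<tau>)) \<in> borel_measurable borel" "(\<lambda>z. deriv (\<kappa> n) (z \<bullet> \<tau>)) \<in> borel_measurable borel"
      using \<kappa>(1) smooth1_deriv by blast+
  qed
  have lim1: "(\<lambda>n. \<integral>z. tens (p\<kappa> n) z * G b (Suc l) z \<partial>lborel) \<longlonglongrightarrow> (\<integral>z. tens p z * G b (Suc l) z \<partial>lborel)"
  proof (rule G_limit[where C = B and c = lo and d = hi])
    show "\<bar>tens (p\<kappa> n) z\<bar> \<le> B" for n z
    proof -
      have "\<bar>\<kappa> n (z \<bullet> \<tau>)\<bar> * \<bar>tens p z\<bar> \<le> 1 * B" by (intro mult_mono \<kappa> B) auto
      then show ?thesis by (simp add: tens_p\<kappa> abs_mult)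
    qed
    show "(\<lambda>n. tens (p\<kappa> n) z) \<longlonglongrightarrow> tens p z" if "0 < z \<bullet> \<tau>" "z \<bullet> \<tau> < T" for z
      by (intro tendsto_eventually, rule eventually_mono[OF \<kappa>(6)[OF in_slab[OF that]]]) (simp add: tens_p\<kappa>)
  qed (use b m\<kappa> tens_measurable[OF p] tens_zero[OF p] in \<open>auto simp: tens_p\<kappa>\<close>)
  have r_bd: "\<exists>B''\<ge>0. \<forall>n z. \<bar>r n z\<bar> \<le> B''"
  proof (cases "b = \<tau>")
    case True
    obtain L where L: "L \<ge> 0" "\<And>x. \<bar>deriv (p \<tau>) x\<bar> \<le> L"
      using smooth_box_bounded[OF smooth_box_deriv[OF p tau] tau] by auto
    have pL: "\<bar>p \<tau> x\<bar> \<le> L * \<bar>x - a\<bar>" for x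
    proof -
      have "norm (p \<tau> x - p \<tau> a) \<le> L * norm (x - a)"
        by (rule field_differentiable_bound[of UNIV "p \<tau>" "deriv (p \<tau>)"])
           (use smooth1_has_deriv0[OF sm[OF tau]] L in auto)
      then show ?thesis using van True by simp
    qed
    define P1 where "P1 = (\<lambda>z. \<Prod>c\<in>Basis - {\<tau>}. p c (z \<bullet> c))"
    have "\<forall>c\<in>Basis. \<exists>Bc\<ge>0. \<forall>x. \<bar>p c x\<bar> \<le> Bc"
      using smooth_box_bounded[OF p] by blast
    then obtain Bc where Bc: "\<And>c. c \<in> Basis \<Longrightarrow> Bc c \<ge> 0" "\<And>c x. c \<in> Basis \<Longrightarrow> \<bar>p c x\<bar> \<le> Bc c" by metis
    have P1: "\<bar>P1 z\<bar> \<le> prod Bc (Basis - {\<tau>})" for z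
      unfolding P1_def abs_prod using Bc by (intro prod_mono) auto
    have "\<bar>r n z\<bar> \<le> C * L * prod Bc (Basis - {\<tau>})" for n z
    proof -
      have "\<bar>r n z\<bar> = \<bar>deriv (\<kappa> n) (z \<bullet> \<tau>)\<bar> * \<bar>p \<tau> (z \<bullet> \<tau>)\<bar> * \<bar>P1 z\<bar>"
        using tens_upd[OF tau, of p "p \<tau>" z] True by (simp add: r_def P1_def abs_mult)
      also have "\<dots> \<le> \<bar>deriv (\<kappa> n) (z \<bullet> \<tau>)\<bar> * (L * \<bar>z \<bullet> \<tau> - a\<bar>) * prod Bc (Basis - {\<tau>})"
        using pL P1 L by (intro mult_mono mult_nonneg_nonneg) auto
      also have "\<dots> = (\<bar>deriv (\<kappa> n) (z \<bullet> \<tau>)\<bar> * \<bar>z \<bullet> \<tau> - a\<bar>) * (L * prod Bc (Basis - {\<tau>}))"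
        by (simp add: mult_ac)
      also have "\<dots> \<le> C * (L * prod Bc (Basis - {\<tau>}))"
        using \<kappa>(4) L Bc(1) by (intro mult_right_mono mult_nonneg_nonneg prod_nonneg) auto
      finally show ?thesis by (simp add: mult_ac)
    qed
    moreover have "0 \<le> C * L * prod Bc (Basis - {\<tau>})"
      using \<kappa>(3) L Bc(1) by (intro mult_nonneg_nonneg prod_nonneg) auto
    ultimately show ?thesis by blast
  qed (auto simp: r_def)
  then obtain B'' where B'': "B'' \<ge> 0" "\<And>n z. \<bar>r n z\<bar> \<le> B''" by blast
  have lim2: "(\<lambda>n. \<integral>z. tens ((p\<kappa> n)(b := deriv (p\<kappa> n b))) z * G b l z \<partial>lborel) \<longlonglongrightarrow> (\<integral>z. tens (p(b := deriv (p b))) z * G b l z \<partial>lborel)"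
  proof (rule G_limit[where C = "B' + B''" and c = lo and d = hi])
    show "\<bar>tens ((p\<kappa> n)(b := deriv (p\<kappa> n b))) z\<bar> \<le> B' + B''" for n z
    proof -
      have "\<bar>\<kappa> n (z \<bullet> \<tau>)\<bar> * \<bar>tens (p(b := deriv (p b))) z\<bar> \<le> 1 * B'"
        by (intro mult_mono \<kappa> B') auto
      then show ?thesis unfolding d\<kappa> using B''(2)[of n z] by (simp add: abs_mult[symmetric])
    qed
    show "(\<lambda>n. tens ((p\<kappa> n)(b := deriv (p\<kappa> n b))) z) \<longlonglongrightarrow> tens (p(b := deriv (p b))) z"
      if "0 < z \<bullet> \<tau>" "z \<bullet> \<tau> < T" for z
      by (intro tendsto_eventually, rule eventually_mono[OF \<kappa>(6)[OF in_slab[OF that]]]) (simp add: d\<kappa> r_def)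
    show "tens ((p\<kappa> n)(b := deriv (p\<kappa> n b))) z = 0" if "z \<notin> cbox lo hi" for n z
      using tens_zero[OF p that] tens_zero[OF smooth_box_deriv[OF p b(1)] that] by (simp add: d\<kappa> r_def)
    show "tens ((p\<kappa> n)(b := deriv (p\<kappa> n b))) \<in> borel_measurable borel" for n
      unfolding d\<kappa>[abs_def] r_def
      using m\<kappa> tens_measurable[OF p] tens_measurable[OF smooth_box_deriv[OF p b(1)]] by auto
  qed (use b tens_measurable[OF smooth_box_deriv[OF p b(1)]] in auto)
  have "(\<lambda>n. - (\<integral>z. tens (p\<kappa> n) z * G b (Suc l) z \<partial>lborel)) \<longlonglongrightarrow> - (\<integral>z. tens p z * G b (Suc l) z \<partial>lborel)"
    using lim1 by (rule tendsto_minus)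
  with lim2 show ?thesis unfolding step by (rule LIMSEQ_unique)
qed

end

section \<open>Bessel's inequality for trigonometric tensor products\<close>

text \<open>The norms need not be equal. Expanding the square of the residual with the coefficients
  c/A, a squared norm smaller than \<open>A\<close> only decreases the last term.\<close>

lemma bessel_inequality:
  fixes u :: "'i \<Rightarrow> 'b \<Rightarrow> real"
  assumes fin: "finite J" and A: "A > 0"
    and uu: "\<And>i j. i \<in> J \<Longrightarrow> j \<in> J \<Longrightarrow> integrable M (\<lambda>x. u i x * u j x)"
    and orth: "\<And>i j. i \<in> J \<Longrightarrow> j \<in> J \<Longrightarrow> i \<noteq> j \<Longrightarrow> (\<integral>x. u i x * u j x \<partial>M) = 0"
    and nrm: "\<And>i. i \<in> J \<Longrightarrow> (\<integral>x. u i x * u i x \<partial>M) \<le> A"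
    and g2: "integrable M (\<lambda>x. (g x)\<^sup>2)"
    and gu: "\<And>i. i \<in> J \<Longrightarrow> integrable M (\<lambda>x. g x * u i x)"
  shows "(\<Sum>i\<in>J. (\<integral>x. g x * u i x \<partial>M)\<^sup>2) \<le> A * (\<integral>x. (g x)\<^sup>2 \<partial>M)"
proof -
  define c where "c = (\<lambda>i. (\<integral>x. g x * u i x \<partial>M))"
  define \<gamma> where "\<gamma> = (\<lambda>i. c i / A)"
  have eq: "(g x - (\<Sum>i\<in>J. \<gamma> i * u i x))\<^sup>2 =
      (g x)\<^sup>2 - 2 * (\<Sum>i\<in>J. \<gamma> i * (g x * u i x)) + (\<Sum>i\<in>J. \<Sum>j\<in>J. \<gamma> i * \<gamma> j * (u i x * u j x))" for x
    by (simp add: power2_eq_square algebra_simps sum_distrib_left sum_distrib_right sum_product)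
  have "0 \<le> (\<integral>x. (g x - (\<Sum>i\<in>J. \<gamma> i * u i x))\<^sup>2 \<partial>M)" by simp
  also have "\<dots> = (\<integral>x. (g x)\<^sup>2 \<partial>M) - 2 * (\<Sum>i\<in>J. \<gamma> i * c i) + (\<Sum>i\<in>J. \<Sum>j\<in>J. \<gamma> i * \<gamma> j * (\<integral>x. u i x * u j x \<partial>M))"
    unfolding eq using g2 gu uu fin by (simp add: c_def integrable_sum)
  also have "(\<Sum>i\<in>J. \<Sum>j\<in>J. \<gamma> i * \<gamma> j * (\<integral>x. u i x * u j x \<partial>M)) = (\<Sum>i\<in>J. \<gamma> i * \<gamma> i * (\<integral>x. u i x * u i x \<partial>M))"
  proof (rule sum.cong[OF refl])
    fix i assume i: "i \<in> J"
    have "(\<Sum>j\<in>J. \<gamma> i * \<gamma> j * (\<integral>x. u i x * u j x \<partial>M)) = (\<Sum>j\<in>J. if j = i then \<gamma> i * \<gamma> i * (\<integral>x. u i x * u i x \<partial>M) else 0)"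
      using orth i by (intro sum.cong) auto
    then show "(\<Sum>j\<in>J. \<gamma> i * \<gamma> j * (\<integral>x. u i x * u j x \<partial>M)) = \<gamma> i * \<gamma> i * (\<integral>x. u i x * u i x \<partial>M)"
      using fin i by simp
  qed
  also have "\<dots> \<le> (\<Sum>i\<in>J. \<gamma> i * \<gamma> i * A)"
    using nrm by (intro sum_mono mult_left_mono) auto
  also have "(\<integral>x. (g x)\<^sup>2 \<partial>M) - 2 * (\<Sum>i\<in>J. \<gamma> i * c i) + (\<Sum>i\<in>J. \<gamma> i * \<gamma> i * A)
      = (\<integral>x. (g x)\<^sup>2 \<partial>M) - (\<Sum>i\<in>J. (c i)\<^sup>2) / A"
    using A by (simp add: \<gamma>_def sum_divide_distrib sum_distrib_left power2_eq_square flip: sum_subtractf)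
       (simp add: sum_negf sum_divide_distrib)
  finally show ?thesis using A by (simp add: c_def field_simps)
qed

lemma lborel_prod_integral:
  fixes p :: "'a::euclidean_space \<Rightarrow> real \<Rightarrow> real"
  assumes "\<And>b. b \<in> Basis \<Longrightarrow> integrable lborel (p b)"
  shows "integrable lborel (\<lambda>z::'a. \<Prod>b\<in>Basis. p b (z \<bullet> b))"
    and "(\<integral>z. (\<Prod>b\<in>(Basis::'a set). p b (z \<bullet> b)) \<partial>lborel) = (\<Prod>b\<in>Basis. \<integral>x. p b x \<partial>lborel)"
proof -
  interpret product_sigma_finite "\<lambda>_::'a. lborel :: real measure" by standard
  have m: "(\<lambda>f. \<Sum>b\<in>Basis. f b *\<^sub>R b) \<in> measurable (\<Pi>\<^sub>M b\<in>(Basis::'a set). lborel) (borel::'a measure)"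
    by measurable
  have pm: "(\<lambda>z::'a. \<Prod>b\<in>Basis. p b (z \<bullet> b)) \<in> borel_measurable borel"
  proof (intro borel_measurable_prod)
    fix b :: 'a assume "b \<in> Basis"
    then have [measurable]: "p b \<in> borel_measurable borel" using assms by (auto dest: borel_measurable_integrable)
    show "(\<lambda>z. p b (z \<bullet> b)) \<in> borel_measurable borel" by measurable
  qed
  have eq: "(\<Prod>b\<in>Basis. p b ((\<Sum>b\<in>Basis. f b *\<^sub>R b) \<bullet> b)) = (\<Prod>b\<in>Basis. p b (f b))" for f :: "'a \<Rightarrow> real"
    by (intro prod.cong) auto
  show "integrable lborel (\<lambda>z::'a. \<Prod>b\<in>Basis. p b (z \<bullet> b))"
    by (subst lborel_eq, subst integrable_distr_eq[OF m pm], unfold eq)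
       (intro product_integrable_prod assms, auto)
  show "(\<integral>z. (\<Prod>b\<in>(Basis::'a set). p b (z \<bullet> b)) \<partial>lborel) = (\<Prod>b\<in>Basis. \<integral>x. p b x \<partial>lborel)"
    by (subst lborel_eq, subst integral_distr[OF m pm], unfold eq)
       (intro product_integral_prod assms, auto)
qed

lemma integrable_Icc_mult:
  fixes f :: "real \<Rightarrow> real"
  assumes "continuous_on UNIV f"
  shows "integrable lborel (\<lambda>x. indicator {a..b} x * f x)"
  using borel_integrable_atLeastAtMost'[OF continuous_on_subset[OF assms subset_UNIV], of a b]
  by (simp add: set_integrable_def)

lemma cos_integral_period:
  fixes K :: int
  assumes R: "R > 0"
  shows "(\<integral>x. indicator {-R..R} x * cos (pi / R * real_of_int K * x + c) \<partial>lborel) = (if K = 0 then 2 * R * cos c else 0)"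
proof (cases "K = 0")
  case True
  then show ?thesis using R by (simp add: mult.commute)
next
  case False
  define w where "w = pi / R * real_of_int K"
  have w: "w \<noteq> 0" using False R by (simp add: w_def)
  have "(\<integral>x. indicator {-R..R} x *\<^sub>R cos (w * x + c) \<partial>lborel) = sin (w * R + c) / w - sin (w * (- R) + c) / w"
  proof (rule integral_FTC_atLeastAtMost)
    show "((\<lambda>x. sin (w * x + c) / w) has_vector_derivative cos (w * x + c)) (at x within {-R..R})" for x
      unfolding has_real_derivative_iff_has_vector_derivative[symmetric]
      using w by (auto intro!: derivative_eq_intros)
  qed (use R in \<open>auto intro!: continuous_intros\<close>)
  also have "\<dots> = 0"
  proof -
    have "w * R = pi * real_of_int K" using R by (simp add: w_def)
    then have "sin (w * R) = 0" by (simp add: sin_npi_int)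
    then have "sin (w * R + c) = sin (w * (- R) + c)" by (simp only: sin_add mult_minus_right sin_minus cos_minus)
    then show ?thesis by simp
  qed
  finally show ?thesis using False by (simp add: w_def)
qed

text \<open>\<open>cos (x - ph s)\<close> is the cosine or the sine of \<open>x\<close>, so an index
  in \<open>nat \<times> bool\<close> runs through the real trigonometric system.\<close>

definition ph :: "bool \<Rightarrow> real" where "ph s = (if s then pi / 2 else 0)"

text \<open>The product formula leaves the frequencies \<open>y * (n - m)\<close> and
  \<open>y * (n + m)\<close>, integral over the period unless zero. For \<open>n = m\<close> the two
  phases differ by pi/2. For \<open>n = m = 0\<close> both functions are constants, cos (\<psi> 0)
  and sin (\<psi> 0), and they are orthogonal only if one of them vanishes: this is the hypothesis
  on \<psi>.\<close>

lemma trig_orthogonal: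
  assumes R: "R > 0" and y: "y \<noteq> (0::int)" and \<psi>: "cos (\<psi> 0) * sin (\<psi> 0) = 0"
    and ne: "(n, s) \<noteq> (m, s')"
  shows "(\<integral>x. indicator {-R..R} x * (cos (pi / R * (y * real n) * x + \<psi> n - ph s) *
    cos (pi / R * (y * real m) * x + \<psi> m - ph s')) \<partial>lborel) = 0"
proof -
  let ?K1 = "y * (int n - int m)" and ?K2 = "y * (int n + int m)"
  let ?c1 = "(\<psi> n - ph s) - (\<psi> m - ph s')" and ?c2 = "(\<psi> n - ph s) + (\<psi> m - ph s')"
  have eq: "indicator {-R..R} x * (cos (pi / R * (y * real n) * x + \<psi> n - ph s) *
    cos (pi / R * (y * real m) * x + \<psi> m - ph s')) =
    (indicator {-R..R} x * cos (pi / R * real_of_int ?K1 * x + ?c1) +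
      indicator {-R..R} x * cos (pi / R * real_of_int ?K2 * x + ?c2)) / 2" for x
    unfolding cos_times_cos by (simp add: algebra_simps)
  have int: "integrable lborel (\<lambda>x. indicator {-R..R} x * cos (pi / R * real_of_int K * x + c))" for K c
    by (intro integrable_Icc_mult continuous_intros)
  have "(\<integral>x. indicator {-R..R} x * (cos (pi / R * (y * real n) * x + \<psi> n - ph s) *
    cos (pi / R * (y * real m) * x + \<psi> m - ph s')) \<partial>lborel) =
    ((if ?K1 = 0 then 2 * R * cos ?c1 else 0) + (if ?K2 = 0 then 2 * R * cos ?c2 else 0)) / 2"
    unfolding eq integral_divide_zero Bochner_Integration.integral_add[OF int int] cos_integral_period[OF R]
    by (rule refl)
  also have "\<dots> = 0"
  proof (cases "n = m")
    case False
    then show ?thesis using y by simp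
  next
    case True
    then have s: "s \<noteq> s'" using ne by simp
    then have c1: "cos ?c1 = 0" using True by (auto simp: ph_def cos_diff)
    show ?thesis
    proof (cases "n = 0")
      case False
      then show ?thesis using True y c1 by simp
    next
      case n0: True
      have "?c2 = 2 * \<psi> 0 - pi / 2" using s True n0 by (auto simp: ph_def)
      then have "cos ?c2 = sin (2 * \<psi> 0)" by (simp add: cos_diff)
      also have "\<dots> = 0" using \<psi> by (auto simp: sin_double)
      finally show ?thesis using True n0 c1 by simp
    qed
  qed
  finally show ?thesis .
qed

lemma trig_tensor_bessel:
  fixes H :: "'a::euclidean_space \<Rightarrow> real" and y :: "'a \<Rightarrow> int"
  assumes R: "R > 0" and y: "\<And>b. b \<in> Basis \<Longrightarrow> y b \<noteq> 0"
    and \<psi>: "\<And>b. b \<in> Basis \<Longrightarrow> cos (\<psi> b 0) * sin (\<psi> b 0) = 0"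
    and Hm: "H \<in> borel_measurable borel" and H2: "integrable lborel (\<lambda>z. (H z)\<^sup>2)"
    and Hz: "\<And>z b. b \<in> Basis \<Longrightarrow> \<bar>z \<bullet> b\<bar> > R \<Longrightarrow> H z = 0"
    and J: "finite J" "J \<subseteq> (\<Pi>\<^sub>E b\<in>Basis. UNIV)"
  shows "(\<Sum>\<iota>\<in>J. (\<integral>z. H z * (\<Prod>b\<in>Basis. cos (pi / R * (y b * real (fst (\<iota> b))) * (z \<bullet> b)
      + \<psi> b (fst (\<iota> b)) - ph (snd (\<iota> b)))) \<partial>lborel)\<^sup>2) \<le> (2 * R) ^ DIM('a) * (\<integral>z. (H z)\<^sup>2 \<partial>lborel)"
proof -
  define E where "E = (\<lambda>b (\<nu>::nat \<times> bool) x. cos (pi / R * (y b * real (fst \<nu>)) * x + \<psi> b (fst \<nu>) - ph (snd \<nu>)))"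
  have E_cont: "continuous_on UNIV (E b \<nu>)" for b \<nu> unfolding E_def by (intro continuous_intros)
  define u where "u = (\<lambda>\<iota> z. \<Prod>b\<in>Basis. indicator {-R..R} (z \<bullet> b) * E b (\<iota> b) (z \<bullet> b))"
  have uu: "u \<iota> z * u \<kappa> z = (\<Prod>b\<in>Basis. indicator {-R..R} (z \<bullet> b) * (E b (\<iota> b) (z \<bullet> b) * E b (\<kappa> b) (z \<bullet> b)))" for \<iota> \<kappa> z
    unfolding u_def prod.distrib[symmetric] by (intro prod.cong) (auto simp: indicator_def)
  have int1: "integrable lborel (\<lambda>x. indicator {-R..R} x * (E b (\<iota> b) x * E b (\<kappa> b) x))" for b \<iota> \<kappa>
    by (intro integrable_Icc_mult continuous_intros E_cont)
  have u_int: "integrable lborel (u \<iota>)" for \<iota>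
    unfolding u_def[abs_def] by (intro lborel_prod_integral(1) integrable_Icc_mult E_cont)
  have u_le: "\<bar>u \<iota> z\<bar> \<le> 1" for \<iota> z
    unfolding u_def abs_prod by (intro prod_le_1) (auto simp: E_def indicator_def)
  have Hu: "H z * u \<iota> z = H z * (\<Prod>b\<in>Basis. E b (\<iota> b) (z \<bullet> b))" for \<iota> z
  proof (cases "\<exists>b\<in>Basis. \<bar>z \<bullet> b\<bar> > R")
    case False
    then show ?thesis unfolding u_def by (intro arg_cong2[where f = "(*)"] prod.cong) (auto simp: indicator_def not_less abs_le_iff)
  qed (use Hz in auto)
  have "(\<Sum>\<iota>\<in>J. (\<integral>z. H z * u \<iota> z \<partial>lborel)\<^sup>2) \<le> (2 * R) ^ DIM('a) * (\<integral>z. (H z)\<^sup>2 \<partial>lborel)"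
  proof (rule bessel_inequality[OF J(1)])
    show "(2 * R) ^ DIM('a) > 0" using R by simp
    show "integrable lborel (\<lambda>x. u i x * u j x)" for i j
      unfolding uu by (intro lborel_prod_integral(1) int1)
    show "(\<integral>x. u i x * u j x \<partial>lborel) = 0" if ij: "i \<in> J" "j \<in> J" "i \<noteq> j" for i j
    proof -
      \<comment> \<open>Indices are extensional functions, so two different ones differ at a basis
        vector, and the one-dimensional orthogonality in that direction kills the whole
        product.\<close>
      from ij J(2) have "i \<in> (\<Pi>\<^sub>E b\<in>Basis. UNIV)" "j \<in> (\<Pi>\<^sub>E b\<in>Basis. UNIV)" by auto
      with ij(3) obtain b where b: "b \<in> Basis" "i b \<noteq> j b" by (metis PiE_ext)
      obtain n s m s' where ij': "i b = (n, s)" "j b = (m, s')" by (metis surj_pair)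
      have "(\<integral>x. indicator {-R..R} x * (E b (i b) x * E b (j b) x) \<partial>lborel) = 0"
        using trig_orthogonal[OF R y[OF b(1)], where \<psi> = "\<psi> b", OF \<psi>[OF b(1)], where n = n and s = s and m = m and s' = s'] b(2)
        unfolding E_def ij' by simp
      then show ?thesis
        unfolding uu using b(1) by (subst lborel_prod_integral(2)[OF int1]) (auto intro!: prod_zero)
    qed
    show "(\<integral>x. u i x * u i x \<partial>lborel) \<le> (2 * R) ^ DIM('a)" for i
    proof -
      have "(\<integral>x. u i x * u i x \<partial>lborel) = (\<Prod>b\<in>Basis. (\<integral>x. indicator {-R..R} x * (E b (i b) x * E b (i b) x) \<partial>lborel))"
        unfolding uu by (rule lborel_prod_integral(2)[OF int1])
      also have "\<dots> \<le> (\<Prod>b\<in>(Basis::'a set). 2 * R)"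
      proof (intro prod_mono conjI)
        fix b :: 'a assume "b \<in> Basis"
        have EE: "0 \<le> E b (i b) x * E b (i b) x \<and> E b (i b) x * E b (i b) x \<le> 1" for x
          using abs_square_le_1[of "E b (i b) x"] by (auto simp: E_def power2_eq_square)
        show "0 \<le> (\<integral>x. indicator {-R..R} x * (E b (i b) x * E b (i b) x) \<partial>lborel)"
          using EE by (intro integral_nonneg_AE AE_I2) auto
        have "(\<integral>x. indicator {-R..R} x * (E b (i b) x * E b (i b) x) \<partial>lborel) \<le> (\<integral>x. indicator {-R..R} x * 1 \<partial>lborel)"
          by (intro integral_mono int1 integrable_Icc_mult mult_left_mono conjunct2[OF EE]) auto
        then show "(\<integral>x. indicator {-R..R} x * (E b (i b) x * E b (i b) x) \<partial>lborel) \<le> 2 * R"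
          using R by simp
      qed
      finally show ?thesis by simp
    qed
    show "integrable lborel (\<lambda>x. H x * u i x)" for i
    proof (rule Bochner_Integration.integrable_bound)
      show "integrable lborel (\<lambda>z. (H z)\<^sup>2 + u i z * u i z)"
        unfolding uu by (intro Bochner_Integration.integrable_add H2 lborel_prod_integral(1) int1)
      show "(\<lambda>x. H x * u i x) \<in> borel_measurable lborel"
        using borel_measurable_integrable[OF u_int, of i] Hm by simp
      have "\<bar>a * b\<bar> \<le> a\<^sup>2 + b * b" for a b :: real
        using sum_squares_bound[of "\<bar>a\<bar>" "\<bar>b\<bar>"] mult_nonneg_nonneg[OF abs_ge_zero[of a] abs_ge_zero[of b]]
        unfolding power2_eq_square abs_mult abs_mult_self_eq by linarith
      then show "AE x in lborel. norm (H x * u i x) \<le> norm ((H x)\<^sup>2 + u i x * u i x)"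
        by (intro AE_I2) (simp only: real_norm_def, smt (verit) zero_le_power2 zero_le_square)
    qed
  qed (use H2 in auto)
  then show ?thesis unfolding Hu by (simp add: E_def)
qed

text \<open>A \<open>K\<close>-th finite difference annihilates polynomials of degree below
  \<open>K\<close>. For \<open>A = 1\<close>, \<open>B = -2\<close> these are the moment conditions
  that make the reflected sums vanish at the end of the slab.\<close>

lemma alternating_binomial_power_zero:
  assumes "m < K"
  shows "(\<Sum>j\<le>K. (-1) ^ j * of_nat (K choose j) * (A + B * of_nat j) ^ m) = (0::'a::comm_ring_1)"
  using assms
proof (induction K arbitrary: m)
  case (Suc K)
  let ?f = "\<lambda>j. (A + B * of_nat j) ^ m"
  have "(\<Sum>j\<le>Suc K. (-1) ^ j * of_nat (Suc K choose j) * ?f j) =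
      ?f 0 + (\<Sum>j\<le>K. (-1) ^ Suc j * of_nat (Suc K choose Suc j) * ?f (Suc j))"
    by (subst sum.atMost_Suc_shift) simp
  also have "(\<Sum>j\<le>K. (-1) ^ Suc j * of_nat (Suc K choose Suc j) * ?f (Suc j)) =
      (\<Sum>j\<le>K. (-1) ^ Suc j * of_nat (K choose j) * ?f (Suc j)) + (\<Sum>j\<le>K. (-1) ^ Suc j * of_nat (K choose Suc j) * ?f (Suc j))"
    unfolding sum.distrib[symmetric] by (intro sum.cong) (simp_all add: algebra_simps)
  also have "?f 0 + (\<dots>) = (\<Sum>j\<le>K. (-1) ^ Suc j * of_nat (K choose j) * ?f (Suc j)) +
      (\<Sum>j\<le>Suc K. (-1) ^ j * of_nat (K choose j) * ?f j)"
  proof -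
    have "(\<Sum>j\<le>Suc K. (-1) ^ j * of_nat (K choose j) * ?f j) =
        ?f 0 + (\<Sum>j\<le>K. (-1) ^ Suc j * of_nat (K choose Suc j) * ?f (Suc j))"
      by (subst sum.atMost_Suc_shift) simp
    then show ?thesis by (simp only: add_ac)
  qed
  also have "\<dots> = (\<Sum>j\<le>K. (-1) ^ Suc j * of_nat (K choose j) * ?f (Suc j)) + (\<Sum>j\<le>K. (-1) ^ j * of_nat (K choose j) * ?f j)"
    by (simp add: binomial_eq_0)
  also have "\<dots> = - (\<Sum>j\<le>K. (-1) ^ j * of_nat (K choose j) * (?f (Suc j) - ?f j))"
    unfolding sum.distrib[symmetric] sum_negf[symmetric] by (intro sum.cong) (simp_all add: algebra_simps)
  also have "(\<Sum>j\<le>K. (-1) ^ j * of_nat (K choose j) * (?f (Suc j) - ?f j)) =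
     (\<Sum>j\<le>K. \<Sum>i<m. of_nat (m choose i) * B ^ (m - i) * ((-1) ^ j * of_nat (K choose j) * (A + B * of_nat j) ^ i))"
  proof (rule sum.cong[OF refl])
    fix j
    have "?f (Suc j) = ((A + B * of_nat j) + B) ^ m" by (simp add: algebra_simps)
    also have "\<dots> = (\<Sum>i\<le>m. of_nat (m choose i) * (A + B * of_nat j) ^ i * B ^ (m - i))"
      by (rule binomial_ring)
    also have "\<dots> = (\<Sum>i<m. of_nat (m choose i) * (A + B * of_nat j) ^ i * B ^ (m - i)) + ?f j"
      by (simp add: lessThan_Suc_atMost[symmetric])
    finally show "(-1) ^ j * of_nat (K choose j) * (?f (Suc j) - ?f j) =
       (\<Sum>i<m. of_nat (m choose i) * B ^ (m - i) * ((-1) ^ j * of_nat (K choose j) * (A + B * of_nat j) ^ i))"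
      by (simp add: sum_distrib_left mult_ac)
  qed
  also have "\<dots> = (\<Sum>i<m. of_nat (m choose i) * B ^ (m - i) * (\<Sum>j\<le>K. (-1) ^ j * of_nat (K choose j) * (A + B * of_nat j) ^ i))"
    by (subst sum.swap) (simp add: sum_distrib_left)
  also have "\<dots> = 0" using Suc.IH Suc.prems by (intro sum.neutral) auto
  finally show ?case by simp
qed simp

text \<open>Square summability expressed by finite partial sums, so that no infinite sum over
  multi-indices is ever formed.\<close>

definition sq_bounded :: "(('a::euclidean_space \<Rightarrow> nat \<times> bool) \<Rightarrow> real) \<Rightarrow> bool" where
  "sq_bounded A \<longleftrightarrow> (\<exists>C\<ge>0. \<forall>J. finite J \<longrightarrow> J \<subseteq> (\<Pi>\<^sub>E b\<in>Basis. UNIV) \<longrightarrow> (\<Sum>\<iota>\<in>J. (A \<iota>)\<^sup>2) \<le> C)"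

lemma sq_boundedI:
  assumes "C \<ge> 0" "\<And>J. finite J \<Longrightarrow> J \<subseteq> (\<Pi>\<^sub>E b\<in>Basis. UNIV) \<Longrightarrow> (\<Sum>\<iota>\<in>J. (A \<iota>)\<^sup>2) \<le> C"
  shows "sq_bounded A"
  unfolding sq_bounded_def using assms by blast

lemma sq_boundedE:
  assumes "sq_bounded A"
  obtains C where "C \<ge> 0" "\<And>J. finite J \<Longrightarrow> J \<subseteq> (\<Pi>\<^sub>E b\<in>Basis. UNIV) \<Longrightarrow> (\<Sum>\<iota>\<in>J. (A \<iota>)\<^sup>2) \<le> C"
proof -
  from assms obtain C where "C \<ge> 0" "\<forall>J. finite J \<longrightarrow> J \<subseteq> (\<Pi>\<^sub>E b\<in>Basis. UNIV) \<longrightarrow> (\<Sum>\<iota>\<in>J. (A \<iota>)\<^sup>2) \<le> C"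
    unfolding sq_bounded_def by (elim exE conjE)
  then show thesis by (intro that[of C]) simp_all
qed

lemma sq_bounded_add:
  assumes "sq_bounded A" "sq_bounded B"
  shows "sq_bounded (\<lambda>\<iota>. A \<iota> + B \<iota>)"
proof -
  obtain C where C: "C \<ge> 0" "\<And>J. finite J \<Longrightarrow> J \<subseteq> (\<Pi>\<^sub>E b\<in>Basis. UNIV) \<Longrightarrow> (\<Sum>\<iota>\<in>J. (A \<iota>)\<^sup>2) \<le> C"
    using assms(1) by (rule sq_boundedE) blast
  obtain D where D: "D \<ge> 0" "\<And>J. finite J \<Longrightarrow> J \<subseteq> (\<Pi>\<^sub>E b\<in>Basis. UNIV) \<Longrightarrow> (\<Sum>\<iota>\<in>J. (B \<iota>)\<^sup>2) \<le> D"
    using assms(2) by (rule sq_boundedE) blast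
  have sq: "(x + y)\<^sup>2 \<le> 2 * x\<^sup>2 + 2 * y\<^sup>2" for x y :: real
    using zero_le_power2[of "x - y"] by (simp add: power2_eq_square algebra_simps)
  show ?thesis
  proof (rule sq_boundedI)
    show "2 * C + 2 * D \<ge> 0" using C D by simp
    fix J :: "('a \<Rightarrow> nat \<times> bool) set" assume J: "finite J" "J \<subseteq> (\<Pi>\<^sub>E b\<in>Basis. UNIV)"
    have "(\<Sum>\<iota>\<in>J. (A \<iota> + B \<iota>)\<^sup>2) \<le> (\<Sum>\<iota>\<in>J. 2 * (A \<iota>)\<^sup>2 + 2 * (B \<iota>)\<^sup>2)"
      by (intro sum_mono sq)
    also have "\<dots> \<le> 2 * C + 2 * D"
      using C(2)[OF J] D(2)[OF J] by (simp add: sum.distrib flip: sum_distrib_left)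
    finally show "(\<Sum>\<iota>\<in>J. (A \<iota> + B \<iota>)\<^sup>2) \<le> 2 * C + 2 * D" .
  qed
qed

lemma sq_bounded_scale:
  assumes "sq_bounded A" shows "sq_bounded (\<lambda>\<iota>. c * A \<iota>)"
  using assms
proof (rule sq_boundedE)
  fix C assume C: "C \<ge> 0" "\<And>J. finite J \<Longrightarrow> J \<subseteq> (\<Pi>\<^sub>E b\<in>Basis. UNIV) \<Longrightarrow> (\<Sum>\<iota>\<in>J. (A \<iota>)\<^sup>2) \<le> C"
  show ?thesis
    by (rule sq_boundedI[of "c\<^sup>2 * C"])
       (use C in \<open>auto simp: power_mult_distrib sum_distrib_left[symmetric] intro!: mult_left_mono\<close>)
qed

lemma sq_bounded_sum:
  assumes "finite I" "\<And>i. i \<in> I \<Longrightarrow> sq_bounded (A i)"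
  shows "sq_bounded (\<lambda>\<iota>. \<Sum>i\<in>I. A i \<iota>)"
  using assms
proof (induction I rule: finite_induct)
  case empty
  show ?case by (rule sq_boundedI[of 0]) auto
qed (simp add: sq_bounded_add)

text \<open>Localisation at one end \<open>a\<close>: the box of the cutoff \<open>X\<close> may
  stick out of the slab beyond \<open>a\<close>, but stays away from the opposite end. The
  trigonometric functions have period 2 R, and the box fits into one period.\<close>

locale slab_end = slab_sobolev \<tau> T k G
  for \<tau> :: "'a::euclidean_space" and T k and G :: "'a \<Rightarrow> nat \<Rightarrow> 'a \<Rightarrow> real" +
  fixes a R :: real and X :: "'a \<Rightarrow> real \<Rightarrow> real" and lo hi :: 'a and F :: "'a \<Rightarrow> real"
  assumes ends: "a = 0 \<and> hi \<bullet> \<tau> < T \<or> a = T \<and> 0 < lo \<bullet> \<tau>"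
    and X: "smooth_box X lo hi"
    and R_pos: "R > 0"
    and box_R: "\<And>b. b \<in> Basis \<Longrightarrow> - R \<le> lo \<bullet> b" "\<And>b. b \<in> Basis \<Longrightarrow> hi \<bullet> b \<le> R"
    and G0: "\<And>b. b \<in> Basis \<Longrightarrow> G b 0 = F"
begin

lemma ibp_end:
  assumes b: "b \<in> Basis" "l < k" and p: "smooth_box p lo hi"
    and van: "b = \<tau> \<Longrightarrow> p \<tau> a = 0"
  shows "(\<integral>z. tens (p(b := deriv (p b))) z * G b l z \<partial>lborel) = - (\<integral>z. tens p z * G b (Suc l) z \<partial>lborel)"
proof -
  have pz: "x < lo \<bullet> \<tau> \<or> x > hi \<bullet> \<tau> \<Longrightarrow> p \<tau> x = 0" for x using p tau by (auto simp: smooth_box_def)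
  show ?thesis
  proof (cases "a = 0 \<and> hi \<bullet> \<tau> < T")
    case True
    \<comment> \<open>The midpoint of \<open>hi \<bullet> \<tau>\<close> and \<open>T\<close>
      separates the support from the far end; the maximum with \<open>T / 2\<close> keeps it
      positive when \<open>hi \<bullet> \<tau>\<close> is negative.\<close>
    show ?thesis
      by (rule ibp_boundary[OF b p, of a 1 "max (T / 2) ((hi \<bullet> \<tau> + T) / 2)"])
         (use True T_pos van pz in \<open>auto simp: max_def split: if_splits\<close>)
  next
    case False
    then have "a = T" "0 < lo \<bullet> \<tau>" using ends by auto
    then show ?thesis
      by (intro ibp_boundary[OF b p, of a "-1" "max (T / 2) (T - (lo \<bullet> \<tau>) / 2)"])
         (use T_pos van pz in \<open>auto simp: max_def split: if_splits\<close>)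
  qed
qed

section \<open>Reflected trigonometric functions and decay of the coefficients\<close>

definition lam :: real where "lam = pi / R"
text \<open>The slopes are 1, -1, -3, ...: index 0 is the identity, all others reflect. Being odd
  integers they never vanish and respect the period. With the weights \<open>cj\<close> the moments
  \<open>\<Sum> cj j * yj j ^ m\<close> are zero for \<open>m < k\<close>. In all directions except
  \<tau>, \<open>Jb\<close> leaves only the identity.\<close>

definition yj :: "nat \<Rightarrow> int" where "yj j = 1 - 2 * int j"
definition Jb :: "'a \<Rightarrow> nat set" where "Jb b = (if b = \<tau> then {..k} else {0})"
definition ab :: "'a \<Rightarrow> real" where "ab b = (if b = \<tau> then a else 0)"
definition cj :: "nat \<Rightarrow> real" where "cj j = (-1) ^ j * of_nat (k choose j)"

text \<open>In the time direction these are Hestenes' higher-order reflections about \<open>a\<close> of the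
  trigonometric functions: \<open>V \<tau> m\<close> is, up to a power of the frequency, the \<open>m\<close>-th derivative of a
  function vanishing to order \<open>k\<close> at \<open>a\<close>.\<close>
definition V :: "'a \<Rightarrow> nat \<Rightarrow> nat \<times> bool \<Rightarrow> real \<Rightarrow> real" where
  "V b m \<nu> x = (\<Sum>j\<in>Jb b. cj j * of_int (yj j) ^ m *
     cos (lam * real (fst \<nu>) * (ab b + of_int (yj j) * (x - ab b)) - ph (snd \<nu>) - (real k - real m) * pi / 2))"

lemma V_deriv: "(V b m \<nu> has_real_derivative lam * real (fst \<nu>) * V b (Suc m) \<nu> x) (at x)"
proof -
  let ?u = "\<lambda>m j x. lam * real (fst \<nu>) * (ab b + of_int (yj j) * (x - ab b)) - ph (snd \<nu>) - (real k - real m) * pi / 2"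
  have "((\<lambda>x. cos (?u m j x)) has_real_derivative lam * real (fst \<nu>) * (of_int (yj j) * cos (?u (Suc m) j x))) (at x)" for j
  proof -
    \<comment> \<open>The phase in \<open>V\<close> is chosen for this: raising \<open>m\<close> by
      one advances the argument by pi/2, which is a differentiation of the cosine. At
      \<open>m = k\<close> the phase is zero.\<close>
    have shift: "?u (Suc m) j x = ?u m j x + pi / 2" by (simp add: field_simps)
    have eq: "cos (?u (Suc m) j x) = - sin (?u m j x)"
      unfolding shift cos_add by simp
    show ?thesis unfolding eq by (auto intro!: derivative_eq_intros)
  qed
  note term_deriv = DERIV_cmult[OF this, of "cj _ * of_int (yj _) ^ m"]
  show ?thesis
    unfolding V_def[abs_def] sum_distrib_left
    by (rule DERIV_cong[OF DERIV_sum], rule term_deriv) (simp add: mult_ac)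
qed

lemma V_smooth: "smooth1 (V b m \<nu>)"
proof -
  let ?D = "\<lambda>i x. (lam * real (fst \<nu>)) ^ i * V b (m + i) \<nu> x"
  have "(?D i has_real_derivative ?D (Suc i) x) (at x)" for i x
    using DERIV_cmult[OF V_deriv[of b "m + i" \<nu> x], of "(lam * real (fst \<nu>)) ^ i"] by (simp add: mult_ac)
  from smooth1_family[of ?D 0, OF this] show ?thesis by simp
qed

text \<open>At \<open>a\<close> all reflected arguments coincide, so a common cosine factors out and
  the \<open>m\<close>-th moment of the weights remains.\<close>

lemma V_vanish:
  assumes "m < k"
  shows "V \<tau> m \<nu> a = 0"
proof -
  have "V \<tau> m \<nu> a = (\<Sum>j\<le>k. (-1) ^ j * of_nat (k choose j) * (1 + (-2) * of_nat j) ^ m) *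
      cos (lam * real (fst \<nu>) * a - ph (snd \<nu>) - (real k - real m) * pi / 2)"
    unfolding V_def sum_distrib_right by (simp add: Jb_def ab_def cj_def yj_def)
  then show ?thesis using alternating_binomial_power_zero[OF assms, of "1::real" "-2"] by simp
qed

definition q :: "'a \<Rightarrow> nat \<times> bool \<Rightarrow> real \<Rightarrow> real" where "q b \<nu> x = X b x * V b k \<nu> x"

text \<open>The direction \<open>b\<close> is opened for integration by parts: its cutoff
  \<open>X b\<close> becomes a free \<eta> and its order \<open>k\<close> becomes \<open>m\<close>,
  the other directions keep \<open>q\<close>.\<close>

definition Q :: "'a \<Rightarrow> nat \<Rightarrow> (real \<Rightarrow> real) \<Rightarrow> ('a \<Rightarrow> nat \<times> bool) \<Rightarrow> 'a \<Rightarrow> real \<Rightarrow> real" where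
  "Q b m \<eta> \<iota> = (\<lambda>c. q c (\<iota> c))(b := \<lambda>x. \<eta> x * V b m (\<iota> b) x)"

definition U :: "'a \<Rightarrow> nat \<Rightarrow> nat \<Rightarrow> (real \<Rightarrow> real) \<Rightarrow> ('a \<Rightarrow> nat \<times> bool) \<Rightarrow> real" where
  "U b l m \<eta> \<iota> = (\<integral>z. tens (Q b m \<eta> \<iota>) z * G b l z \<partial>lborel)"

definition adm :: "'a \<Rightarrow> (real \<Rightarrow> real) \<Rightarrow> bool" where
  "adm b \<eta> \<longleftrightarrow> smooth1 \<eta> \<and> (\<forall>x. x < lo \<bullet> b \<or> x > hi \<bullet> b \<longrightarrow> \<eta> x = 0)"

lemma adm_deriv: "adm b \<eta> \<Longrightarrow> adm b (deriv \<eta>)"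
  unfolding adm_def using smooth1_deriv smooth1_deriv_supp by (metis (no_types, lifting))

lemma adm_X: "b \<in> Basis \<Longrightarrow> adm b (X b)"
  using X by (auto simp: adm_def smooth_box_def)

lemma q_box: "smooth_box (\<lambda>c. q c (\<iota> c)) lo hi"
  using X unfolding smooth_box_def q_def by (auto intro!: smooth1_mult V_smooth)

lemma Q_box: "adm b \<eta> \<Longrightarrow> smooth_box (Q b m \<eta> \<iota>) lo hi"
  unfolding Q_def adm_def by (intro smooth_box_upd q_box smooth1_mult V_smooth) auto

text \<open>\<open>V b (Suc m)\<close> is the derivative of \<open>V b m\<close> divided by the
  frequency. One integration by parts therefore trades an order of \<open>V\<close> and a power of
  the frequency for a weak derivative of \<open>F\<close> or a derivative of the cutoff; in the
  direction \<tau> the boundary term at \<open>a\<close> is absent because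
  \<open>m < k\<close>.\<close>

lemma U_step:
  assumes b: "b \<in> Basis" "l < k" "m < k" and \<eta>: "adm b \<eta>"
  shows "lam * real (fst (\<iota> b)) * U b l (Suc m) \<eta> \<iota> = - U b (Suc l) m \<eta> \<iota> - U b l m (deriv \<eta>) \<iota>"
proof -
  have s: "smooth1 \<eta>" using \<eta> by (simp add: adm_def)
  have upd: "tens (Q b m' \<eta>' \<iota>) z = \<eta>' (z \<bullet> b) * V b m' (\<iota> b) (z \<bullet> b) * (\<Prod>c\<in>Basis - {b}. q c (\<iota> c) (z \<bullet> c))" for m' \<eta>' z
    unfolding Q_def by (simp add: tens_upd[OF b(1)])
  have d: "deriv (Q b m \<eta> \<iota> b) = (\<lambda>x. deriv \<eta> x * V b m (\<iota> b) x + lam * real (fst (\<iota> b)) * V b (Suc m) (\<iota> b) x * \<eta> x)"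
    unfolding Q_def fun_upd_same
    by (intro ext DERIV_imp_deriv DERIV_mult smooth1_has_deriv0 s V_deriv)
  have "tens ((Q b m \<eta> \<iota>)(b := deriv (Q b m \<eta> \<iota> b))) z =
      tens (Q b m (deriv \<eta>) \<iota>) z + lam * real (fst (\<iota> b)) * tens (Q b (Suc m) \<eta> \<iota>) z" for z
  proof -
    have "(\<Prod>c\<in>Basis - {b}. Q b m \<eta> \<iota> c (z \<bullet> c)) = (\<Prod>c\<in>Basis - {b}. q c (\<iota> c) (z \<bullet> c))"
      by (intro prod.cong) (auto simp: Q_def)
    then show ?thesis
      by (simp only: d upd tens_upd[OF b(1)]) (simp add: algebra_simps)
  qed
  then have "(\<integral>z. tens ((Q b m \<eta> \<iota>)(b := deriv (Q b m \<eta> \<iota> b))) z * G b l z \<partial>lborel) =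
    (\<integral>z. tens (Q b m (deriv \<eta>) \<iota>) z * G b l z + lam * real (fst (\<iota> b)) * (tens (Q b (Suc m) \<eta> \<iota>) z * G b l z) \<partial>lborel)"
    by (simp add: algebra_simps)
  also have "\<dots> = U b l m (deriv \<eta>) \<iota> + lam * real (fst (\<iota> b)) * U b l (Suc m) \<eta> \<iota>"
    unfolding U_def using b \<eta>
    by (subst Bochner_Integration.integral_add) (auto intro!: G_int_tens Q_box adm_deriv integrable_mult_right)
  finally have "U b l m (deriv \<eta>) \<iota> + lam * real (fst (\<iota> b)) * U b l (Suc m) \<eta> \<iota> = - U b (Suc l) m \<eta> \<iota>"
    using ibp_end[OF b(1,2) Q_box[OF \<eta>]] V_vanish[OF b(3)] by (simp add: U_def Q_def)
  then show ?thesis by simp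
qed

lemma cos_sin_half_pi: "cos (- ((real n - real m) * pi / 2)) * sin (- ((real n - real m) * pi / 2)) = 0"
proof -
  let ?t = "- ((real n - real m) * pi / 2)"
  have "2 * ?t = pi * real_of_int (int m - int n)" by (simp add: field_simps)
  then have "sin (2 * ?t) = 0" by (simp only: sin_npi_int)
  then show ?thesis unfolding sin_double by (simp only: mult_eq_0_iff) auto
qed

lemma lam_pos: "lam > 0" using R_pos by (simp add: lam_def)

text \<open>Expanding the reflected sum in the direction \<tau> gives finitely many families
  \<open>E j\<close>, each an orthogonal system on the period box. Bessel's inequality is applied to
  each of them with the same function \<open>H\<close>, the cutoff times the weak
  derivative.\<close>

lemma U_bessel:
  assumes b: "b \<in> Basis" "l \<le> k" and \<eta>: "adm b \<eta>"
  shows "sq_bounded (U b l m \<eta>)"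
proof -
  define H where "H = (\<lambda>z. tens (X(b := \<eta>)) z * G b l z)"
  have Xb: "smooth_box (X(b := \<eta>)) lo hi"
    using X \<eta> by (intro smooth_box_upd) (auto simp: adm_def)
  define mb where "mb = (\<lambda>c. if c = b then m else k)"
  define yy where "yy = (\<lambda>j c. if c = \<tau> then yj j else 1)"
  \<comment> \<open>The shift produced by reflecting about \<open>a\<close> is proportional to
    \<open>n\<close>, so at \<open>n = 0\<close> only a multiple of pi/2 remains, as
    \<open>trig_orthogonal\<close> requires.\<close>
  define \<psi> where "\<psi> = (\<lambda>j c n. lam * real n * (ab c * (1 - of_int (yy j c))) + - ((real k - real (mb c)) * pi / 2))"
  define E where "E = (\<lambda>j \<iota> z. \<Prod>c\<in>Basis. cos (pi / R * (yy j c * real (fst (\<iota> c))) * (z \<bullet> c) + \<psi> j c (fst (\<iota> c)) - ph (snd (\<iota> c))))"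
  define \<gamma> where "\<gamma> = (\<lambda>j. cj j * of_int (yj j) ^ mb \<tau>)"
  have Hm: "H \<in> borel_measurable borel"
    unfolding H_def using tens_measurable[OF Xb] G_meas[OF b] by (intro borel_measurable_times)
  have H2: "integrable lborel (\<lambda>z. (H z)\<^sup>2)"
  proof -
    obtain B where B: "B \<ge> 0" "\<And>z. \<bar>tens (X(b := \<eta>)) z\<bar> \<le> B" using tens_bounded[OF Xb] by blast
    show ?thesis
    proof (rule Bochner_Integration.integrable_bound)
      show "integrable lborel (\<lambda>z. B\<^sup>2 * (indicator (cbox lo hi) z * (G b l z)\<^sup>2))"
        using G_sq[OF b] by simp
      show "(\<lambda>z. (H z)\<^sup>2) \<in> borel_measurable lborel" using Hm by simp
      have "(H z)\<^sup>2 \<le> B\<^sup>2 * (indicator (cbox lo hi) z * (G b l z)\<^sup>2)" for z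
      proof (cases "z \<in> cbox lo hi")
        case True
        have "(tens (X(b := \<eta>)) z)\<^sup>2 \<le> B\<^sup>2" using B(2)[of z] B(1) by (simp add: abs_le_square_iff[symmetric])
        then show ?thesis using True by (simp add: H_def power_mult_distrib mult_right_mono)
      qed (simp add: H_def tens_zero[OF Xb])
      then show "AE z in lborel. norm ((H z)\<^sup>2) \<le> norm (B\<^sup>2 * (indicator (cbox lo hi) z * (G b l z)\<^sup>2))"
        by (auto intro!: AE_I2)
    qed
  qed
  have Hz: "H z = 0" if "c \<in> Basis" "\<bar>z \<bullet> c\<bar> > R" for z c
  proof -
    have "z \<notin> cbox lo hi"
    proof
      assume "z \<in> cbox lo hi"
      then have "lo \<bullet> c \<le> z \<bullet> c \<and> z \<bullet> c \<le> hi \<bullet> c" using that(1) by (simp add: mem_box)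
      then show False using that(2) box_R[OF that(1)] by linarith
    qed
    then show ?thesis by (simp add: H_def tens_zero[OF Xb])
  qed
  have Vsplit: "(\<Prod>c\<in>Basis. V c (mb c) (\<iota> c) (z \<bullet> c)) = (\<Sum>j\<le>k. \<gamma> j * E j \<iota> z)" for \<iota> z
  proof -
    have 1: "V c (mb c) (\<iota> c) (z \<bullet> c) = cos (pi / R * (yy j c * real (fst (\<iota> c))) * (z \<bullet> c) + \<psi> j c (fst (\<iota> c)) - ph (snd (\<iota> c)))"
      if "c \<in> Basis - {\<tau>}" for c j
      using that by (simp add: V_def Jb_def ab_def cj_def yj_def yy_def \<psi>_def lam_def algebra_simps)
    have 2: "V \<tau> (mb \<tau>) (\<iota> \<tau>) (z \<bullet> \<tau>) = (\<Sum>j\<le>k. \<gamma> j * cos (pi / R * (yy j \<tau> * real (fst (\<iota> \<tau>))) * (z \<bullet> \<tau>) + \<psi> j \<tau> (fst (\<iota> \<tau>)) - ph (snd (\<iota> \<tau>))))"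
      unfolding V_def Jb_def ab_def \<gamma>_def yy_def \<psi>_def lam_def
      by (simp only: if_True refl) (intro sum.cong arg_cong2[where f = "(*)"] refl arg_cong[where f = cos], simp add: algebra_simps diff_divide_distrib add_divide_distrib)
    have "(\<Prod>c\<in>Basis. V c (mb c) (\<iota> c) (z \<bullet> c)) = V \<tau> (mb \<tau>) (\<iota> \<tau>) (z \<bullet> \<tau>) * (\<Prod>c\<in>Basis - {\<tau>}. V c (mb c) (\<iota> c) (z \<bullet> c))"
      by (rule prod.remove[OF finite_Basis tau])
    also have "\<dots> = (\<Sum>j\<le>k. \<gamma> j * (cos (pi / R * (yy j \<tau> * real (fst (\<iota> \<tau>))) * (z \<bullet> \<tau>) + \<psi> j \<tau> (fst (\<iota> \<tau>)) - ph (snd (\<iota> \<tau>))) *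
        (\<Prod>c\<in>Basis - {\<tau>}. cos (pi / R * (yy j c * real (fst (\<iota> c))) * (z \<bullet> c) + \<psi> j c (fst (\<iota> c)) - ph (snd (\<iota> c))))))"
      unfolding 2 sum_distrib_right using 1 by (intro sum.cong refl) (simp only: mult.assoc cong: prod.cong)
    also have "\<dots> = (\<Sum>j\<le>k. \<gamma> j * E j \<iota> z)"
      unfolding E_def by (subst prod.remove[OF finite_Basis tau]) (rule refl)
    finally show ?thesis .
  qed
  have Qsplit: "tens (Q b m \<eta> \<iota>) z * G b l z = (\<Sum>j\<le>k. \<gamma> j * (H z * E j \<iota> z))" for \<iota> z
  proof -
    have "tens (Q b m \<eta> \<iota>) z = tens (X(b := \<eta>)) z * (\<Prod>c\<in>Basis. V c (mb c) (\<iota> c) (z \<bullet> c))"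
      unfolding tens_def prod.distrib[symmetric] by (intro prod.cong refl) (auto simp: Q_def q_def mb_def)
    then show ?thesis unfolding Vsplit by (simp add: H_def sum_distrib_left sum_distrib_right mult_ac)
  qed
  have E_le: "\<bar>E j \<iota> z\<bar> \<le> 1" for j \<iota> z
    unfolding E_def abs_prod by (intro prod_le_1) auto
  have E_m: "E j \<iota> \<in> borel_measurable borel" for j \<iota>
    unfolding E_def by (intro borel_measurable_continuous_onI continuous_intros)
  have HE: "integrable lborel (\<lambda>z. H z * E j \<iota> z)" for j \<iota>
  proof (rule Bochner_Integration.integrable_bound)
    show "integrable lborel H" unfolding H_def by (rule G_int_tens[OF b Xb])
    show "(\<lambda>z. H z * E j \<iota> z) \<in> borel_measurable lborel" using Hm E_m by simp
    show "AE z in lborel. norm (H z * E j \<iota> z) \<le> norm (H z)"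
      using mult_left_mono[OF E_le abs_ge_zero[of "H _"]] by (auto intro!: AE_I2 simp: abs_mult)
  qed
  have Ueq: "U b l m \<eta> \<iota> = (\<Sum>j\<le>k. \<gamma> j * (\<integral>z. H z * E j \<iota> z \<partial>lborel))" for \<iota>
    unfolding U_def Qsplit using HE by simp
  have "sq_bounded (\<lambda>\<iota>. \<integral>z. H z * E j \<iota> z \<partial>lborel)" for j
  proof (rule sq_boundedI)
    show "(2 * R) ^ DIM('a) * (\<integral>z. (H z)\<^sup>2 \<partial>lborel) \<ge> 0"
      using R_pos by (intro mult_nonneg_nonneg) auto
    fix J :: "('a \<Rightarrow> nat \<times> bool) set" assume J: "finite J" "J \<subseteq> (\<Pi>\<^sub>E b\<in>Basis. UNIV)"
    show "(\<Sum>\<iota>\<in>J. (\<integral>z. H z * E j \<iota> z \<partial>lborel)\<^sup>2) \<le> (2 * R) ^ DIM('a) * (\<integral>z. (H z)\<^sup>2 \<partial>lborel)"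
      unfolding E_def
    proof (rule trig_tensor_bessel[OF R_pos _ _ Hm H2 Hz J])
      show "yy j c \<noteq> 0" for c by (simp add: yy_def yj_def) presburger
      show "cos (\<psi> j c 0) * sin (\<psi> j c 0) = 0" for c
        using cos_sin_half_pi[of k "mb c"] by (simp add: \<psi>_def)
    qed
  qed
  then show ?thesis
    unfolding Ueq[abs_def] by (intro sq_bounded_sum sq_bounded_scale) auto
qed

text \<open>Each use of \<open>U_step\<close> absorbs one power of the frequency. The order
  \<open>l\<close> and the cutoff change on the way, hence the generalisation; at
  \<open>m = 0\<close> only Bessel is left.\<close>

lemma U_decay:
  assumes b: "b \<in> Basis" "l + m \<le> k" and \<eta>: "adm b \<eta>"
  shows "sq_bounded (\<lambda>\<iota>. (lam * real (fst (\<iota> b))) ^ m * U b l m \<eta> \<iota>)"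
  using assms(2,3)
proof (induction m arbitrary: l \<eta>)
  case 0
  then show ?case using U_bessel[OF b(1), of l \<eta> 0] by simp
next
  case (Suc m)
  let ?w = "\<lambda>\<iota>. (lam * real (fst (\<iota> b))) ^ m"
  have "(lam * real (fst (\<iota> b))) ^ Suc m * U b l (Suc m) \<eta> \<iota> =
      (- 1) * (?w \<iota> * U b (Suc l) m \<eta> \<iota>) + (- 1) * (?w \<iota> * U b l m (deriv \<eta>) \<iota>)" for \<iota>
  proof -
    have "(lam * real (fst (\<iota> b))) ^ Suc m * U b l (Suc m) \<eta> \<iota> = ?w \<iota> * (lam * real (fst (\<iota> b)) * U b l (Suc m) \<eta> \<iota>)"
      by (simp add: mult_ac)
    then show ?thesis
      using U_step[OF b(1) _ _ Suc.prems(2), of l m] Suc.prems(1) by (simp add: right_diff_distrib)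
  qed
  moreover have "sq_bounded (\<lambda>\<iota>. ?w \<iota> * U b (Suc l) m \<eta> \<iota>)" "sq_bounded (\<lambda>\<iota>. ?w \<iota> * U b l m (deriv \<eta>) \<iota>)"
    using Suc.prems adm_deriv by (auto intro!: Suc.IH)
  ultimately show ?case
    by (simp only:) (intro sq_bounded_add sq_bounded_scale)
qed

text \<open>After a change of variables, an unnormalised Fourier coefficient of \<open>F\<close>
  times the cutoff, completed by its reflected and stretched copies beyond \<open>a\<close>.\<close>

definition coef :: "('a \<Rightarrow> nat \<times> bool) \<Rightarrow> real" where
  "coef \<iota> = (\<integral>z. tens (\<lambda>c. q c (\<iota> c)) z * F z \<partial>lborel)"

lemma coef_U: "b \<in> Basis \<Longrightarrow> coef \<iota> = U b 0 k (X b) \<iota>"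
  unfolding coef_def U_def using G0 by (auto intro!: Bochner_Integration.integral_cong arg_cong2[where f = "(*)"] tens_cong[THEN fun_cong] simp: Q_def q_def)

lemma coef_decay:
  "sq_bounded coef" "b \<in> Basis \<Longrightarrow> sq_bounded (\<lambda>\<iota>. (lam * real (fst (\<iota> b))) ^ k * coef \<iota>)"
proof -
  have c: "coef = U b 0 k (X b)" if "b \<in> Basis" for b
    by (rule ext) (rule coef_U[OF that])
  show "sq_bounded coef"
    unfolding c[OF tau] by (rule U_bessel[OF tau _ adm_X[OF tau]]) simp
  show "sq_bounded (\<lambda>\<iota>. (lam * real (fst (\<iota> b))) ^ k * coef \<iota>)" if "b \<in> Basis"
    unfolding c[OF that] by (rule U_decay[OF that _ adm_X[OF that]]) simp
qed

end

section \<open>A trigonometric approximate identity\<close>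

text \<open>Each factor cos^2 (x/2) = (1 + cos x) / 2 raises the degree of a cosine polynomial by
  one.\<close>

lemma cos_half_power_expansion:
  "\<exists>w. \<forall>x. cos (x / 2) ^ (2 * N) = (\<Sum>n\<le>N. w n * cos (real n * x))"
proof -
  define TN where "TN = (\<lambda>N (p :: real \<Rightarrow> real). \<exists>w. \<forall>x. p x = (\<Sum>n\<le>N. w n * cos (real n * x)))"
  have add: "TN N (\<lambda>x. p x + q x)" if p: "TN N p" and q: "TN N q" for N p q
  proof -
    from p obtain w where "\<forall>x. p x = (\<Sum>n\<le>N. w n * cos (real n * x))" unfolding TN_def ..
    moreover from q obtain v where "\<forall>x. q x = (\<Sum>n\<le>N. v n * cos (real n * x))" unfolding TN_def ..
    ultimately show ?thesis
      unfolding TN_def by (intro exI[of _ "\<lambda>n. w n + v n"]) (simp add: distrib_right sum.distrib)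
  qed
  have scale: "TN N (\<lambda>x. c * p x)" if p: "TN N p" for N p c
  proof -
    from p obtain w where "\<forall>x. p x = (\<Sum>n\<le>N. w n * cos (real n * x))" unfolding TN_def ..
    then show ?thesis
      unfolding TN_def by (intro exI[of _ "\<lambda>n. c * w n"]) (simp add: sum_distrib_left mult.assoc)
  qed
  have basis: "TN N (\<lambda>x. cos (real n * x))" if "n \<le> N" for N n
    unfolding TN_def
  proof (intro exI[of _ "\<lambda>m. if m = n then 1 else 0"] allI)
    fix x show "cos (real n * x) = (\<Sum>m\<le>N. (if m = n then 1 else 0) * cos (real m * x))"
      using that by (simp add: if_distrib[of "\<lambda>c. c * _"] cong: if_cong)
  qed
  have sum: "TN N (\<lambda>x. \<Sum>n\<in>A. p n x)" if "finite A" "\<And>n. n \<in> A \<Longrightarrow> TN N (p n)" for A :: "nat set" and p N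
    using that
  proof (induction A rule: finite_induct)
    case empty
    then show ?case unfolding TN_def by (intro exI[of _ "\<lambda>_. 0"]) simp
  qed (simp add: add)
  have "TN N (\<lambda>x. cos (x / 2) ^ (2 * N))" for N
  proof (induction N)
    case 0
    then show ?case using basis[of 0 0] by simp
  next
    case (Suc N)
    then obtain w where w: "\<And>x. cos (x / 2) ^ (2 * N) = (\<Sum>n\<le>N. w n * cos (real n * x))"
      unfolding TN_def by blast
    have sq: "cos (x / 2) ^ 2 = (1 + cos x) / 2" for x :: real
      using cos_double_cos[of "x / 2"] by simp
    \<comment> \<open>The difference \<open>n - 1\<close> is truncated at \<open>n = 0\<close>; the
      extra summand \<open>x\<close> repairs that case, where cos (-x) = cos x.\<close>
    have eq: "cos (x / 2) ^ (2 * Suc N) =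
        (\<Sum>n\<le>N. w n * (1/2 * cos (real n * x) + (1/4 * cos (real (Suc n) * x) + 1/4 * cos (real (n - 1) * x + (if n = 0 then x else 0)))))" for x
    proof -
      have "cos (x / 2) ^ (2 * Suc N) = cos (x / 2) ^ (2 * N) * ((1 + cos x) / 2)"
        by (simp add: sq[symmetric] power_add[symmetric])
      also have "\<dots> = (\<Sum>n\<le>N. w n * (cos (real n * x) * ((1 + cos x) / 2)))"
        by (simp only: w sum_distrib_right mult.assoc)
      also have "\<dots> = (\<Sum>n\<le>N. w n * (1/2 * cos (real n * x) + (1/4 * cos (real (Suc n) * x) + 1/4 * cos (real (n - 1) * x + (if n = 0 then x else 0)))))"
      proof (intro sum.cong refl arg_cong2[where f = "(*)"])
        fix n
        have "cos (real n * x - x) = cos (real (n - 1) * x + (if n = 0 then x else 0))"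
          by (cases n) (simp_all add: algebra_simps)
        moreover have "cos (real n * x) * cos x = (cos (real n * x - x) + cos (real n * x + x)) / 2"
          by (rule cos_times_cos)
        ultimately show "cos (real n * x) * ((1 + cos x) / 2) = 1/2 * cos (real n * x) + (1/4 * cos (real (Suc n) * x) + 1/4 * cos (real (n - 1) * x + (if n = 0 then x else 0)))"
          by (simp add: algebra_simps add_divide_distrib)
      qed
      finally show ?thesis .
    qed
    have last: "TN (Suc N) (\<lambda>x. cos (real (n - 1) * x + (if n = 0 then x else 0)))" if "n \<le> N" for n
      using basis[of 1 "Suc N"] basis[of "n - 1" "Suc N"] that by (cases n) simp_all
    show ?case
      unfolding eq by (intro sum scale add basis last) auto
  qed
  then show ?thesis unfolding TN_def .
qed

text \<open>The de la Vallee Poussin kernel of period 2 R, normalised over one period. It is at once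
  nonnegative, a trigonometric polynomial, and concentrated at a geometric rate.\<close>

definition fk :: "real \<Rightarrow> nat \<Rightarrow> real \<Rightarrow> real" where
  "fk R N u = cos (pi / R * u / 2) ^ (2 * N) / (\<integral>x. indicator {-R..R} x * cos (pi / R * x / 2) ^ (2 * N) \<partial>lborel)"

context
  fixes R :: real
  assumes R: "R > 0"
begin

text \<open>Only the interval of length \<delta> around 0 is kept, where the cosine is at least its
  value at the ends.\<close>

lemma fk_norm_ge:
  assumes "0 < \<delta>" "\<delta> \<le> R"
  shows "\<delta> * (cos (pi / R * \<delta> / 4))\<^sup>2 ^ N \<le> (\<integral>x. indicator {-R..R} x * cos (pi / R * x / 2) ^ (2 * N) \<partial>lborel)"
proof -
  have "\<delta> * (cos (pi / R * \<delta> / 4))\<^sup>2 ^ N = (\<integral>x. indicator {-(\<delta>/2)..\<delta>/2} x * (cos (pi / R * \<delta> / 4))\<^sup>2 ^ N \<partial>lborel)"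
    using assms by (simp add: mult.commute)
  also have "\<dots> \<le> (\<integral>x. indicator {-R..R} x * cos (pi / R * x / 2) ^ (2 * N) \<partial>lborel)"
  proof (intro integral_mono integrable_Icc_mult)
    fix x :: real
    show "indicator {-(\<delta>/2)..\<delta>/2} x * (cos (pi / R * \<delta> / 4))\<^sup>2 ^ N \<le> indicator {-R..R} x * cos (pi / R * x / 2) ^ (2 * N)"
    proof (cases "x \<in> {-(\<delta>/2)..\<delta>/2}")
      case True
      have "cos (pi / R * \<delta> / 4) \<le> cos \<bar>pi / R * x / 2\<bar>" (is "?A \<le> cos \<bar>?B\<bar>")
      proof (rule cos_monotone_0_pi_le)
        have ax: "\<bar>x\<bar> \<le> \<delta> / 2" using True by auto
        have "\<bar>pi / R * x / 2\<bar> = pi / R * \<bar>x\<bar> / 2" using R by (simp add: abs_mult)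
        also have "\<dots> \<le> pi / R * (\<delta> / 2) / 2" using ax R by (intro divide_right_mono mult_left_mono) auto
        finally show "\<bar>pi / R * x / 2\<bar> \<le> pi / R * \<delta> / 4" by simp
        have "pi / R * \<delta> / 4 \<le> pi / R * R / 4" using assms R by (intro divide_right_mono mult_left_mono) auto
        then show "pi / R * \<delta> / 4 \<le> pi" using R pi_gt_zero by (simp, linarith)
      qed simp
      then have "?A \<le> cos ?B" by (simp only: cos_abs_real)
      moreover have "0 \<le> cos (pi / R * \<delta> / 4)"
      proof (rule cos_ge_zero)
        have "pi / R * \<delta> / 4 \<le> pi / R * R / 4" using assms R by (intro divide_right_mono mult_left_mono) auto
        then show "pi / R * \<delta> / 4 \<le> pi / 2" using R pi_gt_zero by (simp, linarith)
        have "0 \<le> pi / R * \<delta> / 4" using assms R by simp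
        then show "- (pi / 2) \<le> pi / R * \<delta> / 4" using pi_gt_zero by linarith
      qed
      ultimately have "cos (pi / R * \<delta> / 4) ^ (2 * N) \<le> cos (pi / R * x / 2) ^ (2 * N)"
        by (intro power_mono) simp_all
      then show ?thesis using True assms by (auto simp: power_mult indicator_def)
    qed (simp add: power_mult)
  qed (use R in \<open>auto intro!: continuous_intros\<close>)
  finally show ?thesis .
qed

lemma fk_denom_pos: "0 < (\<integral>x. indicator {-R..R} x * cos (pi / R * x / 2) ^ (2 * N) \<partial>lborel)"
proof -
  have "cos (pi / R * R / 4) > 0" using R by (intro cos_gt_zero_pi) auto
  then have "0 < R * (cos (pi / R * R / 4))\<^sup>2 ^ N" using R by simp
  also have "\<dots> \<le> (\<integral>x. indicator {-R..R} x * cos (pi / R * x / 2) ^ (2 * N) \<partial>lborel)"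
    using fk_norm_ge[of R N] R by simp
  finally show ?thesis .
qed

lemma fk_nonneg: "fk R N u \<ge> 0"
  unfolding fk_def using fk_denom_pos[of N] by (intro divide_nonneg_pos) (simp_all add: power_mult)

lemma fk_cont: "continuous_on UNIV (fk R N)"
  unfolding fk_def divide_inverse by (intro continuous_intros)

lemma fk_integral: "(\<integral>x. indicator {-R..R} x * fk R N x \<partial>lborel) = 1"
proof -
  have "(\<integral>x. indicator {-R..R} x * fk R N x \<partial>lborel) =
     (\<integral>x. indicator {-R..R} x * cos (pi / R * x / 2) ^ (2 * N) / (\<integral>x. indicator {-R..R} x * cos (pi / R * x / 2) ^ (2 * N) \<partial>lborel) \<partial>lborel)"
    unfolding fk_def by simp
  also have "\<dots> = 1" using fk_denom_pos[of N] by (subst integral_divide_zero) simp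
  finally show ?thesis .
qed

text \<open>By orthogonality \<open>w n\<close> times \<open>R\<close> (2 R for
  \<open>n = 0\<close>) is the integral of the kernel against a cosine, at most the total mass 1. A
  bound independent of \<open>N\<close> ensures that smoothing does not enlarge the weighted
  coefficient sums.\<close>

lemma fk_expansion:
  "\<exists>w. (\<forall>u. fk R N u = (\<Sum>n\<le>N. w n * cos (pi / R * real n * u))) \<and> (\<forall>n\<le>N. \<bar>w n\<bar> \<le> 1 / R)"
proof -
  let ?Z = "\<integral>x. indicator {-R..R} x * cos (pi / R * x / 2) ^ (2 * N) \<partial>lborel"
  obtain w0 where w0: "\<And>x. cos (x / 2) ^ (2 * N) = (\<Sum>n\<le>N. w0 n * cos (real n * x))"
    using cos_half_power_expansion by blast
  define w where "w = (\<lambda>n. w0 n / ?Z)"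
  have eq: "fk R N u = (\<Sum>n\<le>N. w n * cos (pi / R * real n * u))" for u
    using w0[of "pi / R * u"] by (simp add: fk_def w_def sum_divide_distrib mult_ac)
  have "\<bar>w n\<bar> \<le> 1 / R" if n: "n \<le> N" for n
  proof -
    have int: "integrable lborel (\<lambda>x. indicator {-R..R} x * (cos (pi / R * real m * x) * cos (pi / R * real n * x)))" for m
      by (intro integrable_Icc_mult continuous_intros)
    have orth: "(\<integral>x. indicator {-R..R} x * (cos (pi / R * real m * x) * cos (pi / R * real n * x)) \<partial>lborel) =
       (if m = n then (if n = 0 then 2 * R else R) else 0)" for m
    proof -
      have eq: "indicator {-R..R} x * (cos (pi / R * real m * x) * cos (pi / R * real n * x)) =
        (indicator {-R..R} x * cos (pi / R * real_of_int (int m - int n) * x + 0) +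
         indicator {-R..R} x * cos (pi / R * real_of_int (int m + int n) * x + 0)) / 2" for x
        unfolding cos_times_cos by (simp add: algebra_simps)
      have int: "integrable lborel (\<lambda>x. indicator {-R..R} x * cos (pi / R * real_of_int K * x + c))" for K c
        by (intro integrable_Icc_mult continuous_intros)
      show ?thesis
        unfolding eq integral_divide_zero Bochner_Integration.integral_add[OF int int] cos_integral_period[OF R]
        by auto
    qed
    have "(\<integral>x. indicator {-R..R} x * (fk R N x * cos (pi / R * real n * x)) \<partial>lborel) =
       (\<integral>x. (\<Sum>m\<le>N. w m * (indicator {-R..R} x * (cos (pi / R * real m * x) * cos (pi / R * real n * x)))) \<partial>lborel)"
      unfolding eq by (simp add: sum_distrib_left sum_distrib_right mult_ac)
    also have "\<dots> = (\<Sum>m\<le>N. w m * (if m = n then (if n = 0 then 2 * R else R) else 0))"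
      by (simp only: Bochner_Integration.integral_sum[OF integrable_mult_right[OF int]] integral_mult_right_zero orth)
    also have "\<dots> = w n * (if n = 0 then 2 * R else R)"
      using n by (simp add: if_distrib cong: if_cong)
    finally have wn: "(\<integral>x. indicator {-R..R} x * (fk R N x * cos (pi / R * real n * x)) \<partial>lborel) = w n * (if n = 0 then 2 * R else R)" .
    have "\<bar>\<integral>x. indicator {-R..R} x * (fk R N x * cos (pi / R * real n * x)) \<partial>lborel\<bar> \<le> (\<integral>x. \<bar>indicator {-R..R} x * (fk R N x * cos (pi / R * real n * x))\<bar> \<partial>lborel)"
      by (rule integral_abs_bound)
    also have "\<dots> \<le> (\<integral>x. indicator {-R..R} x * fk R N x \<partial>lborel)"
    proof (intro integral_mono integrable_Icc_mult fk_cont integrable_abs)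
      fix x
      show "\<bar>indicator {-R..R} x * (fk R N x * cos (pi / R * real n * x))\<bar> \<le> indicator {-R..R} x * fk R N x"
        using mult_left_mono[OF abs_cos_le_one fk_nonneg, of N x "pi / R * real n * x"] fk_nonneg[of N x]
        by (simp add: abs_mult indicator_def)
    qed (intro continuous_intros fk_cont)
    finally have "\<bar>w n * (if n = 0 then 2 * R else R)\<bar> \<le> 1" unfolding fk_integral wn .
    then have "\<bar>w n\<bar> * R \<le> 1" using R by (auto simp: abs_mult split: if_splits)
    then show ?thesis using R by (simp add: pos_le_divide_eq)
  qed
  with eq show ?thesis by blast
qed

lemma fk_concentration:
  assumes \<delta>: "0 < \<delta>" "\<delta> \<le> R"
  shows "\<exists>\<kappa>. \<kappa> \<longlonglongrightarrow> 0 \<and> (\<forall>N. \<kappa> N \<ge> 0) \<and> (\<forall>N u. \<delta> \<le> \<bar>u\<bar> \<longrightarrow> \<bar>u\<bar> \<le> 2 * R - \<delta> \<longrightarrow> fk R N u \<le> \<kappa> N)"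
proof -
  define \<theta> where "\<theta> = pi / R * \<delta> / 2"
  have \<theta>0: "0 < \<theta>" using \<delta> R by (simp add: \<theta>_def)
  have "pi / R * \<delta> / 2 \<le> pi / R * R / 2" using \<delta> R by (intro divide_right_mono mult_left_mono) auto
  moreover have "pi / R * R = pi" using R by simp
  ultimately have \<theta>1: "\<theta> \<le> pi / 2" by (simp only: \<theta>_def)
  have half: "pi / R * \<delta> / 4 = \<theta> / 2" by (simp add: \<theta>_def)
  have c: "cos \<theta> \<ge> 0" using \<theta>0 \<theta>1 by (intro cos_ge_zero) linarith+
  have cd: "cos \<theta> < cos (\<theta> / 2)" using \<theta>0 \<theta>1 pi_gt_zero by (intro cos_monotone_0_pi) linarith+
  define r where "r = (cos \<theta>)\<^sup>2 / (cos (\<theta> / 2))\<^sup>2"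
  have "(cos \<theta>)\<^sup>2 < (cos (\<theta> / 2))\<^sup>2" using c cd by (intro power_strict_mono) auto
  then have r: "0 \<le> r" "r < 1" using c cd by (auto simp: r_def)
  have bound: "fk R N u \<le> 1 / \<delta> * r ^ N" if u: "\<delta> \<le> \<bar>u\<bar>" "\<bar>u\<bar> \<le> 2 * R - \<delta>" for N u
  proof -
    define v where "v = pi / R * \<bar>u\<bar> / 2"
    have l1: "\<theta> \<le> v" unfolding \<theta>_def v_def using u R by (intro divide_right_mono mult_left_mono) auto
    have "v \<le> pi / R * (2 * R - \<delta>) / 2" unfolding v_def using u R by (intro divide_right_mono mult_left_mono) auto
    also have "\<dots> = pi - \<theta>" unfolding \<theta>_def using R by (simp add: field_simps)
    finally have l2: "v \<le> pi - \<theta>" .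
    have "cos v \<le> cos \<theta>" using l1 l2 \<theta>0 by (intro cos_monotone_0_pi_le) linarith+
    moreover have "- cos \<theta> \<le> cos v"
    proof -
      have "cos (pi - \<theta>) \<le> cos v"
        using l1 l2 \<theta>0 by (intro cos_monotone_0_pi_le) linarith+
      then show ?thesis by (simp add: cos_diff)
    qed
    ultimately have "\<bar>cos v\<bar> \<le> cos \<theta>" by linarith
    moreover have "cos v = cos (pi / R * u / 2)" unfolding v_def by (cases "u \<ge> 0") simp_all
    ultimately have "(cos (pi / R * u / 2))\<^sup>2 \<le> (cos \<theta>)\<^sup>2" using c by (simp add: abs_le_square_iff[symmetric])
    then have num: "cos (pi / R * u / 2) ^ (2 * N) \<le> (cos \<theta>)\<^sup>2 ^ N" 
      using power_mono[OF _ zero_le_power2, of _ _ N] unfolding power_mult by blast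
    have dpos: "0 < \<delta> * (cos (\<theta> / 2))\<^sup>2 ^ N" using \<delta> c cd by simp
    have "fk R N u \<le> (cos \<theta>)\<^sup>2 ^ N / (\<delta> * (cos (\<theta> / 2))\<^sup>2 ^ N)"
      unfolding fk_def using num dpos fk_norm_ge[OF \<delta>, of N] unfolding half by (intro frac_le) auto
    also have "\<dots> = 1 / \<delta> * r ^ N" by (simp add: r_def power_divide)
    finally show ?thesis .
  qed
  have "(\<lambda>N. 1 / \<delta> * r ^ N) \<longlonglongrightarrow> 1 / \<delta> * 0"
    by (intro tendsto_mult tendsto_const LIMSEQ_power_zero) (use r in auto)
  then show ?thesis
    using bound \<delta> r by (intro exI[of _ "\<lambda>N. 1 / \<delta> * r ^ N"]) auto
qed

lemma fk_shift_integral: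
  "integrable lborel (\<lambda>y. indicator {-R..R} (x - y) * fk R N (x - y))"
  "(\<integral>y. indicator {-R..R} (x - y) * fk R N (x - y) \<partial>lborel) = 1"
proof -
  let ?g = "\<lambda>u. indicator {-R..R} u * fk R N u"
  have i: "integrable lborel ?g" by (intro integrable_Icc_mult fk_cont)
  show "integrable lborel (\<lambda>y. indicator {-R..R} (x - y) * fk R N (x - y))"
    using lborel_integrable_real_affine[OF i, of "-1" x] by simp
  show "(\<integral>y. indicator {-R..R} (x - y) * fk R N (x - y) \<partial>lborel) = 1"
    using lborel_integral_real_affine[of "-1" ?g x] by (simp add: fk_integral)
qed

text \<open>Approximate identity at a point of continuity. If \<open>y\<close> is far from
  \<open>z\<close>, some coordinate is off by at least \<delta>; in that coordinate the kernel is at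
  most \<kappa> N, in the others it has mass 1.\<close>

lemma fk_tensor_limit:
  fixes H :: "'a::euclidean_space \<Rightarrow> real" and z :: 'a
  assumes Hm: "H \<in> borel_measurable borel" and HB: "\<And>y. \<bar>H y\<bar> \<le> B"
    and supp: "\<And>y b. b \<in> Basis \<Longrightarrow> \<bar>z \<bullet> b - y \<bullet> b\<bar> > R \<Longrightarrow> H y = 0"
    and cont: "isCont H z"
  shows "(\<lambda>N. \<integral>y. H y * (\<Prod>b\<in>Basis. fk R N (z \<bullet> b - y \<bullet> b)) \<partial>lborel) \<longlonglongrightarrow> H z"
proof (rule LIMSEQ_I)
  fix \<epsilon> :: real assume \<epsilon>: "\<epsilon> > 0"
  have B: "B \<ge> 0" using HB[of z] by linarith
  define P where "P = (\<lambda>N b y. indicator {-R..R} (z \<bullet> b - y) * fk R N (z \<bullet> b - y))"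
  have Pi: "integrable lborel (P N b)" "(\<integral>y. P N b y \<partial>lborel) = 1" for N b
    using fk_shift_integral[of "z \<bullet> b" N] by (simp_all add: P_def)
  have P0: "P N b y \<ge> 0" for N b y using fk_nonneg by (simp add: P_def)
  define PP where "PP = (\<lambda>N (y::'a). \<Prod>b\<in>Basis. P N b (y \<bullet> b))"
  have PPi: "integrable lborel (PP N)" "(\<integral>y. PP N y \<partial>lborel) = 1" for N
    unfolding PP_def using lborel_prod_integral[of "P N", OF Pi(1)] by (simp_all add: Pi)
  have PP0: "PP N y \<ge> 0" for N y unfolding PP_def by (intro prod_nonneg) (simp add: P0)
  have HP: "H y * (\<Prod>b\<in>Basis. fk R N (z \<bullet> b - y \<bullet> b)) = H y * PP N y" for N y
  proof (cases "\<exists>b\<in>Basis. \<bar>z \<bullet> b - y \<bullet> b\<bar> > R")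
    case False
    then have "(\<Prod>b\<in>Basis. fk R N (z \<bullet> b - y \<bullet> b)) = PP N y"
      unfolding PP_def P_def by (intro prod.cong) (auto simp: indicator_def not_less abs_le_iff)
    then show ?thesis by simp
  qed (use supp in auto)
  obtain d where d: "d > 0" "\<And>y. norm (y - z) < d \<Longrightarrow> \<bar>H y - H z\<bar> < \<epsilon> / 2"
    using cont \<epsilon> unfolding continuous_at_eps_delta dist_norm by (metis half_gt_zero real_norm_def)
  \<comment> \<open>If all coordinates are off by less than this, the norm is at most the sum of the
    DIM coordinates, hence at most d/2.\<close>
  define \<delta> where "\<delta> = min (d / (2 * DIM('a))) R"
  have \<delta>: "0 < \<delta>" "\<delta> \<le> R" using d R by (auto simp: \<delta>_def)
  obtain \<kappa> where \<kappa>: "\<kappa> \<longlonglongrightarrow> 0" "\<And>N. \<kappa> N \<ge> 0" "\<And>N u. \<delta> \<le> \<bar>u\<bar> \<Longrightarrow> \<bar>u\<bar> \<le> 2 * R - \<delta> \<Longrightarrow> fk R N u \<le> \<kappa> N"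
    using fk_concentration[OF \<delta>] by blast
  \<comment> \<open>The part of the kernel whose coordinate \<open>c\<close> is at least \<delta>
    away from \<open>z\<close>, kept in product form so that its integral factorises.\<close>
  define D where "D = (\<lambda>N c (y::'a). \<Prod>b\<in>Basis. (if b = c then indicator {x. \<delta> \<le> \<bar>z \<bullet> b - x\<bar>} (y \<bullet> b) else 1) * P N b (y \<bullet> b))"
  have Di1: "integrable lborel (\<lambda>x. (if b = c then indicator {x. \<delta> \<le> \<bar>z \<bullet> b - x\<bar>} x else 1) * P N b x)" for N b c
  proof (rule Bochner_Integration.integrable_bound[OF Pi(1)[of N b]])
    have [measurable]: "P N b \<in> borel_measurable borel" using borel_measurable_integrable[OF Pi(1)] by simp
    have [measurable]: "{x. \<delta> \<le> \<bar>z \<bullet> b - x\<bar>} \<in> sets borel" by measurable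
    show "(\<lambda>x. (if b = c then indicator {x. \<delta> \<le> \<bar>z \<bullet> b - x\<bar>} x else 1) * P N b x) \<in> borel_measurable lborel"
      by measurable
    show "AE x in lborel. norm ((if b = c then indicator {x. \<delta> \<le> \<bar>z \<bullet> b - x\<bar>} x else 1) * P N b x) \<le> norm (P N b x)"
      by (intro AE_I2) (auto simp: indicator_def)
  qed
  have Di: "integrable lborel (D N c)" for N c
    unfolding D_def by (intro lborel_prod_integral(1) Di1)
  have Dle: "(\<integral>y. D N c y \<partial>lborel) \<le> 2 * R * \<kappa> N" if c: "c \<in> Basis" for N c
  proof -
    have "(\<integral>y. D N c y \<partial>lborel) = (\<Prod>b\<in>Basis. \<integral>x. (if b = c then indicator {x. \<delta> \<le> \<bar>z \<bullet> b - x\<bar>} x else 1) * P N b x \<partial>lborel)"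
      unfolding D_def by (intro lborel_prod_integral(2) Di1)
    also have "\<dots> = (\<integral>x. indicator {x. \<delta> \<le> \<bar>z \<bullet> c - x\<bar>} x * P N c x \<partial>lborel) * (\<Prod>b\<in>Basis - {c}. 1)"
      by (subst prod.remove[OF finite_Basis c]) (intro arg_cong2[where f = "(*)"] prod.cong, auto simp: Pi)
    also have "\<dots> \<le> (\<integral>x. indicator {z \<bullet> c - R..z \<bullet> c + R} x * \<kappa> N \<partial>lborel)"
    proof -
      have "(\<integral>x. indicator {x. \<delta> \<le> \<bar>z \<bullet> c - x\<bar>} x * P N c x \<partial>lborel) \<le> (\<integral>x. indicator {z \<bullet> c - R..z \<bullet> c + R} x * \<kappa> N \<partial>lborel)"
      proof (intro integral_mono integrable_Icc_mult continuous_intros)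
        show "integrable lborel (\<lambda>x. indicator {x. \<delta> \<le> \<bar>z \<bullet> c - x\<bar>} x * P N c x)" using Di1[of c c N] by simp
        fix x
        show "indicator {x. \<delta> \<le> \<bar>z \<bullet> c - x\<bar>} x * P N c x \<le> indicator {z \<bullet> c - R..z \<bullet> c + R} x * \<kappa> N"
          using \<kappa>(2)[of N] \<kappa>(3)[of "z \<bullet> c - x" N] \<delta> by (auto simp: indicator_def P_def)
      qed
      then show ?thesis by simp
    qed
    also have "\<dots> = 2 * R * \<kappa> N" using R by (simp add: mult.commute)
    finally show ?thesis .
  qed
  have D0: "D N c y \<ge> 0" for N c y unfolding D_def by (intro prod_nonneg) (simp add: P0)
  have key: "\<bar>H y - H z\<bar> * PP N y \<le> \<epsilon> / 2 * PP N y + (\<Sum>c\<in>Basis. 2 * B * D N c y)" for N y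
  proof (cases "\<exists>c\<in>Basis. \<delta> \<le> \<bar>z \<bullet> c - y \<bullet> c\<bar>")
    case True
    then obtain c where c: "c \<in> Basis" "\<delta> \<le> \<bar>z \<bullet> c - y \<bullet> c\<bar>" by blast
    have DP: "D N c y = PP N y" unfolding D_def PP_def using c by (intro prod.cong) auto
    have "\<bar>H y - H z\<bar> * PP N y \<le> (2 * B) * PP N y"
      using HB[of y] HB[of z] PP0 by (intro mult_right_mono) auto
    also have "\<dots> = 2 * B * D N c y" by (simp add: DP)
    also have "\<dots> \<le> (\<Sum>c\<in>Basis. 2 * B * D N c y)"
      using c(1) B D0 by (intro member_le_sum) auto
    finally show ?thesis using \<epsilon> PP0[of N y] by (smt (verit) mult_nonneg_nonneg half_gt_zero)
  next
    case False
    have "norm (y - z) \<le> (\<Sum>c\<in>Basis. \<bar>(y - z) \<bullet> c\<bar>)" by (rule norm_le_l1)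
    also have "\<dots> \<le> (\<Sum>c\<in>(Basis::'a set). \<delta>)"
      using False by (intro sum_mono) (auto simp: inner_diff_left abs_minus_commute not_le intro: less_imp_le)
    also have "\<dots> \<le> DIM('a) * (d / (2 * DIM('a)))"
      unfolding sum_constant by (intro mult_left_mono) (simp_all add: \<delta>_def)
    also have "\<dots> < d" using d by simp
    finally have "\<bar>H y - H z\<bar> < \<epsilon> / 2" by (rule d(2))
    then have "\<bar>H y - H z\<bar> * PP N y \<le> \<epsilon> / 2 * PP N y" using PP0 by (intro mult_right_mono) auto
    moreover have "0 \<le> (\<Sum>c\<in>Basis. 2 * B * D N c y)" using B D0 by (intro sum_nonneg) auto
    ultimately show ?thesis by linarith
  qed
  have HPi: "integrable lborel (\<lambda>y. H y * PP N y)" for N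
  proof (rule Bochner_Integration.integrable_bound)
    show "integrable lborel (\<lambda>y. B * PP N y)" using PPi by simp
    show "(\<lambda>y. H y * PP N y) \<in> borel_measurable lborel" using Hm borel_measurable_integrable[OF PPi(1)] by simp
    show "AE y in lborel. norm (H y * PP N y) \<le> norm (B * PP N y)"
      using HB PP0 B by (intro AE_I2) (simp add: abs_mult mult_right_mono)
  qed
  have est: "\<bar>(\<integral>y. H y * PP N y \<partial>lborel) - H z\<bar> \<le> \<epsilon> / 2 + 4 * B * R * DIM('a) * \<kappa> N" for N
  proof -
    have "(\<integral>y. H y * PP N y \<partial>lborel) - H z = (\<integral>y. H y * PP N y - H z * PP N y \<partial>lborel)"
      using HPi PPi by simp
    also have "\<bar>\<dots>\<bar> \<le> (\<integral>y. \<bar>H y * PP N y - H z * PP N y\<bar> \<partial>lborel)"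
      by (rule integral_abs_bound)
    also have "\<dots> \<le> (\<integral>y. \<epsilon> / 2 * PP N y + (\<Sum>c\<in>Basis. 2 * B * D N c y) \<partial>lborel)"
    proof (rule integral_mono)
      show "integrable lborel (\<lambda>y. \<bar>H y * PP N y - H z * PP N y\<bar>)" using HPi PPi by (intro integrable_abs) simp
      show "integrable lborel (\<lambda>y. \<epsilon> / 2 * PP N y + (\<Sum>c\<in>Basis. 2 * B * D N c y))"
        using PPi Di by (intro Bochner_Integration.integrable_add Bochner_Integration.integrable_sum) simp_all
      show "\<bar>H y * PP N y - H z * PP N y\<bar> \<le> \<epsilon> / 2 * PP N y + (\<Sum>c\<in>Basis. 2 * B * D N c y)" for y
        using key[of y N] PP0[of N y] by (simp add: left_diff_distrib[symmetric] abs_mult)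
    qed
    also have "\<dots> = \<epsilon> / 2 + (\<Sum>c\<in>Basis. 2 * B * (\<integral>y. D N c y \<partial>lborel))"
      using PPi Di by simp
    also have "\<dots> \<le> \<epsilon> / 2 + (\<Sum>c\<in>(Basis::'a set). 2 * B * (2 * R * \<kappa> N))"
      using Dle B by (intro add_left_mono sum_mono mult_left_mono) auto
    finally show ?thesis by (simp add: mult_ac)
  qed
  have "(\<lambda>N. 4 * B * R * DIM('a) * \<kappa> N) \<longlonglongrightarrow> 4 * B * R * DIM('a) * 0"
    by (intro tendsto_mult tendsto_const \<kappa>)
  then have "(\<lambda>N. 4 * B * R * DIM('a) * \<kappa> N) \<longlonglongrightarrow> 0" by simp
  from order_tendstoD(2)[OF this, of "\<epsilon> / 2"] \<epsilon>
  obtain N0 where N0: "\<And>N. N \<ge> N0 \<Longrightarrow> 4 * B * R * DIM('a) * \<kappa> N < \<epsilon> / 2"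
    unfolding eventually_sequentially by auto
  show "\<exists>no. \<forall>n\<ge>no. norm ((\<integral>y. H y * (\<Prod>b\<in>Basis. fk R n (z \<bullet> b - y \<bullet> b)) \<partial>lborel) - H z) < \<epsilon>"
  proof (intro exI[of _ N0] allI impI)
    fix n assume "n \<ge> N0"
    then show "norm ((\<integral>y. H y * (\<Prod>b\<in>Basis. fk R n (z \<bullet> b - y \<bullet> b)) \<partial>lborel) - H z) < \<epsilon>"
      unfolding HP using est[of n] N0[of n] by simp
  qed
qed

end

text \<open>\<open>box_half\<close> keeps coordinate differences within one period around 0, and
  \<open>R_big\<close> prevents the reflected times, which reach several multiples of
  \<open>T\<close> beyond \<open>a\<close>, from coming back to the slab modulo 2 R.\<close>

locale slab_full = slab_end \<tau> T k G a R X lo hi F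
  for \<tau> :: "'a::euclidean_space" and T k and G :: "'a \<Rightarrow> nat \<Rightarrow> 'a \<Rightarrow> real" and a R X lo hi F +
  assumes R_big: "(2 * real k + 2) * T \<le> R"
    and box_half: "\<And>b. b \<in> Basis \<Longrightarrow> - R / 2 \<le> lo \<bullet> b" "\<And>b. b \<in> Basis \<Longrightarrow> hi \<bullet> b \<le> R / 2"
    and F_cont: "\<And>z. 0 < z \<bullet> \<tau> \<Longrightarrow> z \<bullet> \<tau> < T \<Longrightarrow> isCont F z"
    and F_bdd: "\<exists>B. \<forall>z\<in>cbox lo hi. \<bar>F z\<bar> \<le> B"
begin

lemma F_meas: "F \<in> borel_measurable borel"
  using G_meas[OF tau, of 0] G0[OF tau] by simp

lemma F_zero: "\<not> (0 < z \<bullet> \<tau> \<and> z \<bullet> \<tau> < T) \<Longrightarrow> F z = 0"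
  using G_supp[of z \<tau> 0] G0[OF tau] by simp

section \<open>Smoothed Fourier sums and their pointwise limit\<close>

definition wN :: "nat \<Rightarrow> nat \<Rightarrow> real" where
  "wN N = (SOME w. (\<forall>u. fk R N u = (\<Sum>n\<le>N. w n * cos (lam * real n * u))) \<and> (\<forall>n\<le>N. \<bar>w n\<bar> \<le> 1 / R))"

lemma wN: "fk R N u = (\<Sum>n\<le>N. wN N n * cos (lam * real n * u))" "n \<le> N \<Longrightarrow> \<bar>wN N n\<bar> \<le> 1 / R"
proof -
  have "(\<forall>u. fk R N u = (\<Sum>n\<le>N. wN N n * cos (lam * real n * u))) \<and> (\<forall>n\<le>N. \<bar>wN N n\<bar> \<le> 1 / R)"
    using someI_ex[OF fk_expansion[OF R_pos, of N]] unfolding wN_def lam_def .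
  then show "fk R N u = (\<Sum>n\<le>N. wN N n * cos (lam * real n * u))" "n \<le> N \<Longrightarrow> \<bar>wN N n\<bar> \<le> 1 / R"
    by blast+
qed

definition JN :: "nat \<Rightarrow> ('a \<Rightarrow> nat \<times> bool) set" where "JN N = (\<Pi>\<^sub>E b\<in>Basis. {..N} \<times> UNIV)"

lemma JN: "finite (JN N)" "JN N \<subseteq> (\<Pi>\<^sub>E b\<in>Basis. UNIV)"
  unfolding JN_def by (auto intro!: finite_PiE)

text \<open>Multiplying the coefficients by those of the kernel amounts to convolving the reflected
  extension with the tensor kernel; \<open>sig_integral\<close> makes this explicit.\<close>

definition sig :: "nat \<Rightarrow> 'a \<Rightarrow> real" where
  "sig N z = (\<Sum>\<iota>\<in>JN N. (\<Prod>b\<in>Basis. wN N (fst (\<iota> b))) * coef \<iota> *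
     (\<Prod>b\<in>Basis. cos (lam * real (fst (\<iota> b)) * (z \<bullet> b) - ph (snd (\<iota> b)))))"

text \<open>The kernel with the reflection moved onto the integration variable \<open>y\<close>.
  Outside the direction \<tau> it is just \<open>fk R N (x - y)\<close>.\<close>

definition KV :: "'a \<Rightarrow> nat \<Rightarrow> real \<Rightarrow> real \<Rightarrow> real" where
  "KV b N x y = (\<Sum>j\<in>Jb b. cj j * of_int (yj j) ^ k * fk R N (x - (ab b + of_int (yj j) * (y - ab b))))"

lemma KV_expansion:
  "KV b N x y = (\<Sum>\<nu>\<in>{..N} \<times> UNIV. wN N (fst \<nu>) * cos (lam * real (fst \<nu>) * x - ph (snd \<nu>)) * V b k \<nu> y)"
proof -
  have fkA: "fk R N (x - A) = (\<Sum>\<nu>\<in>{..N} \<times> UNIV. wN N (fst \<nu>) * cos (lam * real (fst \<nu>) * x - ph (snd \<nu>)) *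
      cos (lam * real (fst \<nu>) * A - ph (snd \<nu>)))" for A
  proof -
    \<comment> \<open>The addition theorem: the sum over \<open>s\<close> is cos cos + sin sin,
      which separates the two variables.\<close>
    have "cos (lam * real n * (x - A)) = (\<Sum>s\<in>UNIV. cos (lam * real n * x - ph s) * cos (lam * real n * A - ph s))" for n
      by (simp add: UNIV_bool ph_def cos_diff right_diff_distrib)
    then have "fk R N (x - A) = (\<Sum>n\<le>N. \<Sum>s\<in>UNIV. wN N n * (cos (lam * real n * x - ph s) * cos (lam * real n * A - ph s)))"
      by (simp only: wN(1) sum_distrib_left)
    also have "\<dots> = (\<Sum>\<nu>\<in>{..N} \<times> UNIV. wN N (fst \<nu>) * (cos (lam * real (fst \<nu>) * x - ph (snd \<nu>)) *
      cos (lam * real (fst \<nu>) * A - ph (snd \<nu>))))"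
      by (simp only: sum.cartesian_product case_prod_unfold)
    finally show ?thesis by (simp only: mult.assoc)
  qed
  show ?thesis
    unfolding KV_def V_def fkA sum_distrib_left
    by (subst sum.swap) (intro sum.cong refl, simp add: mult_ac)
qed

lemma q_int: "integrable lborel (\<lambda>z. tens (\<lambda>c. q c (\<iota> c)) z * F z)"
  using G_int_tens[OF tau _ q_box, of 0 \<iota>] G0[OF tau] by simp

lemma sig_integral:
  "sig N z = (\<integral>y. F y * (\<Prod>b\<in>Basis. X b (y \<bullet> b) * KV b N (z \<bullet> b) (y \<bullet> b)) \<partial>lborel)"
proof -
  have "F y * (\<Prod>b\<in>Basis. X b (y \<bullet> b) * KV b N (z \<bullet> b) (y \<bullet> b)) =
    (\<Sum>\<iota>\<in>JN N. ((\<Prod>b\<in>Basis. wN N (fst (\<iota> b))) * (\<Prod>b\<in>Basis. cos (lam * real (fst (\<iota> b)) * (z \<bullet> b) - ph (snd (\<iota> b))))) *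
      (tens (\<lambda>c. q c (\<iota> c)) y * F y))" for y
  proof -
    have "(\<Prod>b\<in>Basis. X b (y \<bullet> b) * KV b N (z \<bullet> b) (y \<bullet> b)) =
      (\<Prod>b\<in>Basis. \<Sum>\<nu>\<in>{..N} \<times> UNIV. wN N (fst \<nu>) * cos (lam * real (fst \<nu>) * (z \<bullet> b) - ph (snd \<nu>)) * q b \<nu> (y \<bullet> b))"
      unfolding KV_expansion sum_distrib_left q_def by (intro prod.cong sum.cong refl) (simp add: mult_ac)
    also have "\<dots> = (\<Sum>\<iota>\<in>JN N. \<Prod>b\<in>Basis. wN N (fst (\<iota> b)) * cos (lam * real (fst (\<iota> b)) * (z \<bullet> b) - ph (snd (\<iota> b))) * q b (\<iota> b) (y \<bullet> b))"
      unfolding JN_def by (rule prod_sum_PiE) auto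
    finally show ?thesis
      unfolding tens_def by (simp add: sum_distrib_left prod.distrib mult_ac)
  qed
  then show ?thesis
    unfolding sig_def coef_def
    by (simp only: Bochner_Integration.integral_sum[OF integrable_mult_right[OF q_int]] integral_mult_right_zero) (simp only: mult_ac)
qed

text \<open>For \<open>j \<ge> 1\<close> the map \<open>t \<mapsto> a + yj j * (t - a)\<close> sends the time interval to the other side of \<open>a\<close>,
  away from \<open>z\<close> even modulo the period \<open>2 R\<close>.\<close>
lemma reflected_kernel_vanishes:
  assumes z: "0 < z \<bullet> \<tau>" "z \<bullet> \<tau> < T" "\<And>b. b \<in> Basis \<Longrightarrow> \<bar>z \<bullet> b\<bar> \<le> R / 2" and j: "1 \<le> j" "j \<le> k"
    and Hm: "H \<in> borel_measurable borel" and HB: "\<And>y. \<bar>H y\<bar> \<le> B"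
    and Hz: "\<And>y. H y \<noteq> 0 \<Longrightarrow> y \<in> cbox lo hi \<and> 0 < y \<bullet> \<tau> \<and> y \<bullet> \<tau> < T"
  shows "(\<lambda>N. \<integral>y. H y * (fk R N (z \<bullet> \<tau> - (a + of_int (yj j) * (y \<bullet> \<tau> - a))) *
     (\<Prod>b\<in>Basis - {\<tau>}. fk R N (z \<bullet> b - y \<bullet> b))) \<partial>lborel) \<longlonglongrightarrow> 0"
proof -
  have B: "B \<ge> 0" using HB[of z] by linarith
  \<comment> \<open>The distance of \<open>z\<close> to the ends of the slab. A reflected time lies
    beyond \<open>a\<close>, so it is at least this far from
    \<open>z \<bullet> \<tau>\<close>.\<close>
  define \<delta> where "\<delta> = min (z \<bullet> \<tau>) (T - z \<bullet> \<tau>)"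
  have TR: "2 * T \<le> R"
  proof -
    have "(2 * real k + 2) * T = 2 * (real k * T) + 2 * T" by (simp add: algebra_simps)
    moreover have "0 \<le> real k * T" using T_pos by simp
    ultimately show ?thesis using R_big by linarith
  qed
  have \<delta>: "0 < \<delta>" "\<delta> \<le> R" using z T_pos TR by (auto simp: \<delta>_def)
  obtain \<kappa> where \<kappa>: "\<kappa> \<longlonglongrightarrow> 0" "\<And>N. \<kappa> N \<ge> 0" "\<And>N u. \<delta> \<le> \<bar>u\<bar> \<Longrightarrow> \<bar>u\<bar> \<le> 2 * R - \<delta> \<Longrightarrow> fk R N u \<le> \<kappa> N"
    using fk_concentration[OF R_pos \<delta>] by blast
  have refl_le: "fk R N (z \<bullet> \<tau> - (a + of_int (yj j) * (t - a))) \<le> \<kappa> N" if t: "0 < t" "t < T" for N t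
  proof (rule \<kappa>(3))
    have jk: "real j * t \<le> real k * T" "real j * (T - t) \<le> real k * T" using j t by (auto intro!: mult_mono)
    have jt: "t \<le> real j * t" "T - t \<le> real j * (T - t)"
      using mult_right_mono[of 1 "real j" t] mult_right_mono[of 1 "real j" "T - t"] j t by auto
    have y: "real_of_int (yj j) = 1 - 2 * real j" by (simp add: yj_def)
    have R2: "2 * (real k * T) + 2 * T \<le> R" using R_big by (simp add: algebra_simps)
    consider "a = 0" | "a = T" using ends by auto
    then have "\<delta> \<le> \<bar>z \<bullet> \<tau> - (a + of_int (yj j) * (t - a))\<bar> \<and> \<bar>z \<bullet> \<tau> - (a + of_int (yj j) * (t - a))\<bar> \<le> 2 * R - \<delta>"
    proof cases
      case 1
      then have "z \<bullet> \<tau> - (a + of_int (yj j) * (t - a)) = z \<bullet> \<tau> + 2 * (real j * t) - t"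
        by (simp add: y algebra_simps)
      note u = this
      show ?thesis unfolding u \<delta>_def using jk jt z(1,2) t R2 T_pos R_pos by (intro conjI) linarith+
    next
      case 2
      then have "z \<bullet> \<tau> - (a + of_int (yj j) * (t - a)) = - (T - z \<bullet> \<tau>) - 2 * (real j * (T - t)) + (T - t)"
        by (simp add: y algebra_simps)
      note u = this
      show ?thesis unfolding u \<delta>_def using jk jt z(1,2) t R2 T_pos R_pos by (intro conjI) linarith+
    qed
    then show "\<delta> \<le> \<bar>z \<bullet> \<tau> - (a + of_int (yj j) * (t - a))\<bar>" "\<bar>z \<bullet> \<tau> - (a + of_int (yj j) * (t - a))\<bar> \<le> 2 * R - \<delta>" by auto
  qed
  \<comment> \<open>In the direction \<tau> the kernel has already been estimated by \<kappa> N, so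
    only an indicator of mass 2 R is left there; the other directions keep mass 1.\<close>
  define P where "P = (\<lambda>N b y. if b = \<tau> then indicator {-R..R} y * 1 else indicator {-R..R} (z \<bullet> b - y) * fk R N (z \<bullet> b - y))"
  have Pi: "integrable lborel (P N b)" for N b
    unfolding P_def using fk_shift_integral(1)[OF R_pos, of "z \<bullet> b" N] integrable_Icc_mult[of "\<lambda>_. 1" "-R" R]
    by (cases "b = \<tau>") auto
  have PI: "(\<integral>y. P N b y \<partial>lborel) = (if b = \<tau> then 2 * R else 1)" for N b
    unfolding P_def using fk_shift_integral(2)[OF R_pos, of "z \<bullet> b" N] R_pos by (cases "b = \<tau>") auto
  define PP where "PP = (\<lambda>N (y::'a). \<Prod>b\<in>Basis. P N b (y \<bullet> b))"
  have PPi: "integrable lborel (PP N)" for N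
    unfolding PP_def by (intro lborel_prod_integral(1) Pi)
  have PPI: "(\<integral>y. PP N y \<partial>lborel) = 2 * R" for N
    unfolding PP_def lborel_prod_integral(2)[of "P N", OF Pi] PI using tau by simp
  have bnd: "\<bar>H y * (fk R N (z \<bullet> \<tau> - (a + of_int (yj j) * (y \<bullet> \<tau> - a))) * (\<Prod>b\<in>Basis - {\<tau>}. fk R N (z \<bullet> b - y \<bullet> b)))\<bar> \<le> B * \<kappa> N * PP N y" for N y
  proof (cases "H y = 0")
    case True
    have "0 \<le> PP N y" unfolding PP_def P_def using fk_nonneg[OF R_pos] by (intro prod_nonneg) (auto simp: indicator_def)
    then show ?thesis using True B \<kappa>(2) by simp
  next
    case False
    then have y: "y \<in> cbox lo hi" "0 < y \<bullet> \<tau>" "y \<bullet> \<tau> < T" using Hz by auto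
    have yb: "\<bar>y \<bullet> b\<bar> \<le> R / 2" if "b \<in> Basis" for b
      using y(1) box_half[OF that] that by (force simp: mem_box)
    have "PP N y = P N \<tau> (y \<bullet> \<tau>) * (\<Prod>b\<in>Basis - {\<tau>}. P N b (y \<bullet> b))"
      unfolding PP_def by (rule prod.remove[OF finite_Basis tau])
    also have "P N \<tau> (y \<bullet> \<tau>) = 1" using yb[OF tau] R_pos by (auto simp: P_def indicator_def)
    also have "(\<Prod>b\<in>Basis - {\<tau>}. P N b (y \<bullet> b)) = (\<Prod>b\<in>Basis - {\<tau>}. fk R N (z \<bullet> b - y \<bullet> b))"
    proof (intro prod.cong refl)
      fix b assume b: "b \<in> Basis - {\<tau>}"
      then have "\<bar>z \<bullet> b\<bar> \<le> R / 2" "\<bar>y \<bullet> b\<bar> \<le> R / 2" using z(3) yb by auto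
      then have "z \<bullet> b - y \<bullet> b \<in> {-R..R}" by auto
      then show "P N b (y \<bullet> b) = fk R N (z \<bullet> b - y \<bullet> b)" using b by (simp add: P_def)
    qed
    finally have PPe: "PP N y = (\<Prod>b\<in>Basis - {\<tau>}. fk R N (z \<bullet> b - y \<bullet> b))" by simp
    have p0: "0 \<le> (\<Prod>b\<in>Basis - {\<tau>}. fk R N (z \<bullet> b - y \<bullet> b))" by (intro prod_nonneg) (simp add: fk_nonneg[OF R_pos])
    have "\<bar>H y * (fk R N (z \<bullet> \<tau> - (a + of_int (yj j) * (y \<bullet> \<tau> - a))) * (\<Prod>b\<in>Basis - {\<tau>}. fk R N (z \<bullet> b - y \<bullet> b)))\<bar> =
       \<bar>H y\<bar> * (fk R N (z \<bullet> \<tau> - (a + of_int (yj j) * (y \<bullet> \<tau> - a))) * (\<Prod>b\<in>Basis - {\<tau>}. fk R N (z \<bullet> b - y \<bullet> b)))"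
      using p0 fk_nonneg[OF R_pos] by (simp add: abs_mult)
    also have "\<dots> \<le> B * (\<kappa> N * (\<Prod>b\<in>Basis - {\<tau>}. fk R N (z \<bullet> b - y \<bullet> b)))"
      by (intro mult_mono HB refl_le y(2,3) B p0 \<kappa>(2) mult_nonneg_nonneg fk_nonneg[OF R_pos]) auto
    finally show ?thesis by (simp only: PPe mult.assoc)
  qed
  let ?I = "\<lambda>N. \<integral>y. H y * (fk R N (z \<bullet> \<tau> - (a + of_int (yj j) * (y \<bullet> \<tau> - a))) * (\<Prod>b\<in>Basis - {\<tau>}. fk R N (z \<bullet> b - y \<bullet> b))) \<partial>lborel"
  have bd: "\<bar>?I N\<bar> \<le> B * \<kappa> N * (2 * R)" for N
  proof -
    have "\<bar>?I N\<bar> \<le> (\<integral>y. B * \<kappa> N * PP N y \<partial>lborel)"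
    proof (rule order_trans[OF integral_abs_bound integral_mono'])
      show "integrable lborel (\<lambda>y. B * \<kappa> N * PP N y)" using PPi by simp
      show "0 \<le> B * \<kappa> N * PP N y" for y using bnd[of y N] by linarith
    qed (rule bnd)
    then show ?thesis using PPI PPi by simp
  qed
  have "(\<lambda>N. B * \<kappa> N * (2 * R)) \<longlonglongrightarrow> B * 0 * (2 * R)"
    by (intro tendsto_mult tendsto_const \<kappa>)
  then have lim: "(\<lambda>N. B * \<kappa> N * (2 * R)) \<longlonglongrightarrow> 0" by simp
  have "\<forall>\<^sub>F N in sequentially. norm (?I N) \<le> B * \<kappa> N * (2 * R)"
    using bd by (intro always_eventually allI) (simp only: real_norm_def)
  from Lim_null_comparison[OF this lim] show ?thesis .
qed

text \<open>The unreflected term \<open>j = 0\<close> has weight 1 and converges by the approximate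
  identity; every reflected term tends to zero inside the slab.\<close>

lemma sig_limit:
  assumes z: "0 < z \<bullet> \<tau>" "z \<bullet> \<tau> < T" "\<And>b. b \<in> Basis \<Longrightarrow> \<bar>z \<bullet> b\<bar> \<le> R / 2"
  shows "(\<lambda>N. sig N z) \<longlonglongrightarrow> F z * tens X z"
proof -
  define H where "H = (\<lambda>y. F y * tens X y)"
  obtain B0 where B0: "\<And>y. \<bar>tens X y\<bar> \<le> B0" "B0 \<ge> 0" using tens_bounded[OF X] by blast
  obtain B1 where B1: "\<And>y. y \<in> cbox lo hi \<Longrightarrow> \<bar>F y\<bar> \<le> B1" using F_bdd by blast
  have Hz: "H y \<noteq> 0 \<Longrightarrow> y \<in> cbox lo hi \<and> 0 < y \<bullet> \<tau> \<and> y \<bullet> \<tau> < T" for y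
    using tens_zero[OF X, of y] F_zero[of y] by (auto simp: H_def)
  have HB: "\<bar>H y\<bar> \<le> \<bar>B1\<bar> * B0" for y
  proof (cases "H y = 0")
    case False
    then have "y \<in> cbox lo hi" using Hz by blast
    from B1[OF this] show ?thesis
      unfolding H_def abs_mult using B0 by (intro mult_mono) auto
  qed (use B0 in auto)
  have Hm: "H \<in> borel_measurable borel"
    unfolding H_def using F_meas tens_measurable[OF X] by (rule borel_measurable_times)
  define I where "I = (\<lambda>N j y. H y * (fk R N (z \<bullet> \<tau> - (a + of_int (yj j) * (y \<bullet> \<tau> - a))) * (\<Prod>b\<in>Basis - {\<tau>}. fk R N (z \<bullet> b - y \<bullet> b))))"
  have Hc: "isCont H z"
  proof -
    have "isCont (tens X) z"
      using tens_continuous[of X UNIV] X by (simp add: continuous_on_eq_continuous_at smooth_box_def)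
    then show ?thesis unfolding H_def using F_cont[OF z(1,2)] by (intro continuous_mult)
  qed
  have split: "F y * (\<Prod>b\<in>Basis. X b (y \<bullet> b) * KV b N (z \<bullet> b) (y \<bullet> b)) = (\<Sum>j\<le>k. cj j * of_int (yj j) ^ k * I N j y)" for N y
  proof -
    have "(\<Prod>b\<in>Basis. KV b N (z \<bullet> b) (y \<bullet> b)) = KV \<tau> N (z \<bullet> \<tau>) (y \<bullet> \<tau>) * (\<Prod>b\<in>Basis - {\<tau>}. KV b N (z \<bullet> b) (y \<bullet> b))"
      by (rule prod.remove[OF finite_Basis tau])
    also have "(\<Prod>b\<in>Basis - {\<tau>}. KV b N (z \<bullet> b) (y \<bullet> b)) = (\<Prod>b\<in>Basis - {\<tau>}. fk R N (z \<bullet> b - y \<bullet> b))"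
      by (intro prod.cong refl) (simp add: KV_def Jb_def ab_def cj_def yj_def)
    also have "KV \<tau> N (z \<bullet> \<tau>) (y \<bullet> \<tau>) = (\<Sum>j\<le>k. cj j * of_int (yj j) ^ k * fk R N (z \<bullet> \<tau> - (a + of_int (yj j) * (y \<bullet> \<tau> - a))))"
      by (simp add: KV_def Jb_def ab_def)
    finally show ?thesis
      unfolding prod.distrib by (simp add: I_def H_def tens_def sum_distrib_left sum_distrib_right mult_ac)
  qed
  have fk_le: "\<exists>C\<ge>0. \<forall>u. \<bar>fk R N u\<bar> \<le> C" for N
  proof (intro exI conjI allI)
    show "(\<Sum>n\<le>N. \<bar>wN N n\<bar>) \<ge> 0" by (intro sum_nonneg) auto
    fix u
    have "\<bar>fk R N u\<bar> \<le> (\<Sum>n\<le>N. \<bar>wN N n * cos (lam * real n * u)\<bar>)" unfolding wN(1) by (rule sum_abs)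
    also have "\<dots> \<le> (\<Sum>n\<le>N. \<bar>wN N n\<bar>)"
      unfolding abs_mult by (intro sum_mono mult_left_le) auto
    finally show "\<bar>fk R N u\<bar> \<le> (\<Sum>n\<le>N. \<bar>wN N n\<bar>)" .
  qed
  have I_int: "integrable lborel (I N j)" for N j
  proof -
    obtain C where C: "C \<ge> 0" "\<And>u. \<bar>fk R N u\<bar> \<le> C" using fk_le by blast
    have c: "continuous_on UNIV (\<lambda>y::'a. fk R N (z \<bullet> b - y \<bullet> b))" for b
      by (intro continuous_on_compose2[OF fk_cont[OF R_pos]] continuous_intros) auto
    have c': "continuous_on UNIV (\<lambda>y::'a. fk R N (z \<bullet> \<tau> - (a + of_int (yj j) * (y \<bullet> \<tau> - a))))"
      by (intro continuous_on_compose2[OF fk_cont[OF R_pos]] continuous_intros) auto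
    let ?u = "\<lambda>y. tens X y * (fk R N (z \<bullet> \<tau> - (a + of_int (yj j) * (y \<bullet> \<tau> - a))) * (\<Prod>b\<in>Basis - {\<tau>}. fk R N (z \<bullet> b - y \<bullet> b)))"
    have "integrable lborel (\<lambda>y. ?u y * G \<tau> 0 y)"
    proof (rule G_int[OF tau, of 0 _ "B0 * (C * C ^ card (Basis - {\<tau>}))" lo hi])
      show "?u \<in> borel_measurable borel"
        using c c' by (intro borel_measurable_times[OF tens_measurable[OF X]] borel_measurable_times
            borel_measurable_prod borel_measurable_continuous_onI)
      show "\<bar>?u y\<bar> \<le> B0 * (C * C ^ card (Basis - {\<tau>}))" for y
        unfolding abs_mult abs_prod prod_constant[symmetric] using B0 C
        by (intro mult_mono prod_mono mult_nonneg_nonneg prod_nonneg) auto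
    qed (use tens_zero[OF X] in auto)
    then show ?thesis by (simp add: I_def[abs_def] H_def G0[OF tau] mult_ac)
  qed
  have sig_eq: "sig N z = (\<Sum>j\<le>k. cj j * of_int (yj j) ^ k * (\<integral>y. I N j y \<partial>lborel))" for N
    unfolding sig_integral split using I_int by simp
  have lim: "(\<lambda>N. \<integral>y. I N j y \<partial>lborel) \<longlonglongrightarrow> (if j = 0 then H z else 0)" if "j \<le> k" for j
  proof (cases "j = 0")
    case True
    have "I N j y = H y * (\<Prod>b\<in>Basis. fk R N (z \<bullet> b - y \<bullet> b))" for N y
      unfolding I_def True by (subst prod.remove[OF finite_Basis tau]) (simp add: yj_def)
    moreover have "H y = 0" if b: "b \<in> Basis" "\<bar>z \<bullet> b - y \<bullet> b\<bar> > R" for y b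
    proof (rule ccontr)
      assume "H y \<noteq> 0"
      then have "y \<in> cbox lo hi" using Hz by blast
      then have "\<bar>y \<bullet> b\<bar> \<le> R / 2" using box_half[OF b(1)] b(1) by (force simp: mem_box)
      then show False using z(3)[OF b(1)] b(2) by linarith
    qed
    ultimately show ?thesis using fk_tensor_limit[OF R_pos Hm HB _ Hc] True by simp
  next
    case False
    then show ?thesis using reflected_kernel_vanishes[OF z _ that Hm HB Hz] by (simp add: I_def)
  qed
  have "(\<lambda>N. sig N z) \<longlonglongrightarrow> (\<Sum>j\<le>k. cj j * of_int (yj j) ^ k * (if j = 0 then H z else 0))"
    unfolding sig_eq by (intro tendsto_sum tendsto_mult tendsto_const lim) auto
  also have "(\<Sum>j\<le>k. cj j * of_int (yj j) ^ k * (if j = 0 then H z else 0)) = H z"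
    by (simp add: cj_def yj_def if_distrib cong: if_cong)
  finally show ?thesis by (simp add: H_def)
qed

end

section \<open>Duality bound against ReLU ridge functions\<close>

text \<open>Offsets up to \<rho> would suffice for genuine ridges on the ball. The additional 1
  admits \<open>v = 0\<close>, \<open>c = 1\<close>, so constants are controlled as well.\<close>

definition ridge_le :: "'a::euclidean_space measure \<Rightarrow> real \<Rightarrow> ('a \<Rightarrow> real) \<Rightarrow> real \<Rightarrow> bool" where
  "ridge_le \<mu> \<rho> h \<kappa> \<longleftrightarrow>
    (\<forall>v c. norm v \<le> 1 \<longrightarrow> \<bar>c\<bar> \<le> \<rho> + 1 \<longrightarrow> \<bar>\<integral>z. h z * max 0 (v \<bullet> z + c) \<partial>\<mu>\<bar> \<le> \<kappa>)"

text \<open>Polar form of membership in \<open>M\<close> times the closed symmetric convex hull of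
  the ridge functions. All finite measures are treated at once, so the constant can be found before
  a measure is specified.\<close>

definition ridge_dual :: "'a::euclidean_space set \<Rightarrow> real \<Rightarrow> ('a \<Rightarrow> real) \<Rightarrow> real \<Rightarrow> bool" where
  "ridge_dual \<Omega> \<rho> F M \<longleftrightarrow> (\<forall>\<mu> h B \<kappa>. finite_measure \<mu> \<longrightarrow> sets \<mu> = sets borel \<longrightarrow>
    h \<in> borel_measurable borel \<longrightarrow> (\<forall>z. \<bar>h z\<bar> \<le> B) \<longrightarrow> (\<forall>z. h z \<noteq> 0 \<longrightarrow> z \<in> \<Omega>) \<longrightarrow>
    ridge_le \<mu> \<rho> h \<kappa> \<longrightarrow> \<bar>\<integral>z. h z * F z \<partial>\<mu>\<bar> \<le> M * \<kappa>)"

definition slab_ball :: "'a::euclidean_space \<Rightarrow> real \<Rightarrow> real \<Rightarrow> 'a set" where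
  "slab_ball \<tau> T \<rho> = {z. norm z \<le> \<rho> \<and> 0 < z \<bullet> \<tau> \<and> z \<bullet> \<tau> < T}"

text \<open>Second-order Taylor formula at the left end \<open>-U\<close>. Writing the remainder
  kernel as \<open>max 0 (t - s)\<close> frees the range of integration from \<open>t\<close>, and t
  + U is itself a ReLU on the range.\<close>

lemma cos_taylor_relu:
  fixes U t c :: real
  assumes "\<bar>t\<bar> \<le> U"
  shows "cos (t + c) = cos (c - U) - sin (c - U) * (t + U) -
     (\<integral>s. indicator {-U..U} s * (max 0 (t - s) * cos (s + c)) \<partial>lborel)"
proof -
  have "(\<integral>s. indicator {-U..U} s * (max 0 (t - s) * cos (s + c)) \<partial>lborel) = (\<integral>s. indicator {-U..t} s *\<^sub>R ((t - s) * cos (s + c)) \<partial>lborel)"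
    using assms by (intro Bochner_Integration.integral_cong) (auto simp: indicator_def max_def)
  also have "\<dots> = ((t - t) * sin (t + c) - cos (t + c)) - ((t - (-U)) * sin (-U + c) - cos (-U + c))"
  proof (rule integral_FTC_atLeastAtMost)
    show "((\<lambda>s. (t - s) * sin (s + c) - cos (s + c)) has_vector_derivative (t - s) * cos (s + c)) (at s within {-U..t})" for s
      unfolding has_real_derivative_iff_has_vector_derivative[symmetric]
      by (auto intro!: derivative_eq_intros)
  qed (use assms in \<open>auto intro!: continuous_intros\<close>)
  finally show ?thesis by (simp add: algebra_simps)
qed

context
  fixes \<mu> :: "'a::euclidean_space measure" and h :: "'a \<Rightarrow> real" and \<rho> B \<kappa> :: real
  assumes fin: "finite_measure \<mu>" and sets_mu: "sets \<mu> = sets borel"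
    and h_meas: "h \<in> borel_measurable borel" and h_bdd: "\<And>z. \<bar>h z\<bar> \<le> B"
    and h_supp': "\<forall>z. h z \<noteq> 0 \<longrightarrow> norm z \<le> \<rho>" and rho: "\<rho> \<ge> 0"
    and atoms': "ridge_le \<mu> \<rho> h \<kappa>"
begin

lemma h_supp: "h z \<noteq> 0 \<Longrightarrow> norm z \<le> \<rho>"
  and atoms: "norm v \<le> 1 \<Longrightarrow> \<bar>c\<bar> \<le> \<rho> + 1 \<Longrightarrow> \<bar>\<integral>z. h z * max 0 (v \<bullet> z + c) \<partial>\<mu>\<bar> \<le> \<kappa>"
  using h_supp' atoms' unfolding ridge_le_def by blast+

lemma meas_mu: "g \<in> borel_measurable borel \<Longrightarrow> g \<in> borel_measurable \<mu>"
  using measurable_cong_sets[OF sets_mu refl] by blast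

lemma h_integrable:
  assumes "g \<in> borel_measurable borel" and "\<And>z. norm z \<le> \<rho> \<Longrightarrow> \<bar>g z\<bar> \<le> C"
  shows "integrable \<mu> (\<lambda>z. h z * g z)"
proof (rule finite_measure.integrable_const_bound[OF fin, of _ "B * \<bar>C\<bar>"])
  have "\<bar>h z\<bar> * \<bar>g z\<bar> \<le> B * \<bar>C\<bar>" for z
  proof (cases "h z = 0")
    case False
    then have "\<bar>g z\<bar> \<le> \<bar>C\<bar>" using assms(2)[OF h_supp] by force
    then show ?thesis using h_bdd[of z] by (intro mult_mono) auto
  next
    case True
    then show ?thesis using h_bdd[of z] by simp
  qed
  then show "AE z in \<mu>. norm (h z * g z) \<le> B * \<bar>C\<bar>" by (simp add: abs_mult)
  show "(\<lambda>z. h z * g z) \<in> borel_measurable \<mu>" using assms(1) h_meas by (intro meas_mu borel_measurable_times)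
qed

lemma kappa_nonneg: "\<kappa> \<ge> 0"
  using atoms[of 0 0] rho by simp

lemma inner_rho: "norm z \<le> \<rho> \<Longrightarrow> \<bar>\<xi> \<bullet> z\<bar> \<le> norm \<xi> * \<rho>"
  by (meson Cauchy_Schwarz_ineq2 mult_left_mono norm_ge_zero order_trans)

text \<open>Positive homogeneity: \<open>norm \<xi>\<close> is pulled out, and the offset divided by
  it is at most \<rho>.\<close>

lemma scaled_atom:
  assumes "\<bar>c\<bar> \<le> norm \<xi> * \<rho>"
  shows "\<bar>\<integral>z. h z * max 0 (\<xi> \<bullet> z + c) \<partial>\<mu>\<bar> \<le> norm \<xi> * \<kappa>"
proof (cases "\<xi> = 0")
  case True
  then show ?thesis using assms by simp
next
  case False
  have n: "norm \<xi> > 0" using False by simp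
  let ?v = "\<xi> /\<^sub>R norm \<xi>"
  have "\<bar>c / norm \<xi>\<bar> \<le> \<rho>" using assms n by (simp add: pos_divide_le_eq mult.commute)
  then have 1: "\<bar>\<integral>z. h z * max 0 (?v \<bullet> z + c / norm \<xi>) \<partial>\<mu>\<bar> \<le> \<kappa>"
    using n by (intro atoms) auto
  have "max 0 (\<xi> \<bullet> z + c) = norm \<xi> * max 0 (?v \<bullet> z + c / norm \<xi>)" for z
  proof -
    have "\<xi> \<bullet> z + c = norm \<xi> * (?v \<bullet> z + c / norm \<xi>)" using n by (simp add: field_simps)
    then show ?thesis using n by (simp add: max_mult_distrib_left)
  qed
  then have "(\<integral>z. h z * max 0 (\<xi> \<bullet> z + c) \<partial>\<mu>) = norm \<xi> * (\<integral>z. h z * max 0 (?v \<bullet> z + c / norm \<xi>) \<partial>\<mu>)"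
    by (simp add: mult.left_commute)
  then show ?thesis using 1 n by (simp add: abs_mult)
qed

text \<open>The three summands bound the three parts of \<open>cos_taylor_relu\<close>: the
  constant, the affine part, which is one ridge function, and the remainder, a superposition of
  ridges over an interval of length 2 U with \<open>U = norm \<xi> * \<rho>\<close>. Fubini moves
  the superposition outside.\<close>

lemma cos_dual:
  "\<bar>\<integral>z. h z * cos (\<xi> \<bullet> z + c) \<partial>\<mu>\<bar> \<le> \<kappa> * (1 + norm \<xi> + 2 * \<rho> * (norm \<xi>)\<^sup>2)"
proof -
  define U where "U = norm \<xi> * \<rho>"
  have U: "U \<ge> 0" using rho by (simp add: U_def)
  define f where "f = (\<lambda>z s. h z * (indicator {-U..U} s * (max 0 (\<xi> \<bullet> z - s) * cos (s + c))))"
  have fm: "(\<lambda>(z, s). f z s) \<in> borel_measurable (borel \<Otimes>\<^sub>M borel)"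
    unfolding f_def using h_meas by measurable
  interpret finite_measure \<mu> by (rule fin)
  interpret pair_sigma_finite \<mu> lborel ..
  have fm': "(\<lambda>(z, s). f z s) \<in> borel_measurable (\<mu> \<Otimes>\<^sub>M lborel)"
    using fm measurable_cong_sets[OF sets_pair_measure_cong[OF sets_mu sets_lborel] refl] by blast
  have f_bd: "\<bar>f z s\<bar> \<le> indicator {-U..U} s * (B * (2 * U))" for z s
  proof (cases "h z = 0 \<or> s \<notin> {-U..U}")
    case True
    moreover have "0 \<le> B" using h_bdd[of z] by linarith
    ultimately show ?thesis using U by (auto simp: f_def)
  next
    case False
    then have "\<bar>\<xi> \<bullet> z\<bar> \<le> U" unfolding U_def by (intro inner_rho h_supp) auto
    then have "\<bar>max 0 (\<xi> \<bullet> z - s)\<bar> \<le> 2 * U" using False by auto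
    then have "\<bar>h z\<bar> * (\<bar>max 0 (\<xi> \<bullet> z - s)\<bar> * \<bar>cos (s + c)\<bar>) \<le> B * (2 * U * 1)"
      using h_bdd[of z] U by (intro mult_mono) auto
    then show ?thesis using False by (simp add: f_def abs_mult)
  qed
  have f_int: "integrable lborel (f z)" for z
    unfolding f_def by (intro integrable_mult_right integrable_Icc_mult continuous_intros)
  have fI: "integrable (\<mu> \<Otimes>\<^sub>M lborel) (\<lambda>(z, s). f z s)"
  proof (rule Fubini_integrable[OF fm'])
    show "AE z in \<mu>. integrable lborel (\<lambda>s. case (z, s) of (z, s) \<Rightarrow> f z s)" using f_int by simp
    show "integrable \<mu> (\<lambda>z. \<integral>s. norm (case (z, s) of (z, s) \<Rightarrow> f z s) \<partial>lborel)"
    proof (rule integrable_const_bound[of _ "2 * U * (B * (2 * U))"])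
      have "(\<integral>s. \<bar>f z s\<bar> \<partial>lborel) \<le> (\<integral>s. indicator {-U..U} s * (B * (2 * U)) \<partial>lborel)" for z
        by (intro integral_mono f_bd integrable_abs f_int integrable_Icc_mult continuous_intros)
      then show "AE z in \<mu>. norm (\<integral>s. norm (case (z, s) of (z, s) \<Rightarrow> f z s) \<partial>lborel) \<le> 2 * U * (B * (2 * U))"
        using U by simp
      show "(\<lambda>z. \<integral>s. norm (case (z, s) of (z, s) \<Rightarrow> f z s) \<partial>lborel) \<in> borel_measurable \<mu>"
      proof -
        have "(\<lambda>(z, s). \<bar>f z s\<bar>) \<in> borel_measurable (\<mu> \<Otimes>\<^sub>M lborel)"
          using borel_measurable_abs[OF fm'] by (simp add: case_prod_unfold)
        from lborel.borel_measurable_lebesgue_integral[OF this] show ?thesis by simp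
      qed
    qed
  qed
  define I where "I = (\<lambda>s. \<integral>z. h z * max 0 (\<xi> \<bullet> z - s) \<partial>\<mu>)"
  have Ib: "\<bar>I s\<bar> \<le> norm \<xi> * \<kappa>" if "s \<in> {-U..U}" for s
  proof -
    have "\<bar>- s\<bar> \<le> norm \<xi> * \<rho>" using that by (auto simp: U_def)
    from scaled_atom[OF this] show ?thesis by (simp add: I_def)
  qed
  have fub: "(\<integral>z. (\<integral>s. f z s \<partial>lborel) \<partial>\<mu>) = (\<integral>s. indicator {-U..U} s * (cos (s + c) * I s) \<partial>lborel)"
  proof -
    have "(\<integral>z. (\<integral>s. f z s \<partial>lborel) \<partial>\<mu>) = (\<integral>s. (\<integral>z. f z s \<partial>\<mu>) \<partial>lborel)"
      using Fubini_integral[of "\<lambda>z s. f z s"] fI by simp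
    also have "(\<lambda>s. \<integral>z. f z s \<partial>\<mu>) = (\<lambda>s. indicator {-U..U} s * (cos (s + c) * I s))"
    proof
      fix s
      have "f z s = (indicator {-U..U} s * cos (s + c)) * (h z * max 0 (\<xi> \<bullet> z - s))" for z
        by (simp add: f_def mult_ac)
      then show "(\<integral>z. f z s \<partial>\<mu>) = indicator {-U..U} s * (cos (s + c) * I s)"
        by (simp add: I_def mult.assoc)
    qed
    finally show ?thesis .
  qed
  have J: "\<bar>\<integral>z. (\<integral>s. f z s \<partial>lborel) \<partial>\<mu>\<bar> \<le> 2 * U * (norm \<xi> * \<kappa>)"
  proof -
    have "\<bar>\<integral>z. (\<integral>s. f z s \<partial>lborel) \<partial>\<mu>\<bar> \<le> (\<integral>s. \<bar>indicator {-U..U} s * (cos (s + c) * I s)\<bar> \<partial>lborel)"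
      unfolding fub by (rule integral_abs_bound)
    also have "\<dots> \<le> (\<integral>s. indicator {-U..U} s * (norm \<xi> * \<kappa>) \<partial>lborel)"
    proof (rule integral_mono')
      show "integrable lborel (\<lambda>s. indicator {-U..U} s * (norm \<xi> * \<kappa>))"
        by (intro integrable_Icc_mult continuous_intros)
      show "0 \<le> indicator {-U..U} s * (norm \<xi> * \<kappa>)" for s using kappa_nonneg by simp
      show "\<bar>indicator {-U..U} s * (cos (s + c) * I s)\<bar> \<le> indicator {-U..U} s * (norm \<xi> * \<kappa>)" for s
        using mult_mono[OF abs_cos_le_one[of "s + c"] Ib[of s]] by (cases "s \<in> {-U..U}") (auto simp: abs_mult)
    qed
    finally show ?thesis using U by simp
  qed
  have i1: "integrable \<mu> h" using h_integrable[of "\<lambda>_. 1" 1] by simp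
  have i2: "integrable \<mu> (\<lambda>z. h z * max 0 (\<xi> \<bullet> z + U))"
  proof (rule h_integrable[of _ "2 * U"])
    fix z :: 'a assume "norm z \<le> \<rho>"
    moreover have "\<bar>max 0 (x + u)\<bar> \<le> 2 * u" if "\<bar>x\<bar> \<le> u" for x u :: real using that by auto
    ultimately show "\<bar>max 0 (\<xi> \<bullet> z + U)\<bar> \<le> 2 * U" unfolding U_def using inner_rho by blast
  qed measurable
  have i3: "integrable \<mu> (\<lambda>z. \<integral>s. f z s \<partial>lborel)"
    using integrable_fst[OF fI] by simp
  have "h z * cos (\<xi> \<bullet> z + c) = cos (c - U) * h z - sin (c - U) * (h z * max 0 (\<xi> \<bullet> z + U)) - (\<integral>s. f z s \<partial>lborel)" for z
  proof (cases "h z = 0")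
    case False
    then have le: "\<bar>\<xi> \<bullet> z\<bar> \<le> U" unfolding U_def by (intro inner_rho h_supp)
    then have "max 0 (\<xi> \<bullet> z + U) = \<xi> \<bullet> z + U" by auto
    then show ?thesis
      unfolding cos_taylor_relu[OF le, of c] f_def by (simp add: algebra_simps)
  qed (simp add: f_def)
  then have "(\<integral>z. h z * cos (\<xi> \<bullet> z + c) \<partial>\<mu>) =
     cos (c - U) * (\<integral>z. h z \<partial>\<mu>) - sin (c - U) * (\<integral>z. h z * max 0 (\<xi> \<bullet> z + U) \<partial>\<mu>) - (\<integral>z. (\<integral>s. f z s \<partial>lborel) \<partial>\<mu>)"
    using i1 i2 i3 by simp
  also have "\<bar>\<dots>\<bar> \<le> \<bar>cos (c - U)\<bar> * \<bar>\<integral>z. h z \<partial>\<mu>\<bar> + \<bar>sin (c - U)\<bar> * \<bar>\<integral>z. h z * max 0 (\<xi> \<bullet> z + U) \<partial>\<mu>\<bar> + \<bar>\<integral>z. (\<integral>s. f z s \<partial>lborel) \<partial>\<mu>\<bar>"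
    unfolding abs_mult[symmetric] by linarith
  also have "\<dots> \<le> 1 * \<kappa> + 1 * (norm \<xi> * \<kappa>) + 2 * U * (norm \<xi> * \<kappa>)"
  proof (intro add_mono mult_mono J)
    show "\<bar>\<integral>z. h z \<partial>\<mu>\<bar> \<le> \<kappa>" using atoms[of 0 1] rho by simp
    show "\<bar>\<integral>z. h z * max 0 (\<xi> \<bullet> z + U) \<partial>\<mu>\<bar> \<le> norm \<xi> * \<kappa>" using U by (intro scaled_atom) (simp add: U_def)
  qed auto
  also have "\<dots> = \<kappa> * (1 + norm \<xi> + 2 * \<rho> * (norm \<xi>)\<^sup>2)" by (simp add: U_def power2_eq_square algebra_simps)
  finally show ?thesis .
qed

text \<open>The product formula absorbs one factor into the leading cosine and leaves the mean of
  two cosines with frequencies \<open>\<xi>\<close> plus or minus \<open>\<alpha> e\<close>. A mean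
  preserves the bound, so the number of terms, though doubling, does not enter.\<close>

lemma cos_product_dual:
  assumes "finite A" "A \<subseteq> Basis"
  shows "\<bar>\<integral>z. h z * (cos (\<xi> \<bullet> z + c) * (\<Prod>b\<in>A. cos (\<alpha> b * (z \<bullet> b) - \<phi> b))) \<partial>\<mu>\<bar> \<le>
    \<kappa> * (1 + (norm \<xi> + (\<Sum>b\<in>A. \<bar>\<alpha> b\<bar>)) + 2 * \<rho> * (norm \<xi> + (\<Sum>b\<in>A. \<bar>\<alpha> b\<bar>))\<^sup>2)"
  using assms
proof (induction A arbitrary: \<xi> c rule: finite_induct)
  case empty
  then show ?case using cos_dual[of \<xi> c] by simp
next
  case (insert e A)
  let ?S = "\<Sum>b\<in>A. \<bar>\<alpha> b\<bar>" and ?P = "\<lambda>z. \<Prod>b\<in>A. cos (\<alpha> b * (z \<bullet> b) - \<phi> b)"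
  let ?g = "\<lambda>r. \<kappa> * (1 + r + 2 * \<rho> * r\<^sup>2)"
  have e: "e \<in> Basis" "A \<subseteq> Basis" using insert.prems by auto
  have mono: "?g r \<le> ?g r'" if "0 \<le> r" "r \<le> r'" for r r'
    using that kappa_nonneg rho by (intro mult_left_mono add_mono power_mono) auto
  have P1: "\<bar>?P z\<bar> \<le> 1" for z unfolding abs_prod by (intro prod_le_1) auto
  have int: "integrable \<mu> (\<lambda>z. h z * (cos (\<eta> \<bullet> z + d) * ?P z))" for \<eta> d
  proof (rule h_integrable[of _ 1])
    show "(\<lambda>z. cos (\<eta> \<bullet> z + d) * ?P z) \<in> borel_measurable borel"
      by (intro borel_measurable_continuous_onI continuous_intros)
    show "\<bar>cos (\<eta> \<bullet> z + d) * ?P z\<bar> \<le> 1" for z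
      using mult_mono[OF abs_cos_le_one[of "\<eta> \<bullet> z + d"] P1[of z]] by (simp add: abs_mult)
  qed
  have eq: "h z * (cos (\<xi> \<bullet> z + c) * (\<Prod>b\<in>insert e A. cos (\<alpha> b * (z \<bullet> b) - \<phi> b))) =
    (h z * (cos ((\<xi> - \<alpha> e *\<^sub>R e) \<bullet> z + (c + \<phi> e)) * ?P z) + h z * (cos ((\<xi> + \<alpha> e *\<^sub>R e) \<bullet> z + (c - \<phi> e)) * ?P z)) / 2" for z
  proof -
    have "cos (\<xi> \<bullet> z + c) * cos (\<alpha> e * (z \<bullet> e) - \<phi> e) =
      (cos ((\<xi> - \<alpha> e *\<^sub>R e) \<bullet> z + (c + \<phi> e)) + cos ((\<xi> + \<alpha> e *\<^sub>R e) \<bullet> z + (c - \<phi> e))) / 2"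
      unfolding cos_times_cos by (simp add: inner_diff_left inner_add_left inner_commute algebra_simps)
    then have "cos (\<xi> \<bullet> z + c) * (cos (\<alpha> e * (z \<bullet> e) - \<phi> e) * ?P z) =
      (cos ((\<xi> - \<alpha> e *\<^sub>R e) \<bullet> z + (c + \<phi> e)) + cos ((\<xi> + \<alpha> e *\<^sub>R e) \<bullet> z + (c - \<phi> e))) / 2 * ?P z"
      by (simp only: mult.assoc[symmetric])
    then show ?thesis using insert.hyps by (simp add: algebra_simps add_divide_distrib)
  qed
  have split: "(\<integral>z. h z * (cos (\<xi> \<bullet> z + c) * (\<Prod>b\<in>insert e A. cos (\<alpha> b * (z \<bullet> b) - \<phi> b))) \<partial>\<mu>) =
    ((\<integral>z. h z * (cos ((\<xi> - \<alpha> e *\<^sub>R e) \<bullet> z + (c + \<phi> e)) * ?P z) \<partial>\<mu>) + (\<integral>z. h z * (cos ((\<xi> + \<alpha> e *\<^sub>R e) \<bullet> z + (c - \<phi> e)) * ?P z) \<partial>\<mu>)) / 2"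
    unfolding eq integral_divide_zero Bochner_Integration.integral_add[OF int int] ..
  have n: "norm (\<xi> - \<alpha> e *\<^sub>R e) \<le> norm \<xi> + \<bar>\<alpha> e\<bar>" "norm (\<xi> + \<alpha> e *\<^sub>R e) \<le> norm \<xi> + \<bar>\<alpha> e\<bar>"
    using norm_triangle_ineq4[of \<xi> "\<alpha> e *\<^sub>R e"] norm_triangle_ineq[of \<xi> "\<alpha> e *\<^sub>R e"] e by simp_all
  have S: "?S \<ge> 0" by (intro sum_nonneg) auto
  have tot: "(\<Sum>b\<in>insert e A. \<bar>\<alpha> b\<bar>) = \<bar>\<alpha> e\<bar> + ?S" by (rule sum.insert[OF insert.hyps])
  have mean: "\<bar>(x + y) / 2\<bar> \<le> g" if "\<bar>x\<bar> \<le> g" "\<bar>y\<bar> \<le> g" for x y g :: real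
    using that by (auto simp: abs_le_iff)
  show ?case
    unfolding split tot
  proof (rule mean)
    show "\<bar>\<integral>z. h z * (cos ((\<xi> - \<alpha> e *\<^sub>R e) \<bullet> z + (c + \<phi> e)) * ?P z) \<partial>\<mu>\<bar> \<le> ?g (norm \<xi> + (\<bar>\<alpha> e\<bar> + ?S))"
      by (rule order_trans[OF insert.IH[OF e(2)] mono]) (use n S in auto)
    show "\<bar>\<integral>z. h z * (cos ((\<xi> + \<alpha> e *\<^sub>R e) \<bullet> z + (c - \<phi> e)) * ?P z) \<partial>\<mu>\<bar> \<le> ?g (norm \<xi> + (\<bar>\<alpha> e\<bar> + ?S))"
      by (rule order_trans[OF insert.IH[OF e(2)] mono]) (use n S in auto)
  qed
qed

end

text \<open>In D = DIM('a) = d + 1 variables the hypothesis on \<open>k\<close> reads 2k > d + 5,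
  that is 2k \<ge> D + 5 for integers. Then 2k - 4 \<ge> D + 1 makes the inverse weights
  summable.\<close>

locale slab_barron = slab_full +
  assumes k_dim: "DIM('a) + 5 \<le> 2 * k"
begin

section \<open>Weighted summability of the coefficients\<close>

definition om :: "('a \<Rightarrow> nat \<times> bool) \<Rightarrow> real" where "om \<iota> = 1 + (\<Sum>b\<in>Basis. real (fst (\<iota> b)))"

lemma om_ge: "om \<iota> \<ge> 1" "b \<in> Basis \<Longrightarrow> om \<iota> \<ge> 1 + real (fst (\<iota> b))"
  unfolding om_def using member_le_sum[of b Basis "\<lambda>b. real (fst (\<iota> b))"] by (auto intro!: sum_nonneg)

text \<open>\<open>om\<close> has D + 1 summands, D being the dimension; one of them is at least
  their mean. Powers of \<open>om\<close> are thus controlled by pure powers of single frequencies,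
  matching the pure derivatives available.\<close>

lemma om_le: "om \<iota> ^ (2 * k) \<le> (1 + real DIM('a)) ^ (2 * k) * (1 + (\<Sum>b\<in>Basis. real (fst (\<iota> b)) ^ (2 * k)))"
proof -
  let ?D = "1 + real DIM('a)"
  have S0: "0 \<le> (\<Sum>b\<in>Basis. real (fst (\<iota> b)) ^ (2 * k))" by (intro sum_nonneg) auto
  have pow: "om \<iota> ^ (2 * k) \<le> ?D ^ (2 * k) * x ^ (2 * k)" if "om \<iota> \<le> ?D * x" for x
    using power_mono[OF that, of "2 * k"] om_ge(1)[of \<iota>] by (simp add: power_mult_distrib)
  consider "om \<iota> \<le> ?D * 1" | b where "b \<in> Basis" "om \<iota> \<le> ?D * real (fst (\<iota> b))"
  proof -
    have "om \<iota> \<le> ?D * 1 \<or> (\<exists>b\<in>Basis. om \<iota> \<le> ?D * real (fst (\<iota> b)))"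
    proof (rule ccontr)
      assume "\<not> ?thesis"
      then have n: "om \<iota> > ?D" "\<And>b. b \<in> Basis \<Longrightarrow> ?D * real (fst (\<iota> b)) \<le> om \<iota>" by (auto simp: not_le intro: less_imp_le)
      have "?D * om \<iota> = ?D + (\<Sum>b\<in>Basis. ?D * real (fst (\<iota> b)))" by (simp add: om_def distrib_left sum_distrib_left)
      also have "\<dots> \<le> ?D + (\<Sum>b\<in>(Basis::'a set). om \<iota>)" using n by (intro add_left_mono sum_mono) auto
      also have "\<dots> < om \<iota> + (\<Sum>b\<in>(Basis::'a set). om \<iota>)" using n by simp
      also have "\<dots> = ?D * om \<iota>" by (simp add: algebra_simps)
      finally show False by simp
    qed
    then show ?thesis using that by blast
  qed
  then show ?thesis
  proof cases
    case 1
    then have "om \<iota> ^ (2 * k) \<le> ?D ^ (2 * k) * 1" using pow[of 1] by simp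
    also have "\<dots> \<le> ?D ^ (2 * k) * (1 + (\<Sum>b\<in>Basis. real (fst (\<iota> b)) ^ (2 * k)))"
      using S0 by (intro mult_left_mono) auto
    finally show ?thesis .
  next
    case 2
    have "real (fst (\<iota> b)) ^ (2 * k) \<le> (\<Sum>b\<in>Basis. real (fst (\<iota> b)) ^ (2 * k))"
      using 2(1) by (intro member_le_sum) auto
    then have "?D ^ (2 * k) * real (fst (\<iota> b)) ^ (2 * k) \<le> ?D ^ (2 * k) * (1 + (\<Sum>b\<in>Basis. real (fst (\<iota> b)) ^ (2 * k)))"
      by (intro mult_left_mono) auto
    then show ?thesis using pow[OF 2(2)] by linarith
  qed
qed

text \<open>With the exponent p = (D + 1) / D > 1 the product of the (1 + n_b)^p is at most
  \<open>om ^ (D + 1)\<close>. The sum over multi-indices then splits into D convergent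
  one-dimensional sums; the factor 2 counts cosine and sine.\<close>

lemma om_inverse_sum: "\<exists>C\<ge>0. \<forall>N. (\<Sum>\<iota>\<in>JN N. 1 / om \<iota> ^ (2 * k - 4)) \<le> C"
proof -
  define p where "p = (real DIM('a) + 1) / real DIM('a)"
  have D: "real DIM('a) > 0" by simp
  have p: "p > 1" using D by (simp add: p_def field_simps)
  have "summable (\<lambda>n. real n powr (- p))" using p by (simp add: summable_real_powr_iff)
  then have sm: "summable (\<lambda>n. (1 + real n) powr (- p))"
    using summable_Suc_iff[of "\<lambda>n. real n powr (- p)"] by (simp add: add.commute)
  define Z where "Z = (\<Sum>n. (1 + real n) powr (- p))"
  have Z: "(\<Sum>n\<le>N. (1 + real n) powr (- p)) \<le> Z" for N
    unfolding Z_def by (intro sum_le_suminf sm) auto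
  have Z0: "Z \<ge> 0" unfolding Z_def by (intro suminf_nonneg sm) auto
  have le: "1 / om \<iota> ^ (2 * k - 4) \<le> (\<Prod>b\<in>Basis. (1 + real (fst (\<iota> b))) powr (- p))" for \<iota>
  proof -
    have o: "om \<iota> \<ge> 1" by (rule om_ge)
    have "(\<Prod>b\<in>Basis. (1 + real (fst (\<iota> b))) powr p) \<le> (\<Prod>b\<in>(Basis::'a set). om \<iota> powr p)"
      using om_ge(2) p by (intro prod_mono conjI powr_mono2) auto
    also have "\<dots> = om \<iota> powr (p * real DIM('a))" using o by (simp add: powr_power mult.commute)
    also have "p * real DIM('a) = real (DIM('a) + 1)" using D by (simp add: p_def)
    also have "om \<iota> powr real (DIM('a) + 1) = om \<iota> ^ (DIM('a) + 1)" using o by (subst powr_realpow) auto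
    also have "\<dots> \<le> om \<iota> ^ (2 * k - 4)" using o k_dim by (intro power_increasing) auto
    finally have "(\<Prod>b\<in>Basis. (1 + real (fst (\<iota> b))) powr p) \<le> om \<iota> ^ (2 * k - 4)" .
    moreover have "(\<Prod>b\<in>Basis. (1 + real (fst (\<iota> b))) powr p) > 0" by (intro prod_pos) (auto simp: add_pos_nonneg)
    ultimately have "1 / om \<iota> ^ (2 * k - 4) \<le> 1 / (\<Prod>b\<in>Basis. (1 + real (fst (\<iota> b))) powr p)"
      by (intro divide_left_mono) (auto intro: mult_pos_pos)
    also have "\<dots> = (\<Prod>b\<in>Basis. (1 + real (fst (\<iota> b))) powr (- p))"
      by (simp add: powr_minus divide_inverse prod_inversef[symmetric] o_def)
    finally show ?thesis .
  qed
  show ?thesis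
  proof (intro exI[of _ "(2 * Z) ^ DIM('a)"] conjI allI)
    show "(2 * Z) ^ DIM('a) \<ge> 0" using Z0 by simp
    fix N
    have "(\<Sum>\<iota>\<in>JN N. 1 / om \<iota> ^ (2 * k - 4)) \<le> (\<Sum>\<iota>\<in>JN N. \<Prod>b\<in>Basis. (1 + real (fst (\<iota> b))) powr (- p))"
      by (intro sum_mono le)
    also have "\<dots> = (\<Prod>b\<in>(Basis::'a set). \<Sum>\<nu>\<in>{..N} \<times> (UNIV::bool set). (1 + real (fst \<nu>)) powr (- p))"
      unfolding JN_def by (rule prod_sum_PiE[symmetric]) auto
    also have "(\<Sum>\<nu>\<in>{..N} \<times> (UNIV::bool set). (1 + real (fst \<nu>)) powr (- p)) = 2 * (\<Sum>n\<le>N. (1 + real n) powr (- p))"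
    proof -
      have "(\<Sum>\<nu>\<in>{..N} \<times> (UNIV::bool set). (1 + real (fst \<nu>)) powr (- p)) = (\<Sum>n\<le>N. \<Sum>s\<in>(UNIV::bool set). (1 + real n) powr (- p))"
        by (simp only: sum.cartesian_product case_prod_unfold)
      then show ?thesis by (simp add: sum_distrib_left)
    qed
    also have "(\<Prod>b\<in>(Basis::'a set). 2 * (\<Sum>n\<le>N. (1 + real n) powr (- p))) \<le> (2 * Z) ^ DIM('a)"
      unfolding prod_constant using Z[of N] by (intro power_mono) (auto intro!: sum_nonneg)
    finally show "(\<Sum>\<iota>\<in>JN N. 1 / om \<iota> ^ (2 * k - 4)) \<le> (2 * Z) ^ DIM('a)" .
  qed
qed

lemma om_coef_sum: "\<exists>C\<ge>0. \<forall>N. (\<Sum>\<iota>\<in>JN N. (om \<iota>)\<^sup>2 * \<bar>coef \<iota>\<bar>) \<le> C"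
proof -
  obtain C1 where C1: "C1 \<ge> 0" "\<And>N. (\<Sum>\<iota>\<in>JN N. 1 / om \<iota> ^ (2 * k - 4)) \<le> C1"
    using om_inverse_sum by blast
  obtain C0 where C0: "C0 \<ge> 0" "\<And>J. finite J \<Longrightarrow> J \<subseteq> (\<Pi>\<^sub>E b\<in>Basis. UNIV) \<Longrightarrow> (\<Sum>\<iota>\<in>J. (coef \<iota>)\<^sup>2) \<le> C0"
    using coef_decay(1) by (rule sq_boundedE) blast
  from coef_decay(2) have "\<forall>b\<in>Basis. \<exists>C\<ge>0. \<forall>N. (\<Sum>\<iota>\<in>JN N. ((lam * real (fst (\<iota> b))) ^ k * coef \<iota>)\<^sup>2) \<le> C"
    unfolding sq_bounded_def using JN by (meson order_refl)
  from bchoice[OF this] obtain C where C: "\<forall>b\<in>Basis. C b \<ge> 0 \<and> (\<forall>N. (\<Sum>\<iota>\<in>JN N. ((lam * real (fst (\<iota> b))) ^ k * coef \<iota>)\<^sup>2) \<le> C b)" ..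
  \<comment> \<open>\<open>om_le\<close> reduces the weight to the single directions, and dividing
    by \<open>lam ^ (2 * k)\<close> removes the frequency unit contained in
    \<open>coef_decay\<close>.\<close>
  define C3 where "C3 = (1 + real DIM('a)) ^ (2 * k) * (C0 + (\<Sum>b\<in>Basis. C b / lam ^ (2 * k)))"
  have "(\<Sum>\<iota>\<in>JN N. (om \<iota> ^ k * \<bar>coef \<iota>\<bar>)\<^sup>2) \<le> C3" for N
  proof -
    have "(\<Sum>\<iota>\<in>JN N. (om \<iota> ^ k * \<bar>coef \<iota>\<bar>)\<^sup>2) = (\<Sum>\<iota>\<in>JN N. om \<iota> ^ (2 * k) * (coef \<iota>)\<^sup>2)"
      by (simp add: power_mult_distrib power_mult[symmetric] mult.commute)
    also have "\<dots> \<le> (\<Sum>\<iota>\<in>JN N. ((1 + real DIM('a)) ^ (2 * k) * (1 + (\<Sum>b\<in>Basis. real (fst (\<iota> b)) ^ (2 * k)))) * (coef \<iota>)\<^sup>2)"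
      by (intro sum_mono mult_right_mono om_le) auto
    also have "\<dots> = (1 + real DIM('a)) ^ (2 * k) * ((\<Sum>\<iota>\<in>JN N. (coef \<iota>)\<^sup>2) +
        (\<Sum>b\<in>Basis. (\<Sum>\<iota>\<in>JN N. ((lam * real (fst (\<iota> b))) ^ k * coef \<iota>)\<^sup>2) / lam ^ (2 * k)))"
    proof -
      have e: "((lam * real (fst (\<iota> b))) ^ k * coef \<iota>)\<^sup>2 / lam ^ (2 * k) = real (fst (\<iota> b)) ^ (2 * k) * (coef \<iota>)\<^sup>2" for b \<iota>
        unfolding power_even_eq using lam_pos by (simp add: power_mult_distrib)
      have "(\<Sum>b\<in>Basis. (\<Sum>\<iota>\<in>JN N. ((lam * real (fst (\<iota> b))) ^ k * coef \<iota>)\<^sup>2) / lam ^ (2 * k)) =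
        (\<Sum>\<iota>\<in>JN N. \<Sum>b\<in>Basis. real (fst (\<iota> b)) ^ (2 * k) * (coef \<iota>)\<^sup>2)"
        unfolding sum_divide_distrib e by (rule sum.swap)
      then show ?thesis by (simp add: sum_distrib_left sum_distrib_right distrib_left distrib_right sum.distrib mult_ac)
    qed
    also have "\<dots> \<le> C3"
      unfolding C3_def using C0(2)[OF JN] C lam_pos by (intro mult_left_mono add_mono sum_mono divide_right_mono) auto
    finally show ?thesis .
  qed
  note C3 = this
  have k2: "k \<ge> 2" using k_dim by auto
  have "(\<Sum>\<iota>\<in>JN N. (om \<iota>)\<^sup>2 * \<bar>coef \<iota>\<bar>) \<le> sqrt (C1 * C3)" for N
  proof -
    \<comment> \<open>The factorisation for Cauchy-Schwarz: an inverse power of order k - 2, square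
      summable by dimension, and the \<open>k\<close>-th power, square summable by
      smoothness.\<close>
    have t: "(om \<iota>)\<^sup>2 * \<bar>coef \<iota>\<bar> = 1 / om \<iota> ^ (k - 2) * (om \<iota> ^ k * \<bar>coef \<iota>\<bar>)" for \<iota>
    proof -
      have "om \<iota> ^ k = om \<iota> ^ (k - 2) * (om \<iota>)\<^sup>2"
        using k2 by (metis le_add_diff_inverse2 power_add)
      moreover have "om \<iota> > 0" using om_ge(1)[of \<iota>] by linarith
      ultimately show ?thesis by simp
    qed
    have s: "(1 / om \<iota> ^ (k - 2))\<^sup>2 = 1 / om \<iota> ^ (2 * k - 4)" for \<iota>
    proof -
      have "(k - 2) * 2 = 2 * k - 4" using k2 by simp
      then show ?thesis by (simp only: power_divide power_mult[symmetric] power_one)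
    qed
    have "(\<Sum>\<iota>\<in>JN N. (om \<iota>)\<^sup>2 * \<bar>coef \<iota>\<bar>)\<^sup>2 \<le> (\<Sum>\<iota>\<in>JN N. (1 / om \<iota> ^ (k - 2))\<^sup>2) * (\<Sum>\<iota>\<in>JN N. (om \<iota> ^ k * \<bar>coef \<iota>\<bar>)\<^sup>2)"
      unfolding t by (rule Cauchy_Schwarz_ineq_sum)
    also have "\<dots> \<le> C1 * C3"
      unfolding s using C1 C3 by (intro mult_mono) (auto intro!: sum_nonneg)
    finally show ?thesis by (rule real_le_rsqrt)
  qed
  moreover have "0 \<le> sqrt (C1 * C3)"
    using C1 C0 C lam_pos unfolding C3_def
    by (intro real_sqrt_ge_zero mult_nonneg_nonneg add_nonneg_nonneg sum_nonneg divide_nonneg_pos) auto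
  ultimately show ?thesis by blast
qed

lemma sig_weight: "\<exists>M\<ge>0. \<forall>N. (\<Sum>\<iota>\<in>JN N. \<bar>(\<Prod>b\<in>Basis. wN N (fst (\<iota> b))) * coef \<iota>\<bar> * (om \<iota>)\<^sup>2) \<le> M"
proof -
  obtain C where C: "C \<ge> 0" "\<And>N. (\<Sum>\<iota>\<in>JN N. (om \<iota>)\<^sup>2 * \<bar>coef \<iota>\<bar>) \<le> C" using om_coef_sum by blast
  show ?thesis
  proof (intro exI[of _ "(1 / R) ^ DIM('a) * C"] conjI allI)
    show "(1 / R) ^ DIM('a) * C \<ge> 0" using C R_pos by simp
    fix N
    have wbound: "\<bar>\<Prod>b\<in>Basis. wN N (fst (\<iota> b))\<bar> \<le> (1 / R) ^ DIM('a)" if "\<iota> \<in> JN N" for \<iota>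
      unfolding abs_prod prod_constant[symmetric]
    proof (intro prod_mono conjI abs_ge_zero wN(2))
      show "fst (\<iota> b) \<le> N" if "b \<in> Basis" for b
        using PiE_mem[OF \<open>\<iota> \<in> JN N\<close>[unfolded JN_def] that] by auto
    qed
    have "(\<Sum>\<iota>\<in>JN N. \<bar>(\<Prod>b\<in>Basis. wN N (fst (\<iota> b))) * coef \<iota>\<bar> * (om \<iota>)\<^sup>2) \<le>
        (\<Sum>\<iota>\<in>JN N. (1 / R) ^ DIM('a) * ((om \<iota>)\<^sup>2 * \<bar>coef \<iota>\<bar>))"
    proof (intro sum_mono)
      fix \<iota> assume "\<iota> \<in> JN N"
      from mult_right_mono[OF this[THEN wbound], of "\<bar>coef \<iota>\<bar> * (om \<iota>)\<^sup>2"]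
      show "\<bar>(\<Prod>b\<in>Basis. wN N (fst (\<iota> b))) * coef \<iota>\<bar> * (om \<iota>)\<^sup>2 \<le> (1 / R) ^ DIM('a) * ((om \<iota>)\<^sup>2 * \<bar>coef \<iota>\<bar>)"
        by (simp add: abs_mult mult_ac)
    qed
    also have "\<dots> \<le> (1 / R) ^ DIM('a) * C"
      unfolding sum_distrib_left[symmetric] using C R_pos by (intro mult_left_mono) auto
    finally show "(\<Sum>\<iota>\<in>JN N. \<bar>(\<Prod>b\<in>Basis. wN N (fst (\<iota> b))) * coef \<iota>\<bar> * (om \<iota>)\<^sup>2) \<le> (1 / R) ^ DIM('a) * C" .
  qed
qed

text \<open>The duality estimate is linear, so it passes from cosines to every \<open>sig N\<close>
  with a constant independent of \<open>N\<close>. The same weighted sum bounds \<open>sig N\<close>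
  uniformly, and dominated convergence transfers the estimate to the limit.\<close>

lemma end_dual_bound:
  assumes rho: "\<rho> \<ge> 0" "\<rho> \<le> R / 2"
  shows "\<exists>M\<ge>0. ridge_dual (slab_ball \<tau> T \<rho>) \<rho> (\<lambda>z. F z * tens X z) M"
proof -
  obtain M where M: "M \<ge> 0" "\<And>N. (\<Sum>\<iota>\<in>JN N. \<bar>(\<Prod>b\<in>Basis. wN N (fst (\<iota> b))) * coef \<iota>\<bar> * (om \<iota>)\<^sup>2) \<le> M"
    using sig_weight by blast
  \<comment> \<open>The frequencies of one product of cosines add up to
    \<open>lam * (om \<iota> - 1)\<close>. As \<open>om \<iota> \<ge> 1\<close>, the quadratic bound
    of \<open>cos_product_dual\<close> is at most this constant times the square of
    \<open>om \<iota>\<close>.\<close>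
  define Cg where "Cg = 1 + lam + 2 * \<rho> * lam\<^sup>2"
  have Cg: "Cg \<ge> 0" using rho lam_pos by (simp add: Cg_def)
  show ?thesis
    unfolding ridge_dual_def
  proof (intro exI[of _ "Cg * M"] conjI allI impI)
    show "Cg * M \<ge> 0" using Cg M by simp
    fix \<mu> h B \<kappa>
    assume fin: "finite_measure \<mu>" and sets_mu: "sets \<mu> = sets borel" and hm: "h \<in> borel_measurable borel" and hB: "\<forall>z. \<bar>h z\<bar> \<le> B"
      and h_ball: "\<forall>z. h z \<noteq> 0 \<longrightarrow> z \<in> slab_ball \<tau> T \<rho>" and at: "ridge_le \<mu> \<rho> h \<kappa>"
    have hs: "norm z \<le> \<rho> \<and> 0 < z \<bullet> \<tau> \<and> z \<bullet> \<tau> < T \<and> (\<forall>b\<in>Basis. \<bar>z \<bullet> b\<bar> \<le> R / 2)" if "h z \<noteq> 0" for z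
    proof -
      have z: "norm z \<le> \<rho> \<and> 0 < z \<bullet> \<tau> \<and> z \<bullet> \<tau> < T" using h_ball that by (simp add: slab_ball_def)
      moreover have "\<bar>z \<bullet> b\<bar> \<le> R / 2" if "b \<in> Basis" for b
        using Basis_le_norm[OF that, of z] z rho(2) by linarith
      ultimately show ?thesis by blast
    qed
    have hs': "\<forall>z. h z \<noteq> 0 \<longrightarrow> norm z \<le> \<rho>" using hs by blast
    have hB': "\<And>z. \<bar>h z\<bar> \<le> B" using hB by blast
    note base = fin sets_mu hm hB' hs' rho(1) at
    have k0: "\<kappa> \<ge> 0" by (rule kappa_nonneg[OF base])
    define C where "C = (\<lambda>\<iota> (z::'a). \<Prod>b\<in>Basis. cos (lam * real (fst (\<iota> b)) * (z \<bullet> b) - ph (snd (\<iota> b))) :: real)"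
    have C1: "\<bar>C \<iota> z\<bar> \<le> 1" for \<iota> z unfolding C_def abs_prod by (intro prod_le_1) auto
    have Cm: "C \<iota> \<in> borel_measurable borel" for \<iota>
      unfolding C_def by (intro borel_measurable_continuous_onI continuous_intros)
    have hC: "integrable \<mu> (\<lambda>z. h z * C \<iota> z)" for \<iota> by (rule h_integrable[OF base Cm, of _ 1]) (rule C1)
    have Cd: "\<bar>\<integral>z. h z * C \<iota> z \<partial>\<mu>\<bar> \<le> \<kappa> * (Cg * (om \<iota>)\<^sup>2)" for \<iota>
    proof -
      let ?s = "\<Sum>b\<in>Basis. \<bar>lam * real (fst (\<iota> b))\<bar>"
      have "\<bar>\<integral>z. h z * C \<iota> z \<partial>\<mu>\<bar> \<le> \<kappa> * (1 + ?s + 2 * \<rho> * ?s\<^sup>2)"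
        using cos_product_dual[OF base finite_Basis subset_refl, of 0 0 "\<lambda>b. lam * real (fst (\<iota> b))" "\<lambda>b. ph (snd (\<iota> b))"]
        by (simp add: C_def)
      also have "\<dots> \<le> \<kappa> * (Cg * (om \<iota>)\<^sup>2)"
      proof (rule mult_left_mono[OF _ k0])
        have s: "?s = lam * (om \<iota> - 1)" using lam_pos by (simp add: om_def sum_distrib_left abs_mult)
        have o: "om \<iota> \<ge> 1" by (rule om_ge)
        have o2: "om \<iota> \<le> (om \<iota>)\<^sup>2" "1 \<le> (om \<iota>)\<^sup>2" using o by (auto simp: power2_eq_square intro: mult_left_mono[of 1 "om \<iota>" "om \<iota>", simplified] order_trans[OF o])
        have a1: "?s \<le> lam * (om \<iota>)\<^sup>2" unfolding s using lam_pos o2 by (intro mult_left_mono) auto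
        have "?s\<^sup>2 \<le> (lam * om \<iota>)\<^sup>2" unfolding s using lam_pos o by (intro power_mono mult_left_mono mult_nonneg_nonneg) auto
        then have "2 * \<rho> * ?s\<^sup>2 \<le> 2 * \<rho> * (lam\<^sup>2 * (om \<iota>)\<^sup>2)" using rho by (intro mult_left_mono) (auto simp: power_mult_distrib)
        then show "1 + ?s + 2 * \<rho> * ?s\<^sup>2 \<le> Cg * (om \<iota>)\<^sup>2"
          using a1 o2 by (simp add: Cg_def algebra_simps)
      qed
      finally show ?thesis .
    qed
    have sigC: "sig N z = (\<Sum>\<iota>\<in>JN N. ((\<Prod>b\<in>Basis. wN N (fst (\<iota> b))) * coef \<iota>) * C \<iota> z)" for N z
      by (simp add: sig_def C_def)
    have sb: "\<bar>\<integral>z. h z * sig N z \<partial>\<mu>\<bar> \<le> Cg * M * \<kappa>" for N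
    proof -
      have "(\<integral>z. h z * sig N z \<partial>\<mu>) = (\<integral>z. (\<Sum>\<iota>\<in>JN N. ((\<Prod>b\<in>Basis. wN N (fst (\<iota> b))) * coef \<iota>) * (h z * C \<iota> z)) \<partial>\<mu>)"
        unfolding sigC by (simp add: sum_distrib_left mult_ac)
      also have "\<dots> = (\<Sum>\<iota>\<in>JN N. ((\<Prod>b\<in>Basis. wN N (fst (\<iota> b))) * coef \<iota>) * (\<integral>z. h z * C \<iota> z \<partial>\<mu>))"
        by (simp only: Bochner_Integration.integral_sum[OF integrable_mult_right[OF hC]] integral_mult_right_zero)
      finally have "\<bar>\<integral>z. h z * sig N z \<partial>\<mu>\<bar> = \<bar>\<Sum>\<iota>\<in>JN N. ((\<Prod>b\<in>Basis. wN N (fst (\<iota> b))) * coef \<iota>) * (\<integral>z. h z * C \<iota> z \<partial>\<mu>)\<bar>"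
        by (rule arg_cong)
      also have "\<dots> \<le> (\<Sum>\<iota>\<in>JN N. \<bar>((\<Prod>b\<in>Basis. wN N (fst (\<iota> b))) * coef \<iota>)\<bar> * (\<kappa> * (Cg * (om \<iota>)\<^sup>2)))"
        by (rule order_trans[OF sum_abs]) (unfold abs_mult[of _ "integral\<^sup>L \<mu> _"], intro sum_mono mult_left_mono Cd abs_ge_zero)
      also have "\<dots> = (\<kappa> * Cg) * (\<Sum>\<iota>\<in>JN N. \<bar>(\<Prod>b\<in>Basis. wN N (fst (\<iota> b))) * coef \<iota>\<bar> * (om \<iota>)\<^sup>2)"
        unfolding sum_distrib_left by (intro sum.cong refl) (simp only: mult_ac)
      also have "\<dots> \<le> (\<kappa> * Cg) * M" using M k0 Cg by (intro mult_left_mono) auto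
      finally show ?thesis by (simp add: mult_ac)
    qed
    have sM: "\<bar>sig N z\<bar> \<le> M" for N z
    proof -
      have "\<bar>sig N z\<bar> \<le> (\<Sum>\<iota>\<in>JN N. \<bar>((\<Prod>b\<in>Basis. wN N (fst (\<iota> b))) * coef \<iota>)\<bar> * \<bar>C \<iota> z\<bar>)"
        unfolding sigC by (rule order_trans[OF sum_abs]) (simp add: abs_mult)
      also have "\<dots> \<le> (\<Sum>\<iota>\<in>JN N. \<bar>((\<Prod>b\<in>Basis. wN N (fst (\<iota> b))) * coef \<iota>)\<bar> * (om \<iota>)\<^sup>2)"
        by (intro sum_mono mult_left_mono order_trans[OF C1]) (auto simp: one_le_power om_ge)
      finally show ?thesis using M(2)[of N] by linarith
    qed
    have "(\<lambda>N. \<integral>z. h z * sig N z \<partial>\<mu>) \<longlonglongrightarrow> (\<integral>z. h z * (F z * tens X z) \<partial>\<mu>)"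
    proof (rule integral_dominated_convergence[where w = "\<lambda>z. B * M"])
      have sm: "sig N \<in> borel_measurable borel" for N
        unfolding sigC[abs_def] using Cm by (intro borel_measurable_sum borel_measurable_times) auto
      show "(\<lambda>z. h z * sig N z) \<in> borel_measurable \<mu>" for N
        by (rule meas_mu[OF base]) (intro borel_measurable_times hm sm)
      show "(\<lambda>z. h z * (F z * tens X z)) \<in> borel_measurable \<mu>"
        by (rule meas_mu[OF base]) (intro borel_measurable_times hm F_meas tens_measurable[OF X])
      show "integrable \<mu> (\<lambda>z. B * M)" using fin by (simp add: finite_measure.integrable_const)
      show "AE z in \<mu>. (\<lambda>N. h z * sig N z) \<longlonglongrightarrow> h z * (F z * tens X z)"
      proof (rule AE_I2)
        fix z show "(\<lambda>N. h z * sig N z) \<longlonglongrightarrow> h z * (F z * tens X z)"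
          using hs sig_limit[of z] by (cases "h z = 0") (auto intro!: tendsto_mult)
      qed
      show "AE z in \<mu>. norm (h z * sig N z) \<le> B * M" for N
        using hB' sM by (intro AE_I2) (auto simp: abs_mult intro!: mult_mono order_trans[OF abs_ge_zero hB'])
    qed
    then have "(\<lambda>N. \<bar>\<integral>z. h z * sig N z \<partial>\<mu>\<bar>) \<longlonglongrightarrow> \<bar>\<integral>z. h z * (F z * tens X z) \<partial>\<mu>\<bar>"
      by (rule tendsto_rabs)
    then show "\<bar>\<integral>z. h z * (F z * tens X z) \<partial>\<mu>\<bar> \<le> Cg * M * \<kappa>"
      by (rule LIMSEQ_le_const2) (use sb in blast)
  qed
qed

end

text \<open>A partition of unity in time writes \<open>F\<close> as a part away from the end
  \<open>T\<close> and a part away from the end 0; each is handled by the reflection at its own end,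
  and the constants add up.\<close>

lemma (in slab_sobolev) barron_dual:
  fixes F :: "'a \<Rightarrow> real"
  assumes k_dim: "DIM('a) + 5 \<le> 2 * k" and G0: "\<forall>b\<in>Basis. G b 0 = F"
    and F_cont: "\<forall>z. 0 < z \<bullet> \<tau> \<and> z \<bullet> \<tau> < T \<longrightarrow> isCont F z"
    and F_bdd: "\<And>c d. \<exists>B. \<forall>z\<in>cbox c d. \<bar>F z\<bar> \<le> B"
    and rho: "\<rho> \<ge> 0"
  shows "\<exists>M\<ge>0. ridge_dual (slab_ball \<tau> T \<rho>) \<rho> F M"
proof -
  obtain s where s: "smooth1 s" "\<forall>x\<le>0. s x = 0" "\<forall>x\<ge>1. s x = 1" "\<forall>x. 0 \<le> s x \<and> s x \<le> 1"
    using smooth_step_exists by blast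
  define \<eta> where "\<eta> = (\<lambda>x. s (1 * x + (\<rho> + 1)) * s ((-1) * x + (\<rho> + 1)))"
  \<comment> \<open>\<theta>0 is 1 on [0, T/3] and falls to 0 on [T/3, 2T/3]; \<theta>T complements
    it on the slab. Beyond the ends both are continued over a length 1 to remain smooth, which costs
    nothing because \<open>F\<close> vanishes there.\<close>
  define \<theta>0 where "\<theta>0 = (\<lambda>t. s (1 * t + 1) * (1 - s (3 / T * t + (-1))))"
  define \<theta>T where "\<theta>T = (\<lambda>t. s (3 / T * t + (-1)) * s ((-1) * t + (T + 1)))"
  \<comment> \<open>The three summands cover the spatial box, the time box reaching
    \<open>T + 1\<close>, and the reflected times.\<close>
  define R where "R = 2 * (\<rho> + 1) + 2 * (T + 1) + (2 * real k + 2) * T"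
  define bx where "bx = (\<lambda>m M. \<Sum>b\<in>(Basis::'a set). (if b = \<tau> then m else M) *\<^sub>R b)"
  have bx: "bx m M \<bullet> b = (if b = \<tau> then m else M)" if "b \<in> Basis" for b m M
    unfolding bx_def using that by (simp add: inner_sum_left_Basis)
  have kT: "(2 * real k + 2) * T \<ge> 0" using T_pos by simp
  have R_half: "\<rho> + 1 \<le> R / 2" and R_T: "T + 1 \<le> R / 2"
    unfolding R_def using rho T_pos kT by argo+
  have R: "R > 0" "\<rho> + 1 \<le> R / 2" "T + 1 \<le> R / 2" "(2 * real k + 2) * T \<le> R"
  proof -
    show "R > 0" using R_half rho by linarith
    show "(2 * real k + 2) * T \<le> R" unfolding R_def using rho T_pos by argo
  qed (fact R_half R_T)+
  have sm: "smooth1 \<eta>" "smooth1 \<theta>0" "smooth1 \<theta>T"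
    unfolding \<eta>_def \<theta>0_def \<theta>T_def using s(1)
    by (intro smooth1_mult smooth1_affine smooth1_diff_const[OF smooth1_affine]; simp)+
  have \<eta>0: "\<eta> x = 0" if "x < - (\<rho> + 1) \<or> x > \<rho> + 1" for x using that s(2) by (auto simp: \<eta>_def)
  have \<eta>1: "\<eta> x = 1" if "\<bar>x\<bar> \<le> \<rho>" for x using that s(3) by (auto simp: \<eta>_def)
  have third: "3 / T * t + (-1) \<le> 0 \<longleftrightarrow> t \<le> T / 3" "3 / T * t + (-1) \<ge> 1 \<longleftrightarrow> t \<ge> 2 * T / 3" for t
    using T_pos by (auto simp: field_simps)
  have \<theta>00: "\<theta>0 t = 0" if "t < -1 \<or> t > 2 * T / 3" for t
  proof (cases "t < -1")
    case True
    then show ?thesis using s(2) by (simp add: \<theta>0_def)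
  next
    case False
    then have "s (3 / T * t + (-1)) = 1" using s(3) third(2)[of t] that by auto
    then show ?thesis by (simp add: \<theta>0_def)
  qed
  have \<theta>T0: "\<theta>T t = 0" if "t < T / 3 \<or> t > T + 1" for t
  proof (cases "t < T / 3")
    case True
    then have "s (3 / T * t + (-1)) = 0" using s(2) third(1)[of t] by auto
    then show ?thesis by (simp add: \<theta>T_def)
  next
    case False
    then show ?thesis using s(2) that by (simp add: \<theta>T_def)
  qed
  have \<theta>1: "\<theta>0 t + \<theta>T t = 1" if "0 < t" "t < T" for t
  proof -
    have "s (1 * t + 1) = 1" "s ((-1) * t + (T + 1)) = 1" using that s(3) by auto
    then show ?thesis by (simp add: \<theta>0_def \<theta>T_def)
  qed
  define X0 where "X0 = (\<lambda>b. if b = \<tau> then \<theta>0 else \<eta>)"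
  define XT where "XT = (\<lambda>b. if b = \<tau> then \<theta>T else \<eta>)"
  have box0: "smooth_box X0 (bx (-1) (- (\<rho> + 1))) (bx (2 * T / 3) (\<rho> + 1))"
    unfolding smooth_box_def X0_def using sm \<eta>0 \<theta>00 by (auto simp: bx)
  have boxT: "smooth_box XT (bx (T / 3) (- (\<rho> + 1))) (bx (T + 1) (\<rho> + 1))"
    unfolding smooth_box_def XT_def using sm \<eta>0 \<theta>T0 by (auto simp: bx)
  interpret E0: slab_barron \<tau> T k G 0 R X0 "bx (-1) (- (\<rho> + 1))" "bx (2 * T / 3) (\<rho> + 1)" F
    by unfold_locales (use tau T_pos box0 R rho G0 F_cont F_bdd k_dim in \<open>auto simp: bx\<close>)
  interpret ET: slab_barron \<tau> T k G T R XT "bx (T / 3) (- (\<rho> + 1))" "bx (T + 1) (\<rho> + 1)" F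
    by unfold_locales (use tau T_pos boxT R rho G0 F_cont F_bdd k_dim in \<open>auto simp: bx\<close>)
  have \<rho>R: "\<rho> \<le> R / 2" using R(2) by simp
  obtain M0 where M0: "M0 \<ge> 0" "ridge_dual (slab_ball \<tau> T \<rho>) \<rho> (\<lambda>z. F z * tens X0 z) M0"
    using E0.end_dual_bound[OF rho \<rho>R] by blast
  obtain MT where MT: "MT \<ge> 0" "ridge_dual (slab_ball \<tau> T \<rho>) \<rho> (\<lambda>z. F z * tens XT z) MT"
    using ET.end_dual_bound[OF rho \<rho>R] by blast
  show ?thesis
    unfolding ridge_dual_def
  proof (intro exI[of _ "M0 + MT"] conjI allI impI)
    show "M0 + MT \<ge> 0" using M0 MT by simp
    fix \<mu> h B \<kappa>
    assume fin: "finite_measure \<mu>" and sets_mu: "sets \<mu> = sets borel" and hm: "h \<in> borel_measurable borel" and hB: "\<forall>z. \<bar>h z\<bar> \<le> B"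
      and h_ball: "\<forall>z. h z \<noteq> 0 \<longrightarrow> z \<in> slab_ball \<tau> T \<rho>" and at: "ridge_le \<mu> \<rho> h \<kappa>"
    have hs: "\<forall>z. h z \<noteq> 0 \<longrightarrow> norm z \<le> \<rho> \<and> 0 < z \<bullet> \<tau> \<and> z \<bullet> \<tau> < T" using h_ball by (simp add: slab_ball_def)
    have hB': "\<bar>h z\<bar> \<le> B" for z using hB by blast
    have hs0: "\<forall>z. h z \<noteq> 0 \<longrightarrow> norm z \<le> \<rho>" using hs by blast
    note base = fin sets_mu hm hB' hs0 rho at
    have zb: "\<bar>z \<bullet> b\<bar> \<le> \<rho>" if "norm z \<le> \<rho>" "b \<in> Basis" for z b
      using Basis_le_norm[OF that(2), of z] that(1) by linarith
    have b0: "\<bar>\<integral>z. h z * (F z * tens X0 z) \<partial>\<mu>\<bar> \<le> M0 * \<kappa>"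
      using M0(2) fin sets_mu hm hB h_ball at unfolding ridge_dual_def by blast
    have bT: "\<bar>\<integral>z. h z * (F z * tens XT z) \<partial>\<mu>\<bar> \<le> MT * \<kappa>"
      using MT(2) fin sets_mu hm hB h_ball at unfolding ridge_dual_def by blast
    obtain BF where BF: "\<forall>z\<in>cbox (bx (-\<rho>) (-\<rho>)) (bx \<rho> \<rho>). \<bar>F z\<bar> \<le> BF" using F_bdd by blast
    have BF': "\<bar>F z\<bar> \<le> BF" if "norm z \<le> \<rho>" for z
    proof -
      have "z \<in> cbox (bx (-\<rho>) (-\<rho>)) (bx \<rho> \<rho>)"
        unfolding mem_box using zb[OF that] by (auto simp: bx abs_le_iff minus_le_iff)
      with BF show ?thesis by blast
    qed
    have int: "integrable \<mu> (\<lambda>z. h z * (F z * tens X z))" if X: "smooth_box X lo hi" for X lo hi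
    proof -
      obtain BX where BX: "BX \<ge> 0" "\<And>z. \<bar>tens X z\<bar> \<le> BX" using tens_bounded[OF X] by blast
      show ?thesis
      proof (rule h_integrable[OF base, of _ "BF * BX"])
        show "(\<lambda>z. F z * tens X z) \<in> borel_measurable borel"
          using E0.F_meas tens_measurable[OF X] by (rule borel_measurable_times)
        show "\<bar>F z * tens X z\<bar> \<le> BF * BX" if "norm z \<le> \<rho>" for z
          unfolding abs_mult using BX BF'[OF that] by (intro mult_mono) auto
      qed
    qed
    have "h z * F z = h z * (F z * tens X0 z) + h z * (F z * tens XT z)" for z
    proof (cases "h z = 0")
      case False
      then have z: "norm z \<le> \<rho>" "0 < z \<bullet> \<tau>" "z \<bullet> \<tau> < T" using hs by auto
      have "(\<Prod>b\<in>Basis - {\<tau>}. \<eta> (z \<bullet> b)) = 1" using zb[OF z(1)] \<eta>1 by (intro prod.neutral) auto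
      moreover have "(\<Prod>b\<in>Basis - {\<tau>}. X0 b (z \<bullet> b)) = (\<Prod>b\<in>Basis - {\<tau>}. \<eta> (z \<bullet> b))"
        "(\<Prod>b\<in>Basis - {\<tau>}. XT b (z \<bullet> b)) = (\<Prod>b\<in>Basis - {\<tau>}. \<eta> (z \<bullet> b))"
        by (auto simp: X0_def XT_def intro!: prod.cong)
      ultimately have "tens X0 z = \<theta>0 (z \<bullet> \<tau>)" "tens XT z = \<theta>T (z \<bullet> \<tau>)"
        unfolding tens_def prod.remove[OF finite_Basis tau] by (auto simp: X0_def XT_def)
      then have "tens X0 z + tens XT z = 1" using \<theta>1[OF z(2,3)] by simp
      then have "h z * F z = h z * F z * (tens X0 z + tens XT z)" by simp
      then show ?thesis by (simp only: distrib_left mult.assoc)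
    qed simp
    then have "(\<integral>z. h z * F z \<partial>\<mu>) = (\<integral>z. h z * (F z * tens X0 z) \<partial>\<mu>) + (\<integral>z. h z * (F z * tens XT z) \<partial>\<mu>)"
      using Bochner_Integration.integral_add[OF int[OF box0] int[OF boxT]] by simp
    then show "\<bar>\<integral>z. h z * F z \<partial>\<mu>\<bar> \<le> (M0 + MT) * \<kappa>"
      using b0 bT by (simp add: distrib_right)
  qed
qed

section \<open>Approximation by ReLU networks with rate \<open>1 / sqrt P\<close>\<close>

definition relu_net :: "nat \<Rightarrow> (nat \<Rightarrow> 'a::euclidean_space) \<Rightarrow> (nat \<Rightarrow> real) \<Rightarrow> (nat \<Rightarrow> real) \<Rightarrow> 'a \<Rightarrow> real" where
  "relu_net P v c w z = (\<Sum>i<P. w i * max 0 (v i \<bullet> z + c i))"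

lemma relu_net_continuous: "continuous_on A (relu_net P v c w)"
  unfolding relu_net_def[abs_def] by (intro continuous_intros)

text \<open>A deterministic form of Maurey's argument: the duality bound always supplies a neuron that does
  not increase the correlation with the current error, so the squared error of the sum of \<open>l\<close>
  neurons against \<open>l F\<close> grows at most linearly in \<open>l\<close>.\<close>
lemma greedy_relu_approximation:
  fixes F :: "'a::euclidean_space \<Rightarrow> real" and \<mu> :: "'a measure" and \<Omega> :: "'a set"
  assumes fin: "finite_measure \<mu>" and sets_mu: "sets \<mu> = sets borel"
    and \<Omega>: "\<Omega> \<in> sets borel" "\<And>z. z \<in> \<Omega> \<Longrightarrow> norm z \<le> \<rho>" and AE_\<Omega>: "AE z in \<mu>. z \<in> \<Omega>"
    and F: "F \<in> borel_measurable borel" "\<And>z. z \<in> \<Omega> \<Longrightarrow> \<bar>F z\<bar> \<le> BF"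
    and rho: "\<rho> \<ge> 0" and BF: "BF \<ge> 0" and M: "M \<ge> 0"
    and dual: "ridge_dual \<Omega> \<rho> F M"
    and P: "P \<ge> 1"
  shows "\<exists>v c w. (\<forall>i<P. norm (v i) \<le> 1 \<and> \<bar>w i\<bar> \<le> (M + 1) / real P) \<and>
    (\<integral>z. (F z - relu_net P v c w z)\<^sup>2 \<partial>\<mu>) \<le>
      (2 + ((M + 1) * (2 * \<rho> + 1) + BF)\<^sup>2 * measure \<mu> (space \<mu>)) / real P"
proof -
  interpret finite_measure \<mu> by (rule fin)
  \<comment> \<open>The price of one neuron: twice a cross term of at most 1, plus the integral of
    the squared increment.\<close>
  define Q where "Q = 2 + ((M + 1) * (2 * \<rho> + 1) + BF)\<^sup>2 * measure \<mu> (space \<mu>)"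
  \<comment> \<open>The amplitude is \<open>M + 1\<close> because it has to be divided by later and
    \<open>M\<close> may be zero; the sign \<open>s\<close> makes the dictionary symmetric.\<close>
  define nr where "nr = (\<lambda>(v::'a) (c::real) (s::real) z. s * (M + 1) * max 0 (v \<bullet> z + c))"
  define E where "E = (\<lambda>v c s (l::nat) z. indicator \<Omega> z * ((\<Sum>i<l. nr (v i) (c i) (s i) z) - real l * F z))"
  define ok where "ok = (\<lambda>v c s. norm v \<le> (1::real) \<and> \<bar>c\<bar> \<le> \<rho> + 1 \<and> \<bar>s\<bar> = (1::real))"
  have mm: "g \<in> borel_measurable borel \<Longrightarrow> g \<in> borel_measurable \<mu>" for g :: "'a \<Rightarrow> real"
    using measurable_cong_sets[OF sets_mu refl] by blast
  have nr_m: "nr v c s \<in> borel_measurable borel" for v c s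
    unfolding nr_def by measurable
  have ind_m: "indicator \<Omega> \<in> borel_measurable borel" using \<Omega>(1) by measurable
  have nr_b: "\<bar>nr v c s z\<bar> \<le> (M + 1) * (2 * \<rho> + 1)" if ok: "norm v \<le> 1" "\<bar>c\<bar> \<le> \<rho> + 1" "\<bar>s\<bar> = 1" and z: "z \<in> \<Omega>" for v c s z
  proof -
    have "\<bar>v \<bullet> z\<bar> \<le> norm v * norm z" by (rule Cauchy_Schwarz_ineq2)
    also have "\<dots> \<le> 1 * \<rho>" using ok \<Omega>(2)[OF z] by (intro mult_mono) auto
    finally have "\<bar>max 0 (v \<bullet> z + c)\<bar> \<le> 2 * \<rho> + 1" using ok(2) rho by auto
    then show ?thesis using ok(3) M by (simp add: nr_def abs_mult mult_left_mono)
  qed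
  have bint: "integrable \<mu> g" if "g \<in> borel_measurable borel" "\<And>z. \<bar>g z\<bar> \<le> B" for g :: "'a \<Rightarrow> real" and B :: real
    using that by (intro integrable_const_bound[of _ B] mm) auto
  \<comment> \<open>Let J be the integral of \<open>h * F\<close>. If every neuron of either sign
    had correlation above J + 1, then \<open>ridge_le\<close> would hold with \<kappa> = (-J - 1) /
    (M + 1), and duality would give -J \<le> M \<kappa> = -J - 1 - \<kappa>, which is absurd. The
    slack 1 makes it unnecessary that an optimal neuron exists.\<close>
  have step: "\<exists>v c s. norm v \<le> 1 \<and> \<bar>c\<bar> \<le> \<rho> + 1 \<and> \<bar>s\<bar> = 1 \<and> (\<integral>z. h z * nr v c s z \<partial>\<mu>) \<le> (\<integral>z. h z * F z \<partial>\<mu>) + 1"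
    if hm: "h \<in> borel_measurable borel" and hB: "\<forall>z. \<bar>h z\<bar> \<le> B" and hs: "\<forall>z. h z \<noteq> 0 \<longrightarrow> z \<in> \<Omega>" for h B
  proof (rule ccontr)
    assume neg: "\<not> ?thesis"
    let ?J = "\<integral>z. h z * F z \<partial>\<mu>"
    have nr_eq: "(\<integral>z. h z * nr v c s z \<partial>\<mu>) = s * (M + 1) * (\<integral>z. h z * max 0 (v \<bullet> z + c) \<partial>\<mu>)" for v c s
      unfolding nr_def by (subst integral_mult_right_zero[symmetric]) (simp add: mult_ac)
    have gt: "s * (M + 1) * (\<integral>z. h z * max 0 (v \<bullet> z + c) \<partial>\<mu>) > ?J + 1" if "norm v \<le> 1" "\<bar>c\<bar> \<le> \<rho> + 1" "\<bar>s\<bar> = 1" for v c s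
      using neg that unfolding nr_eq[symmetric] by (meson not_le)
    define \<kappa> where "\<kappa> = (- ?J - 1) / (M + 1)"
    have le: "\<bar>\<integral>z. h z * max 0 (v \<bullet> z + c) \<partial>\<mu>\<bar> \<le> \<kappa>" if "norm v \<le> 1" "\<bar>c\<bar> \<le> \<rho> + 1" for v c
    proof -
      let ?A = "\<integral>z. h z * max 0 (v \<bullet> z + c) \<partial>\<mu>"
      have "(M + 1) * ?A > ?J + 1" using gt[OF that, of 1] by simp
      moreover have "(- 1) * (M + 1) * ?A = - ((M + 1) * ?A)" by (simp only: mult_minus1 mult_minus_left)
      then have "- ((M + 1) * ?A) > ?J + 1" using gt[OF that, of "-1"] by (metis abs_1 abs_minus)
      moreover have "(M + 1) * \<bar>?A\<bar> = \<bar>(M + 1) * ?A\<bar>" using M by (simp add: abs_mult)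
      ultimately have "(M + 1) * \<bar>?A\<bar> \<le> - ?J - 1" by linarith
      then show ?thesis using M by (simp add: \<kappa>_def pos_le_divide_eq mult.commute)
    qed
    have "\<bar>?J\<bar> \<le> M * \<kappa>" using dual fin sets_mu hm hB hs le unfolding ridge_dual_def ridge_le_def by blast
    moreover have "\<kappa> \<ge> 0" using le[of 0 0] rho by simp
    moreover have "(M + 1) * \<kappa> = - ?J - 1" using M by (simp add: \<kappa>_def)
    ultimately have "- ?J \<le> - ?J - 1 - \<kappa>" by (simp add: distrib_right)
    then show False using \<open>\<kappa> \<ge> 0\<close> by simp
  qed
  have E_m: "E v c s l \<in> borel_measurable borel" for v c s l
    unfolding E_def using nr_m ind_m F(1) by (intro borel_measurable_times borel_measurable_diff borel_measurable_sum) auto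
  have E_b: "\<bar>E v c s l z\<bar> \<le> real l * ((M + 1) * (2 * \<rho> + 1) + BF)"
    if ok: "\<And>i. i < l \<Longrightarrow> norm (v i) \<le> 1 \<and> \<bar>c i\<bar> \<le> \<rho> + 1 \<and> \<bar>s i\<bar> = 1" for v c s l z
  proof (cases "z \<in> \<Omega>")
    case True
    have "\<bar>\<Sum>i<l. nr (v i) (c i) (s i) z\<bar> \<le> (\<Sum>i<l. (M + 1) * (2 * \<rho> + 1))"
      by (rule order_trans[OF sum_abs sum_mono]) (use ok nr_b True in auto)
    moreover have "\<bar>real l * F z\<bar> \<le> real l * BF" using F(2)[OF True] by (simp add: abs_mult mult_left_mono)
    ultimately show ?thesis using True by (simp add: E_def distrib_left)
  next
    case False
    then show ?thesis using M rho BF by (simp add: E_def)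
  qed
  have E_rec: "\<exists>v c s. (\<forall>i<l. norm (v i) \<le> 1 \<and> \<bar>c i\<bar> \<le> \<rho> + 1 \<and> \<bar>s i\<bar> = 1) \<and> (\<integral>z. (E v c s l z)\<^sup>2 \<partial>\<mu>) \<le> real l * Q" for l
  proof (induction l)
    case 0
    then show ?case by (simp add: E_def)
  next
    case (Suc l)
    then obtain v c s where ok: "\<And>i. i < l \<Longrightarrow> norm (v i) \<le> 1 \<and> \<bar>c i\<bar> \<le> \<rho> + 1 \<and> \<bar>s i\<bar> = 1"
      and El: "(\<integral>z. (E v c s l z)\<^sup>2 \<partial>\<mu>) \<le> real l * Q" by blast
    let ?h = "E v c s l" and ?B = "real l * ((M + 1) * (2 * \<rho> + 1) + BF)"
    have hB: "\<forall>z. \<bar>?h z\<bar> \<le> ?B" using E_b[of l v c s, OF ok] by blast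
    have hs: "\<forall>z. ?h z \<noteq> 0 \<longrightarrow> z \<in> \<Omega>" by (auto simp: E_def indicator_def)
    obtain v' c' s' where n: "norm v' \<le> 1" "\<bar>c'\<bar> \<le> \<rho> + 1" "\<bar>s'\<bar> = 1"
      "(\<integral>z. ?h z * nr v' c' s' z \<partial>\<mu>) \<le> (\<integral>z. ?h z * F z \<partial>\<mu>) + 1"
      using step[OF E_m hB hs] by blast
    define d where "d = (\<lambda>z. indicator \<Omega> z * (nr v' c' s' z - F z))"
    have d_m: "d \<in> borel_measurable borel" unfolding d_def using nr_m ind_m F(1) by (intro borel_measurable_times borel_measurable_diff)
    have d_b: "\<bar>d z\<bar> \<le> (M + 1) * (2 * \<rho> + 1) + BF" for z
    proof (cases "z \<in> \<Omega>")
      case True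
      then show ?thesis using nr_b[OF n(1,2,3) True] F(2)[OF True] by (simp add: d_def)
    next
      case False
      then show ?thesis using M rho BF by (simp add: d_def)
    qed
    have eq: "E (v(l := v')) (c(l := c')) (s(l := s')) (Suc l) z = ?h z + d z" for z
    proof -
      have "(\<Sum>i<l. nr ((v(l := v')) i) ((c(l := c')) i) ((s(l := s')) i) z) = (\<Sum>i<l. nr (v i) (c i) (s i) z)"
        by (intro sum.cong) auto
      then show ?thesis by (simp add: E_def d_def algebra_simps)
    qed
    have sq_int: "integrable \<mu> (\<lambda>z. (?h z)\<^sup>2)" "integrable \<mu> (\<lambda>z. (d z)\<^sup>2)" "integrable \<mu> (\<lambda>z. ?h z * d z)"
    proof -
      have B0: "0 \<le> ?B" "0 \<le> (M + 1) * (2 * \<rho> + 1) + BF" using M rho BF by simp_all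
      show "integrable \<mu> (\<lambda>z. (?h z)\<^sup>2)"
        by (rule bint[of _ "?B\<^sup>2"]) (use E_m hB power_mono[OF _ abs_ge_zero, of _ ?B 2] in \<open>auto simp: power2_abs\<close>)
      show "integrable \<mu> (\<lambda>z. (d z)\<^sup>2)"
        by (rule bint[of _ "((M + 1) * (2 * \<rho> + 1) + BF)\<^sup>2"]) (use d_m d_b power_mono[OF d_b abs_ge_zero, of _ 2] in \<open>auto simp: power2_abs\<close>)
      show "integrable \<mu> (\<lambda>z. ?h z * d z)"
        by (rule bint[of _ "?B * ((M + 1) * (2 * \<rho> + 1) + BF)"])
           (use E_m d_m hB d_b B0 in \<open>auto simp: abs_mult intro!: mult_mono\<close>)
    qed
    have hat: "integrable \<mu> (\<lambda>z. ?h z * nr v' c' s' z)" "integrable \<mu> (\<lambda>z. ?h z * F z)"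
    proof -
      have "\<bar>?h z\<bar> * \<bar>nr v' c' s' z\<bar> \<le> ?B * ((M + 1) * (2 * \<rho> + 1)) \<and> \<bar>?h z\<bar> * \<bar>F z\<bar> \<le> ?B * BF" for z
      proof (cases "z \<in> \<Omega>")
        case True
        show ?thesis using hB nr_b[OF n(1,2,3) True] F(2)[OF True] M rho BF by (intro conjI mult_mono) auto
      next
        case False
        then show ?thesis using M rho BF by (simp add: E_def)
      qed
      then have b: "\<bar>?h z * nr v' c' s' z\<bar> \<le> ?B * ((M + 1) * (2 * \<rho> + 1))" "\<bar>?h z * F z\<bar> \<le> ?B * BF" for z
        by (simp_all only: abs_mult)
      show "integrable \<mu> (\<lambda>z. ?h z * nr v' c' s' z)" by (rule bint[OF _ b(1)]) (intro borel_measurable_times E_m nr_m)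
      show "integrable \<mu> (\<lambda>z. ?h z * F z)" by (rule bint[OF _ b(2)]) (intro borel_measurable_times E_m F(1))
    qed
    have hd: "(\<integral>z. ?h z * d z \<partial>\<mu>) \<le> 1"
    proof -
      have "?h z * d z = ?h z * nr v' c' s' z - ?h z * F z" for z
        using hs by (cases "?h z = 0") (auto simp: d_def right_diff_distrib)
      then have "(\<integral>z. ?h z * d z \<partial>\<mu>) = (\<integral>z. ?h z * nr v' c' s' z \<partial>\<mu>) - (\<integral>z. ?h z * F z \<partial>\<mu>)"
        using hat by simp
      then show ?thesis using n(4) by linarith
    qed
    have dd: "(\<integral>z. (d z)\<^sup>2 \<partial>\<mu>) \<le> ((M + 1) * (2 * \<rho> + 1) + BF)\<^sup>2 * measure \<mu> (space \<mu>)"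
    proof -
      have "(\<integral>z. (d z)\<^sup>2 \<partial>\<mu>) \<le> (\<integral>z. ((M + 1) * (2 * \<rho> + 1) + BF)\<^sup>2 \<partial>\<mu>)"
        using power_mono[OF d_b abs_ge_zero, of _ 2] sq_int(2) by (intro integral_mono) (auto simp: power2_abs)
      then show ?thesis by (simp add: mult.commute)
    qed
    have "(\<integral>z. (E (v(l := v')) (c(l := c')) (s(l := s')) (Suc l) z)\<^sup>2 \<partial>\<mu>) =
        (\<integral>z. (?h z)\<^sup>2 + 2 * (?h z * d z) + (d z)\<^sup>2 \<partial>\<mu>)"
      unfolding eq by (simp add: power2_sum mult_ac add_ac)
    also have "\<dots> = (\<integral>z. (?h z)\<^sup>2 \<partial>\<mu>) + 2 * (\<integral>z. ?h z * d z \<partial>\<mu>) + (\<integral>z. (d z)\<^sup>2 \<partial>\<mu>)"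
      using sq_int by simp
    also have "\<dots> \<le> real l * Q + 2 * 1 + (Q - 2)"
      using El hd dd unfolding Q_def by linarith
    finally have "(\<integral>z. (E (v(l := v')) (c(l := c')) (s(l := s')) (Suc l) z)\<^sup>2 \<partial>\<mu>) \<le> real (Suc l) * Q"
      by (simp add: algebra_simps)
    moreover have "\<forall>i<Suc l. norm ((v(l := v')) i) \<le> 1 \<and> \<bar>(c(l := c')) i\<bar> \<le> \<rho> + 1 \<and> \<bar>(s(l := s')) i\<bar> = 1"
      using ok n by (auto simp: less_Suc_eq)
    ultimately show ?case by blast
  qed
  obtain v c s where ok: "\<forall>i<P. norm (v i) \<le> 1 \<and> \<bar>c i\<bar> \<le> \<rho> + 1 \<and> \<bar>s i\<bar> = 1" and EP: "(\<integral>z. (E v c s P z)\<^sup>2 \<partial>\<mu>) \<le> real P * Q"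
    using E_rec by blast
  define w where "w = (\<lambda>i. s i * (M + 1) / real P)"
  have "(\<integral>z. (F z - relu_net P v c w z)\<^sup>2 \<partial>\<mu>) = (\<integral>z. (E v c s P z)\<^sup>2 / (real P)\<^sup>2 \<partial>\<mu>)"
  proof (rule integral_cong_AE)
    show "(\<lambda>z. (F z - relu_net P v c w z)\<^sup>2) \<in> borel_measurable \<mu>"
      using F(1) borel_measurable_continuous_onI[OF relu_net_continuous, of P v c w] by (intro mm) measurable
    show "(\<lambda>z. (E v c s P z)\<^sup>2 / (real P)\<^sup>2) \<in> borel_measurable \<mu>"
      by (rule mm) (use E_m[of v c s P] in measurable)
    show "AE z in \<mu>. (F z - relu_net P v c w z)\<^sup>2 = (E v c s P z)\<^sup>2 / (real P)\<^sup>2"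
      using AE_\<Omega>
    proof (rule AE_mp, intro AE_I2 impI)
      fix z assume z: "z \<in> \<Omega>"
      have "relu_net P v c w z = (\<Sum>i<P. nr (v i) (c i) (s i) z) / real P"
        by (simp add: relu_net_def w_def nr_def sum_divide_distrib)
      then have "F z - relu_net P v c w z = - (E v c s P z) / real P"
        using z P by (simp add: E_def field_simps)
      then show "(F z - relu_net P v c w z)\<^sup>2 = (E v c s P z)\<^sup>2 / (real P)\<^sup>2"
        by (simp add: power_divide)
    qed
  qed
  also have "\<dots> = (\<integral>z. (E v c s P z)\<^sup>2 \<partial>\<mu>) / (real P)\<^sup>2" by simp
  also have "\<dots> \<le> real P * Q / (real P)\<^sup>2" using EP by (intro divide_right_mono) auto
  also have "\<dots> = Q / real P" using P by (simp add: power2_eq_square)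
  finally have "(\<integral>z. (F z - relu_net P v c w z)\<^sup>2 \<partial>\<mu>) \<le> Q / real P" .
  moreover have "\<forall>i<P. norm (v i) \<le> 1 \<and> \<bar>w i\<bar> \<le> (M + 1) / real P"
    using ok M by (auto simp: w_def abs_mult)
  ultimately show ?thesis unfolding Q_def by blast
qed

section \<open>Stability of flows\<close>

lemma gronwall:
  fixes e :: "real \<Rightarrow> real"
  assumes e: "continuous_on {0..T} e" and L: "L \<ge> 0"
    and le: "\<And>t. t \<in> {0..T} \<Longrightarrow> e t \<le> D + L * integral {0..t} e" and t: "t \<in> {0..T}"
  shows "e t \<le> D * exp (L * t)"
proof -
  let ?E = "\<lambda>t. integral {0..t} e"
  let ?\<Phi> = "\<lambda>t. exp (- L * t) * (D + L * ?E t)"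
  have dE: "(?E has_real_derivative e x) (at x within {0..T})" if "x \<in> {0..T}" for x
    using integral_has_real_derivative[OF e that] .
  have "?\<Phi> t \<le> ?\<Phi> 0"
  proof (rule DERIV_nonpos_imp_decreasing_open[where f = ?\<Phi> and a = 0 and b = t])
    show "0 \<le> t" using t by simp
    have "continuous_on {0..T} ?E"
      by (intro indefinite_integral_continuous_1 integrable_continuous_interval e)
    then show "continuous_on {0..t} ?\<Phi>"
      using t by (intro continuous_intros) (auto elim: continuous_on_subset)
    fix x assume x: "0 < x" "x < t"
    then have "(?E has_real_derivative e x) (at x)"
      using dE[of x] t at_within_Icc_at[of 0 x T] by simp
    then have "(?\<Phi> has_real_derivative exp (- L * x) * (- L) * (D + L * ?E x) + L * e x * exp (- L * x)) (at x)"
      by (auto intro!: derivative_eq_intros)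
    moreover have "exp (- L * x) * (- L) * (D + L * ?E x) + L * e x * exp (- L * x) \<le> 0"
    proof -
      have "L * e x \<le> L * (D + L * ?E x)" using le[of x] x t L by (intro mult_left_mono) auto
      then have "exp (- L * x) * (L * e x) \<le> exp (- L * x) * (L * (D + L * ?E x))" by (rule mult_left_mono) simp
      then show ?thesis by (simp add: algebra_simps)
    qed
    ultimately show "\<exists>y. (?\<Phi> has_real_derivative y) (at x) \<and> y \<le> 0" by blast
  qed
  then have "exp (- L * t) * (D + L * ?E t) \<le> D" by simp
  then have "exp (L * t) * (exp (- L * t) * (D + L * ?E t)) \<le> exp (L * t) * D" by (intro mult_left_mono) auto
  then have "D + L * ?E t \<le> D * exp (L * t)" by (simp add: mult.assoc[symmetric] exp_add[symmetric] mult.commute)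
  then show ?thesis using le[OF t] by linarith
qed

text \<open>Applied twice: to the field \<open>f\<close>, and to a flow, whose Lipschitz dependence
  on the initial state comes from Gronwall.\<close>

lemma lipschitz_joint_continuous:
  fixes f :: "'a::real_normed_vector \<Rightarrow> real \<Rightarrow> 'b::real_normed_vector"
  assumes lip: "\<And>x y t. t \<in> {0..T} \<Longrightarrow> norm (f x t - f y t) \<le> L * norm (x - y)"
    and ct: "\<And>x. continuous_on {0..T} (f x)"
  shows "continuous_on (UNIV \<times> {0..T}) (\<lambda>z. f (fst z) (snd z))"
  unfolding continuous_on_def
proof
  fix z0 :: "'a \<times> real" assume z0: "z0 \<in> UNIV \<times> {0..T}"
  let ?S = "UNIV \<times> {0..T} :: ('a \<times> real) set"
  have "continuous_on ?S (\<lambda>z. f (fst z0) (snd z))"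
    by (rule continuous_on_compose2[OF ct]) (auto intro!: continuous_intros)
  then have 1: "((\<lambda>z. f (fst z0) (snd z)) \<longlongrightarrow> f (fst z0) (snd z0)) (at z0 within ?S)"
    using z0 by (auto simp: continuous_on_def)
  have "((\<lambda>z. L * norm (fst z - fst z0)) \<longlongrightarrow> L * norm (fst z0 - fst z0)) (at z0 within ?S)"
    by (intro tendsto_intros)
  then have 2: "((\<lambda>z. L * norm (fst z - fst z0)) \<longlongrightarrow> 0) (at z0 within ?S)" by simp
  have "((\<lambda>z. f (fst z) (snd z) - f (fst z0) (snd z)) \<longlongrightarrow> 0) (at z0 within ?S)"
  proof (rule Lim_null_comparison[OF _ 2])
    show "\<forall>\<^sub>F z in at z0 within ?S. norm (f (fst z) (snd z) - f (fst z0) (snd z)) \<le> L * norm (fst z - fst z0)"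
      unfolding eventually_at_filter by (intro always_eventually) (auto intro!: lip)
  qed
  from tendsto_add[OF this 1] show "((\<lambda>z. f (fst z) (snd z)) \<longlongrightarrow> f (fst z0) (snd z0)) (at z0 within ?S)"
    by simp
qed

lemma continuous_along:
  fixes f :: "'a::real_normed_vector \<Rightarrow> real \<Rightarrow> 'b::real_normed_vector"
  assumes "continuous_on (UNIV \<times> {0..T}) (\<lambda>z. f (fst z) (snd z))" "continuous_on {0..T} x"
  shows "continuous_on {0..T} (\<lambda>s. f (x s) s)"
proof -
  have c: "continuous_on {0..T} (\<lambda>s. (x s, s))" using assms(2) by (intro continuous_intros)
  have "(\<lambda>s. (x s, s)) ` {0..T} \<subseteq> UNIV \<times> {0..T}" by auto
  from continuous_on_compose2[OF assms(1) c this] show ?thesis by simp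
qed

text \<open>The splitting F(x) - H(y) = (F(x) - H(x)) + (H(x) - H(y)) puts the defect on the
  trajectory \<open>x\<close> and uses the Lipschitz constant of \<open>H\<close> only. With
  \<open>H\<close> the network, the points at which it is tested do not depend on it.\<close>

lemma ode_compare:
  fixes x y :: "real \<Rightarrow> 'a::euclidean_space" and F H :: "'a \<Rightarrow> real \<Rightarrow> 'a"
  assumes x: "\<And>t. t \<in> {0..T} \<Longrightarrow> (x has_vector_derivative F (x t) t) (at t within {0..T})"
    and y: "\<And>t. t \<in> {0..T} \<Longrightarrow> (y has_vector_derivative H (y t) t) (at t within {0..T})"
    and Fc: "continuous_on (UNIV \<times> {0..T}) (\<lambda>z. F (fst z) (snd z))"
    and Hc: "continuous_on (UNIV \<times> {0..T}) (\<lambda>z. H (fst z) (snd z))"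
    and lip: "\<And>u v t. t \<in> {0..T} \<Longrightarrow> norm (H u t - H v t) \<le> L * norm (u - v)" and L: "L \<ge> 0"
    and t: "t \<in> {0..T}"
  shows "norm (x t - y t) \<le> (norm (x 0 - y 0) + integral {0..T} (\<lambda>s. norm (F (x s) s - H (x s) s))) * exp (L * t)"
proof -
  have xc: "continuous_on {0..T} x" and yc: "continuous_on {0..T} y"
    unfolding continuous_on_eq_continuous_within
    using x y has_vector_derivative_continuous by blast+
  note c = continuous_along[OF Fc xc] continuous_along[OF Hc xc] continuous_along[OF Hc yc]
  let ?g = "\<lambda>s. norm (F (x s) s - H (x s) s)" and ?e = "\<lambda>s. norm (x s - y s)"
  have gc: "continuous_on {0..T} ?g" and ec: "continuous_on {0..T} ?e"
    using c xc yc by (auto intro!: continuous_intros)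
  show ?thesis
  proof (rule gronwall[OF ec L _ t])
    fix t assume t: "t \<in> {0..T}"
    then have sub: "{0..t} \<subseteq> {0..T}" by auto
    have ix: "((\<lambda>s. F (x s) s) has_integral (x t - x 0)) {0..t}"
    proof (rule fundamental_theorem_of_calculus)
      show "(x has_vector_derivative F (x s) s) (at s within {0..t})" if "s \<in> {0..t}" for s
        using has_vector_derivative_within_subset[OF x sub] that sub by blast
    qed (use t in auto)
    have iy: "((\<lambda>s. H (y s) s) has_integral (y t - y 0)) {0..t}"
    proof (rule fundamental_theorem_of_calculus)
      show "(y has_vector_derivative H (y s) s) (at s within {0..t})" if "s \<in> {0..t}" for s
        using has_vector_derivative_within_subset[OF y sub] that sub by blast
    qed (use t in auto)
    have int: "?g integrable_on {0..t}" "?e integrable_on {0..t}" "?g integrable_on {0..T}"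
      by (intro integrable_continuous_interval continuous_on_subset[OF gc sub] continuous_on_subset[OF ec sub] gc)+
    have d: "((\<lambda>s. F (x s) s - H (y s) s) has_integral ((x t - x 0) - (y t - y 0))) {0..t}"
      using ix iy by (rule has_integral_diff)
    have "norm ((x t - x 0) - (y t - y 0)) = norm (integral {0..t} (\<lambda>s. F (x s) s - H (y s) s))"
      using d by (simp add: integral_unique)
    also have "\<dots> \<le> integral {0..t} (\<lambda>s. ?g s + L * ?e s)"
    proof (rule integral_norm_bound_integral)
      show "(\<lambda>s. F (x s) s - H (y s) s) integrable_on {0..t}" using d by blast
      show "(\<lambda>s. ?g s + L * ?e s) integrable_on {0..t}"
        using int by (intro integrable_add integrable_on_mult_right) auto
      fix s assume "s \<in> {0..t}"
      then have "norm (H (x s) s - H (y s) s) \<le> L * ?e s" using sub by (intro lip) auto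
      then show "norm (F (x s) s - H (y s) s) \<le> ?g s + L * ?e s"
        using norm_triangle_ineq[of "F (x s) s - H (x s) s" "H (x s) s - H (y s) s"] by simp
    qed
    also have "\<dots> = integral {0..t} ?g + L * integral {0..t} ?e"
      using int by (subst Henstock_Kurzweil_Integration.integral_add) (auto intro: integrable_on_mult_right)
    also have "integral {0..t} ?g \<le> integral {0..T} ?g"
      using int sub by (intro integral_subset_le) auto
    finally have "norm ((x t - x 0) - (y t - y 0)) \<le> integral {0..T} ?g + L * integral {0..t} ?e" by simp
    then show "?e t \<le> norm (x 0 - y 0) + integral {0..T} ?g + L * integral {0..t} ?e"
      using norm_triangle_ineq[of "x 0 - y 0" "(x t - x 0) - (y t - y 0)"] by (simp add: algebra_simps)
  qed
qed

lemma flow_lipschitz: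
  fixes F :: "real^'n \<Rightarrow> real \<Rightarrow> real^'n"
  assumes "is_flow T F \<phi>" "is_flow T F \<phi>'"
    and "continuous_on (UNIV \<times> {0..T}) (\<lambda>z. F (fst z) (snd z))"
    and "\<And>u v t. t \<in> {0..T} \<Longrightarrow> norm (F u t - F v t) \<le> L * norm (u - v)" "L \<ge> 0" "t \<in> {0..T}"
  shows "norm (\<phi> t x - \<phi>' t y) \<le> exp (L * T) * norm (x - y)"
proof -
  have "norm (\<phi> t x - \<phi>' t y) \<le> (norm (\<phi> 0 x - \<phi>' 0 y) + integral {0..T} (\<lambda>s. norm (F (\<phi> s x) s - F (\<phi> s x) s))) * exp (L * t)"
    by (rule ode_compare[of T "\<lambda>s. \<phi> s x" F "\<lambda>s. \<phi>' s y" F]) (use assms in \<open>auto simp: is_flow_def\<close>)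
  also have "\<dots> = norm (x - y) * exp (L * t)" using assms(1,2) by (simp add: is_flow_def)
  also have "\<dots> \<le> norm (x - y) * exp (L * T)" using assms(5,6) by (intro mult_left_mono) (auto intro: mult_left_mono)
  finally show ?thesis by (simp add: mult.commute)
qed

lemma flow_joint_continuous:
  fixes F :: "real^'n \<Rightarrow> real \<Rightarrow> real^'n"
  assumes "is_flow T F \<phi>"
    and "continuous_on (UNIV \<times> {0..T}) (\<lambda>z. F (fst z) (snd z))"
    and "\<And>u v t. t \<in> {0..T} \<Longrightarrow> norm (F u t - F v t) \<le> L * norm (u - v)" "L \<ge> 0"
  shows "continuous_on (UNIV \<times> {0..T}) (\<lambda>z. \<phi> (snd z) (fst z))"
proof (rule lipschitz_joint_continuous[where f = "\<lambda>x t. \<phi> t x" and L = "exp (L * T)"])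
  show "norm (\<phi> t x - \<phi> t y) \<le> exp (L * T) * norm (x - y)" if "t \<in> {0..T}" for x y t
    using flow_lipschitz[OF assms(1,1,2,3,4) that] .
  show "continuous_on {0..T} (\<lambda>t. \<phi> t x)" for x
    unfolding continuous_on_eq_continuous_within
    using assms(1) has_vector_derivative_continuous unfolding is_flow_def by blast
qed

text \<open>The joint law of \<open>g\<close> and \<open>h\<close> is an admissible
  coupling.\<close>

lemma W1_pushforward_le:
  fixes g h :: "real^'n \<Rightarrow> real^'n"
  assumes "prob_space M" "g \<in> measurable M borel" "h \<in> measurable M borel"
  shows "W1 (distr M borel g) (distr M borel h) \<le> (\<integral>\<^sup>+ x. ennreal (dist (g x) (h x)) \<partial>M)"
proof -
  interpret prob_space M by fact
  let ?p = "\<lambda>x. (g x, h x)"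
  have p: "?p \<in> measurable M borel"
    using assms(2,3) by (simp add: borel_prod[symmetric])
  have m: "fst \<in> measurable (borel :: ((real^'n) \<times> (real^'n)) measure) borel" "snd \<in> measurable (borel :: ((real^'n) \<times> (real^'n)) measure) borel"
    by (auto intro!: borel_measurable_continuous_onI continuous_intros)
  have "distr M borel ?p \<in> {\<pi>. prob_space \<pi> \<and> sets \<pi> = sets borel \<and> distr \<pi> borel fst = distr M borel g \<and> distr \<pi> borel snd = distr M borel h}"
    using p m by (auto simp: prob_space_distr distr_distr comp_def)
  then have "W1 (distr M borel g) (distr M borel h) \<le> (\<integral>\<^sup>+ z. ennreal (dist (fst z) (snd z)) \<partial>distr M borel ?p)"
    unfolding W1_def by (rule INF_lower)
  also have "\<dots> = (\<integral>\<^sup>+ x. ennreal (dist (g x) (h x)) \<partial>M)"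
    using p by (subst nn_integral_distr) (auto intro!: borel_measurable_continuous_onI continuous_intros measurable_compose[OF _ measurable_ennreal])
  finally show ?thesis .
qed

section \<open>From the Sobolev hypothesis to networks\<close>

lemma isCont_indicator_open:
  fixes f :: "'a::t2_space \<Rightarrow> real"
  assumes "open S" "continuous_on S f" "z \<in> S"
  shows "isCont (\<lambda>z. indicator S z * f z) z"
proof -
  have "isCont f z" using assms by (simp add: continuous_on_eq_continuous_at)
  moreover have "\<forall>\<^sub>F y in nhds z. indicator S y * f y = f y"
    using eventually_nhds_in_open[OF assms(1,3)] by (auto elim!: eventually_mono simp: indicator_def)
  ultimately show ?thesis using isCont_cong by fast
qed

text \<open>\<open>H_loc\<close> supplies each weak derivative separately, by its pairing with
  derivatives of test functions. The locale needs the passage from order \<open>l\<close> to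
  \<open>Suc l\<close>, obtained by testing order \<open>Suc l\<close> with \<open>tens p\<close>
  and order \<open>l\<close> with its partial derivative.\<close>

lemma sobolev_component_slab:
  fixes f :: "real^'n \<Rightarrow> real \<Rightarrow> real^'n" and j :: 'n
  assumes T_pos: "T > 0"
    and fc: "continuous_on (UNIV \<times> {0..T}) (\<lambda>z. f (fst z) (snd z))"
    and sob: "H_loc k T f"
  defines "S \<equiv> (UNIV :: (real^'n) set) \<times> {0<..<T}" and "F \<equiv> \<lambda>z. indicator (UNIV \<times> {0<..<T}) z * (f (fst z) (snd z) $ j)"
  shows "\<exists>G. slab_sobolev (0, 1) T k G \<and> (\<forall>b\<in>Basis. G b 0 = F)"
proof -
  let ?\<tau> = "(0, 1) :: (real^'n) \<times> real"
  let ?f = "\<lambda>z. f (fst z) (snd z)"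
  have tau: "?\<tau> \<in> Basis" by (simp add: Basis_prod_def)
  have S_iff: "z \<in> S \<longleftrightarrow> 0 < z \<bullet> ?\<tau> \<and> z \<bullet> ?\<tau> < T" for z by (cases z) (auto simp: S_def)
  have S_open: "open S" unfolding S_def by (intro open_Times) auto
  have S_borel: "S \<in> sets borel" using S_open by simp
  \<comment> \<open>Measurability is requested only after multiplication by the indicator of
    \<open>S\<close>, as nothing is known of \<open>f\<close> outside the time interval.\<close>
  define P where "P = (\<lambda>b l (g :: (real^'n) \<times> real \<Rightarrow> real^'n).
     (\<lambda>z. indicator S z *\<^sub>R g z) \<in> borel_measurable borel \<and>
     (\<forall>X. compact X \<and> X \<subseteq> UNIV \<times> {0..T} \<longrightarrow> set_integrable lborel X (\<lambda>z. (norm (g z))\<^sup>2)) \<and>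
     (\<forall>\<phi>. test_fun S \<phi> \<longrightarrow> (LINT z|lborel. iter_dderiv \<phi> (replicate l b) z *\<^sub>R ?f z) = ((-1) ^ l) *\<^sub>R (LINT z|lborel. \<phi> z *\<^sub>R g z)))"
  have rep: "replicate l b \<in> lists Basis" if "b \<in> Basis" for l and b :: "(real^'n) \<times> real" using that by (induction l) auto
  have P0: "P b 0 ?f" if "b \<in> Basis" for b
  proof -
    have "S \<subseteq> UNIV \<times> {0..T}" by (auto simp: S_def)
    then have "(\<lambda>z. indicator S z *\<^sub>R ?f z) \<in> borel_measurable borel"
      by (intro borel_measurable_continuous_on_indicator[OF S_borel continuous_on_subset[OF fc]])
    moreover have "\<forall>X. compact X \<and> X \<subseteq> UNIV \<times> {0..T} \<longrightarrow> set_integrable lborel X (\<lambda>z. (norm (?f z))\<^sup>2)"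
      using sob[unfolded H_loc_def, rule_format, of "[]"] by force
    ultimately show ?thesis by (simp add: P_def)
  qed
  have Pl: "\<exists>g. P b l g" if b: "b \<in> Basis" and l: "l \<le> k" for b l
  proof -
    from sob[unfolded H_loc_def, rule_format, OF rep[OF b], of l] l
    obtain g where g: "g \<in> borel_measurable lborel"
      "\<And>X. compact X \<and> X \<subseteq> UNIV \<times> {0..T} \<Longrightarrow> set_integrable lborel X (\<lambda>z. (norm (g z))\<^sup>2)"
      "\<And>\<phi>. test_fun S \<phi> \<Longrightarrow> (LINT z|lborel. iter_dderiv \<phi> (replicate l b) z *\<^sub>R ?f z) = ((-1) ^ l) *\<^sub>R (LINT z|lborel. \<phi> z *\<^sub>R g z)"
      unfolding S_def by auto
    have "(\<lambda>z. indicator S z *\<^sub>R g z) \<in> borel_measurable borel"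
      using g(1) S_borel by (intro borel_measurable_scaleR) auto
    then show ?thesis using g(2,3) unfolding P_def by blast
  qed
  \<comment> \<open>At order zero \<open>f\<close> itself is taken: a weak derivative of order zero
    is determined only up to null sets, whereas \<open>G b 0\<close> must be the same function
    \<open>F\<close> for all \<open>b\<close> and continuous in the slab.\<close>
  define g where "g = (\<lambda>b l. if l = 0 then ?f else (SOME g. P b l g))"
  have gP: "P b l (g b l)" if "b \<in> Basis" "l \<le> k" for b l
    using P0[OF that(1)] someI_ex[OF Pl[OF that]] by (auto simp: g_def)
  have gI: "(LINT z|lborel. iter_dderiv \<phi> (replicate l b) z *\<^sub>R ?f z) = ((-1) ^ l) *\<^sub>R (LINT z|lborel. \<phi> z *\<^sub>R g b l z)"
    if "b \<in> Basis" "l \<le> k" "test_fun S \<phi>" for b l \<phi>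
    using gP[OF that(1,2), unfolded P_def] that(3) by simp
  define G where "G = (\<lambda>b l z. indicator S z * (g b l z $ j))"
  have G_meas: "G b l \<in> borel_measurable borel" if "b \<in> Basis" "l \<le> k" for b l
  proof -
    have "(\<lambda>v::real^'n. v $ j) \<in> borel_measurable borel"
      by (intro borel_measurable_continuous_onI continuous_intros)
    from measurable_compose[OF conjunct1[OF gP[OF that, unfolded P_def]] this]
    have "(\<lambda>z. (indicator S z *\<^sub>R g b l z) $ j) \<in> borel_measurable borel" .
    then show ?thesis by (simp add: G_def)
  qed
  have G_sq: "integrable lborel (\<lambda>z. indicator (cbox c d) z * (G b l z)\<^sup>2)" if bl: "b \<in> Basis" "l \<le> k" for b l c d
  proof (rule Bochner_Integration.integrable_bound)
    let ?X = "cbox c d \<inter> (UNIV \<times> {0..T})"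
    have "compact ?X" by (intro compact_Int_closed compact_cbox closed_Times) auto
    then show "integrable lborel (\<lambda>z. indicator ?X z *\<^sub>R (norm (g b l z))\<^sup>2)"
      using gP[OF bl] unfolding P_def set_integrable_def by blast
    show "(\<lambda>z. indicator (cbox c d) z * (G b l z)\<^sup>2) \<in> borel_measurable lborel"
      using G_meas[OF bl] by measurable
    have "indicator (cbox c d) z * (G b l z)\<^sup>2 \<le> indicator ?X z *\<^sub>R (norm (g b l z))\<^sup>2" for z
    proof (cases "z \<in> cbox c d \<and> z \<in> S")
      case True
      then have "z \<in> ?X" by (auto simp: S_def)
      moreover have "(g b l z $ j)\<^sup>2 \<le> (norm (g b l z))\<^sup>2"
        using component_le_norm_cart[of "g b l z" j] by (simp add: abs_le_square_iff[symmetric])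
      ultimately show ?thesis using True by (simp add: G_def)
    qed (auto simp: G_def)
    then show "AE z in lborel. norm (indicator (cbox c d) z * (G b l z)\<^sup>2) \<le> norm (indicator ?X z *\<^sub>R (norm (g b l z))\<^sup>2)"
      by (intro AE_I2) auto
  qed
  have comp: "(\<integral>z. tens p z * G b l z \<partial>lborel) = (LINT z|lborel. tens p z *\<^sub>R g b l z) $ j"
    if bl: "b \<in> Basis" "l \<le> k" and p: "smooth_box p lo hi" and t: "0 < lo \<bullet> ?\<tau>" "hi \<bullet> ?\<tau> < T" for b l p lo hi
  proof -
    have S: "tens p z \<noteq> 0 \<Longrightarrow> z \<in> cbox lo hi \<and> z \<in> S" for z
    proof -
      assume "tens p z \<noteq> 0"
      then have z: "z \<in> cbox lo hi" using tens_zero[OF p] by blast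
      then have "lo \<bullet> ?\<tau> \<le> z \<bullet> ?\<tau> \<and> z \<bullet> ?\<tau> \<le> hi \<bullet> ?\<tau>" using tau unfolding mem_box by blast
      then show ?thesis using z t unfolding S_iff by linarith
    qed
    obtain B where B: "B \<ge> 0" "\<And>z. \<bar>tens p z\<bar> \<le> B" using tens_bounded[OF p] by blast
    have int: "integrable lborel (\<lambda>z. tens p z *\<^sub>R g b l z)"
    proof (rule Bochner_Integration.integrable_bound)
      let ?X = "cbox lo hi \<inter> (UNIV \<times> {0..T})"
      have X: "compact ?X" by (intro compact_Int_closed compact_cbox closed_Times) auto
      then have "integrable lborel (\<lambda>z. indicator ?X z *\<^sub>R (norm (g b l z))\<^sup>2)"
        using gP[OF bl] unfolding P_def set_integrable_def by blast
      moreover have "integrable lborel (indicator ?X :: _ \<Rightarrow> real)"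
        using emeasure_bounded_finite[OF compact_imp_bounded[OF X]] compact_imp_closed[OF X]
        by (intro integrable_real_indicator) (simp_all add: less_top[symmetric])
      ultimately show "integrable lborel (\<lambda>z. B * (indicator ?X z + indicator ?X z *\<^sub>R (norm (g b l z))\<^sup>2))"
        by (intro integrable_mult_right Bochner_Integration.integrable_add)
      have eq: "tens p z *\<^sub>R g b l z = tens p z *\<^sub>R (indicator S z *\<^sub>R g b l z)" for z
        using S[of z] by (cases "tens p z = 0") auto
      show "(\<lambda>z. tens p z *\<^sub>R g b l z) \<in> borel_measurable lborel"
      proof -
        have "(\<lambda>z. tens p z *\<^sub>R (indicator S z *\<^sub>R g b l z)) \<in> borel_measurable borel"
          by (rule borel_measurable_scaleR[OF tens_measurable[OF p] conjunct1[OF gP[OF bl, unfolded P_def]]])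
        also have "(\<lambda>z. tens p z *\<^sub>R (indicator S z *\<^sub>R g b l z)) = (\<lambda>z. tens p z *\<^sub>R g b l z)"
          using eq by (intro ext) (rule sym)
        finally show ?thesis by simp
      qed
      have "norm (tens p z *\<^sub>R g b l z) \<le> B * (indicator ?X z + indicator ?X z *\<^sub>R (norm (g b l z))\<^sup>2)" for z
      proof (cases "tens p z = 0")
        case False
        then have zX: "z \<in> ?X" using S[of z] by (auto simp: S_def)
        have "norm (g b l z) \<le> 1 + (norm (g b l z))\<^sup>2"
          using zero_le_power2[of "norm (g b l z) - 1/2"] by (simp add: power2_eq_square algebra_simps)
        then have "\<bar>tens p z\<bar> * norm (g b l z) \<le> B * (1 + (norm (g b l z))\<^sup>2)"
          using B by (intro mult_mono) auto
        then show ?thesis using zX by simp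
      qed (use B in auto)
      then show "AE z in lborel. norm (tens p z *\<^sub>R g b l z) \<le> norm (B * (indicator ?X z + indicator ?X z *\<^sub>R (norm (g b l z))\<^sup>2))"
        by (intro AE_I2) (use abs_ge_self order_trans in \<open>fastforce simp del: norm_scaleR\<close>)
    qed
    have "(LINT z|lborel. tens p z *\<^sub>R g b l z) $ j = (LINT z|lborel. (tens p z *\<^sub>R g b l z) $ j)"
      by (rule integral_bounded_linear[OF bounded_linear_vec_nth int, symmetric])
    also have "\<dots> = (\<integral>z. tens p z * G b l z \<partial>lborel)"
      using S by (intro Bochner_Integration.integral_cong refl) (auto simp: G_def indicator_def)
    finally show ?thesis ..
  qed
  have "slab_sobolev ?\<tau> T k G"
  proof
    show "?\<tau> \<in> Basis" "0 < T" by fact+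
    show "G b l \<in> borel_measurable borel" if "b \<in> Basis" "l \<le> k" for b l using G_meas[OF that] .
    show "G b l z = 0" if "\<not> (0 < z \<bullet> ?\<tau> \<and> z \<bullet> ?\<tau> < T)" for b l z
      using that unfolding S_iff[symmetric] by (simp add: G_def)
    show "integrable lborel (\<lambda>z. indicator (cbox c d) z * (G b l z)\<^sup>2)" if "b \<in> Basis" "l \<le> k" for b l c d using G_sq[OF that] .
    fix b :: "(real^'n) \<times> real" and l p lo hi
    assume b: "b \<in> Basis" and l: "l < k" and p: "smooth_box p lo hi" and t: "0 < lo \<bullet> ?\<tau>" "hi \<bullet> ?\<tau> < T"
    let ?p' = "p(b := deriv (p b))"
    have p': "smooth_box ?p' lo hi" by (rule smooth_box_deriv[OF p b])
    have sub: "cbox lo hi \<subseteq> S"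
    proof
      fix z assume "z \<in> cbox lo hi"
      then have "lo \<bullet> ?\<tau> \<le> z \<bullet> ?\<tau> \<and> z \<bullet> ?\<tau> \<le> hi \<bullet> ?\<tau>" using tau unfolding mem_box by blast
      then show "z \<in> S" using t unfolding S_iff by linarith
    qed
    have sm: "c \<in> Basis \<Longrightarrow> smooth1 (p c)" "c \<in> Basis \<Longrightarrow> smooth1 (?p' c)" for c
      using p p' by (auto simp: smooth_box_def)
    have cl: "count_list (replicate m b) c = (if c = b then m else 0)" for m c by (induction m) auto
    \<comment> \<open>Both weak formulations now have the same left-hand side, so their right-hand
      sides agree; this is the integration by parts from \<open>l\<close> to
      \<open>Suc l\<close>.\<close>
    have D: "iter_dderiv (tens p) (replicate (Suc l) b) = iter_dderiv (tens ?p') (replicate l b)"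
    proof -
      have "iter_dderiv (tens p) (replicate (Suc l) b) = tens (\<lambda>c. (deriv ^^ count_list (replicate (Suc l) b) c) (p c))"
        by (rule iter_dderiv_tens[OF _ rep[OF b]]) (rule sm(1))
      moreover have "iter_dderiv (tens ?p') (replicate l b) = tens (\<lambda>c. (deriv ^^ count_list (replicate l b) c) (?p' c))"
        by (rule iter_dderiv_tens[OF _ rep[OF b]]) (rule sm(2))
      ultimately show ?thesis
        unfolding cl by (simp only:) (intro tens_cong, simp add: funpow_swap1)
    qed
    have "((-1) ^ l) *\<^sub>R (LINT z|lborel. tens ?p' z *\<^sub>R g b l z) = ((-1) ^ Suc l) *\<^sub>R (LINT z|lborel. tens p z *\<^sub>R g b (Suc l) z)"
      unfolding gI[OF b _ test_fun_tens[OF p' sub], OF less_imp_le[OF l], symmetric]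
        gI[OF b _ test_fun_tens[OF p sub], OF Suc_leI[OF l], symmetric] D ..
    then have "((-1) ^ l) *\<^sub>R (LINT z|lborel. tens ?p' z *\<^sub>R g b l z) = ((-1) ^ l) *\<^sub>R (- (LINT z|lborel. tens p z *\<^sub>R g b (Suc l) z))"
      by simp
    then have "(LINT z|lborel. tens ?p' z *\<^sub>R g b l z) = - (LINT z|lborel. tens p z *\<^sub>R g b (Suc l) z)"
      by (simp only: scaleR_cancel_left) simp
    then show "(\<integral>z. tens ?p' z * G b l z \<partial>lborel) = - (\<integral>z. tens p z * G b (Suc l) z \<partial>lborel)"
      using comp[OF b _ p' t, of l] comp[OF b _ p t, of "Suc l"] l by simp
  qed
  moreover have "\<forall>b\<in>Basis. G b 0 = F" by (simp add: G_def g_def F_def S_def)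
  ultimately show ?thesis by blast
qed

definition net_fit :: "'a::euclidean_space measure \<Rightarrow> ('a \<Rightarrow> real) \<Rightarrow> nat \<Rightarrow> real \<Rightarrow> real \<Rightarrow>
    (nat \<Rightarrow> 'a) \<Rightarrow> (nat \<Rightarrow> real) \<Rightarrow> (nat \<Rightarrow> real) \<Rightarrow> bool" where
  "net_fit \<mu> F P C M v c w \<longleftrightarrow> (\<forall>i<P. norm (v i) \<le> 1 \<and> \<bar>w i\<bar> \<le> M / real P) \<and>
    (\<integral>\<^sup>+z. ennreal \<bar>F z - relu_net P v c w z\<bar> \<partial>\<mu>) \<le> ennreal (C / sqrt (real P))"

lemma component_networks:
  fixes f :: "real^'n \<Rightarrow> real \<Rightarrow> real^'n" and j :: 'n and \<mu> :: "((real^'n) \<times> real) measure"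
  assumes T_pos: "T > 0"
    and fc: "continuous_on (UNIV \<times> {0..T}) (\<lambda>z. f (fst z) (snd z))"
    and sob: "H_loc k T f" and k_big: "real k > (real CARD('n) + 1) / 2 + 2"
    and rho: "\<rho> \<ge> 0" and fin: "finite_measure \<mu>" and sets_mu: "sets \<mu> = sets borel"
    and AE_mu: "AE z in \<mu>. norm z \<le> \<rho> \<and> 0 < snd z \<and> snd z < T"
  shows "\<exists>C M. \<forall>P\<ge>1. \<exists>v c w. net_fit \<mu> (\<lambda>z. f (fst z) (snd z) $ j) P C M v c w"
proof -
  let ?\<tau> = "(0, 1) :: (real^'n) \<times> real"
  let ?S = "UNIV \<times> {0<..<T} :: ((real^'n) \<times> real) set"
  define F where "F = (\<lambda>z. indicator ?S z * (f (fst z) (snd z) $ j))"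
  have it: "z \<bullet> ?\<tau> = snd z" for z :: "(real^'n) \<times> real" by (cases z) simp
  obtain G where G: "slab_sobolev ?\<tau> T k G" "\<forall>b\<in>Basis. G b 0 = F"
    using sobolev_component_slab[OF T_pos fc sob, of j] unfolding F_def by blast
  interpret slab_sobolev ?\<tau> T k G by (rule G(1))
  have fjc: "continuous_on (UNIV \<times> {0..T}) (\<lambda>z. f (fst z) (snd z) $ j)"
    using fc by (intro continuous_intros)
  have F_cont: "\<forall>z. 0 < z \<bullet> ?\<tau> \<and> z \<bullet> ?\<tau> < T \<longrightarrow> isCont F z"
    unfolding F_def
  proof (intro allI impI isCont_indicator_open)
    fix z assume that: "0 < z \<bullet> ?\<tau> \<and> z \<bullet> ?\<tau> < T"
    show "open ?S" by (intro open_Times) auto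
    show "continuous_on ?S (\<lambda>z. f (fst z) (snd z) $ j)" by (rule continuous_on_subset[OF fjc]) auto
    show "z \<in> ?S" using that unfolding it by (cases z) auto
  qed
  have F_bdd: "\<exists>B. \<forall>z\<in>cbox c d. \<bar>F z\<bar> \<le> B" for c d
  proof -
    let ?X = "cbox c d \<inter> (UNIV \<times> {0..T})"
    have "compact ?X" by (intro compact_Int_closed compact_cbox closed_Times) auto
    then have "compact ((\<lambda>z. f (fst z) (snd z) $ j) ` ?X)"
      by (intro compact_continuous_image continuous_on_subset[OF fjc]) auto
    then obtain B where B: "\<forall>y\<in>(\<lambda>z. f (fst z) (snd z) $ j) ` ?X. norm y \<le> B"
      using compact_imp_bounded bounded_iff by blast
    have "\<bar>F z\<bar> \<le> \<bar>B\<bar>" if "z \<in> cbox c d" for z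
    proof (cases "z \<in> ?S")
      case True
      then have "z \<in> ?X" using that by auto
      then have "norm (f (fst z) (snd z) $ j) \<le> B" using B by blast
      then show ?thesis using True by (simp add: F_def)
    qed (simp add: F_def)
    then show ?thesis by blast
  qed
  have k_dim: "DIM((real^'n) \<times> real) + 5 \<le> 2 * k"
  proof -
    have "real (CARD('n) + 5) < real (2 * k)" using k_big by (simp add: field_simps)
    then have "CARD('n) + 5 < 2 * k" by (simp only: of_nat_less_iff)
    then show ?thesis by simp
  qed
  define \<Omega> where "\<Omega> = slab_ball ?\<tau> T \<rho>"
  obtain M where M: "M \<ge> 0" "ridge_dual \<Omega> \<rho> F M"
    using barron_dual[OF k_dim G(2) F_cont F_bdd rho] unfolding \<Omega>_def by blast
  have \<Omega>_iff: "z \<in> \<Omega> \<longleftrightarrow> norm z \<le> \<rho> \<and> 0 < snd z \<and> snd z < T" for z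
    by (simp add: \<Omega>_def slab_ball_def it)
  have \<Omega>: "\<Omega> \<in> sets borel" "z \<in> \<Omega> \<Longrightarrow> norm z \<le> \<rho>" for z
  proof -
    have "\<Omega> = cball 0 \<rho> \<inter> ?S" by (auto simp: \<Omega>_iff mem_Times_iff)
    moreover have "open ?S" by (intro open_Times) auto
    ultimately show "\<Omega> \<in> sets borel" by simp
  qed (auto simp: \<Omega>_iff)
  obtain BF0 where BF0: "\<forall>z\<in>cbox (\<Sum>b\<in>Basis. (- \<rho>) *\<^sub>R b) (\<Sum>b\<in>Basis. \<rho> *\<^sub>R b). \<bar>F z\<bar> \<le> BF0" using F_bdd by blast
  define BF where "BF = \<bar>BF0\<bar>"
  have BF: "BF \<ge> 0" "\<bar>F z\<bar> \<le> BF" if "z \<in> \<Omega>" for z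
  proof -
    have ip: "(\<Sum>b\<in>Basis. x *\<^sub>R b) \<bullet> c = x" if "c \<in> Basis" for x and c :: "(real^'n) \<times> real"
      using that by (simp add: inner_sum_left_Basis)
    have "- \<rho> \<le> z \<bullet> b \<and> z \<bullet> b \<le> \<rho>" if "b \<in> Basis" for b
      using Basis_le_norm[OF that, of z] \<open>z \<in> \<Omega>\<close> by (auto simp: \<Omega>_iff)
    then have "z \<in> cbox (\<Sum>b\<in>Basis. (- \<rho>) *\<^sub>R b) (\<Sum>b\<in>Basis. \<rho> *\<^sub>R b)" unfolding mem_box using ip by metis
    then show "\<bar>F z\<bar> \<le> BF" using BF0 by (force simp: BF_def)
  qed (simp add: BF_def)
  have F_m: "F \<in> borel_measurable borel" using G_meas[OF tau, of 0] bspec[OF G(2) tau] by simp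
  define m where "m = measure \<mu> (space \<mu>)"
  define Q where "Q = 2 + ((M + 1) * (2 * \<rho> + 1) + BF)\<^sup>2 * m"
  interpret finite_measure \<mu> by (rule fin)
  have "\<exists>v c w. net_fit \<mu> (\<lambda>z. f (fst z) (snd z) $ j) P ((m + Q) / 2) (M + 1) v c w"
    if P: "P \<ge> 1" for P :: nat
  proof -
    have "\<exists>v c w. (\<forall>i<P. norm (v i) \<le> 1 \<and> \<bar>w i\<bar> \<le> (M + 1) / real P) \<and>
      (\<integral>z. (F z - relu_net P v c w z)\<^sup>2 \<partial>\<mu>) \<le>
      (2 + ((M + 1) * (2 * \<rho> + 1) + BF)\<^sup>2 * measure \<mu> (space \<mu>)) / real P"
      by (rule greedy_relu_approximation[OF fin sets_mu \<Omega> _ F_m BF(2) rho _ M P])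
         (use AE_mu in \<open>auto simp: \<Omega>_iff BF_def\<close>)
    then obtain v c w where vw: "\<forall>i<P. norm (v i) \<le> 1 \<and> \<bar>w i\<bar> \<le> (M + 1) / real P"
      and err: "(\<integral>z. (F z - relu_net P v c w z)\<^sup>2 \<partial>\<mu>) \<le> Q / real P"
      unfolding Q_def m_def by blast
    let ?u = "\<lambda>z. F z - relu_net P v c w z"
    define U where "U = BF + (\<Sum>i<P. \<bar>w i\<bar> * (norm (v i) * \<rho> + \<bar>c i\<bar>))"
    have ub: "\<bar>?u z\<bar> \<le> U" if z: "z \<in> \<Omega>" for z
    proof -
      have "\<bar>w i * max 0 (v i \<bullet> z + c i)\<bar> \<le> \<bar>w i\<bar> * (norm (v i) * \<rho> + \<bar>c i\<bar>)" for i
      proof -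
        have "\<bar>v i \<bullet> z\<bar> \<le> norm (v i) * norm z" by (rule Cauchy_Schwarz_ineq2)
        also have "\<dots> \<le> norm (v i) * \<rho>" using \<Omega>(2)[OF z] by (intro mult_left_mono) auto
        finally have "\<bar>max 0 (v i \<bullet> z + c i)\<bar> \<le> norm (v i) * \<rho> + \<bar>c i\<bar>" by auto
        then show ?thesis by (simp add: abs_mult mult_left_mono)
      qed
      then have "\<bar>\<Sum>i<P. w i * max 0 (v i \<bullet> z + c i)\<bar> \<le> (\<Sum>i<P. \<bar>w i\<bar> * (norm (v i) * \<rho> + \<bar>c i\<bar>))"
        unfolding relu_net_def by (intro order_trans[OF sum_abs sum_mono])
      then show ?thesis using BF(2)[OF z] unfolding U_def relu_net_def by linarith
    qed
    have um: "?u \<in> borel_measurable \<mu>"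
      unfolding measurable_cong_sets[OF sets_mu refl]
      by (intro borel_measurable_diff F_m borel_measurable_continuous_onI relu_net_continuous)
    have AE_\<Omega>: "AE z in \<mu>. z \<in> \<Omega>" using AE_mu by (simp add: \<Omega>_iff)
    have usq: "integrable \<mu> (\<lambda>z. (?u z)\<^sup>2)"
    proof (rule integrable_const_bound)
      show "AE z in \<mu>. norm ((?u z)\<^sup>2) \<le> U\<^sup>2"
        using AE_\<Omega> by (rule AE_mp) (intro AE_I2 impI, use power_mono[OF ub abs_ge_zero, of _ 2] in simp)
      show "(\<lambda>z. (?u z)\<^sup>2) \<in> borel_measurable \<mu>" using um by measurable
    qed
    \<comment> \<open>Passing from L^2 to L^1: in |x| \<le> (\<epsilon> + x^2 / \<epsilon>) / 2 this
      choice balances the total mass against the squared error \<open>Q / P\<close>, and both terms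
      become of order 1 / sqrt P.\<close>
    define \<epsilon> where "\<epsilon> = 1 / sqrt (real P)"
    have \<epsilon>: "\<epsilon> > 0" using P by (simp add: \<epsilon>_def)
    have am: "\<bar>x\<bar> \<le> (\<epsilon> + x\<^sup>2 / \<epsilon>) / 2" for x :: real
    proof -
      have "0 \<le> (\<bar>x\<bar> - \<epsilon>)\<^sup>2" by simp
      then have "2 * \<epsilon> * \<bar>x\<bar> \<le> \<epsilon>\<^sup>2 + x\<^sup>2" by (simp add: power2_diff algebra_simps)
      then show ?thesis using \<epsilon> by (simp add: field_simps power2_eq_square)
    qed
    have "(\<integral>\<^sup>+z. ennreal \<bar>f (fst z) (snd z) $ j - relu_net P v c w z\<bar> \<partial>\<mu>) \<le> (\<integral>\<^sup>+z. ennreal ((\<epsilon> + (?u z)\<^sup>2 / \<epsilon>) / 2) \<partial>\<mu>)"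
    proof (rule nn_integral_mono_AE)
      show "AE z in \<mu>. ennreal \<bar>f (fst z) (snd z) $ j - relu_net P v c w z\<bar> \<le> ennreal ((\<epsilon> + (?u z)\<^sup>2 / \<epsilon>) / 2)"
        using AE_\<Omega>
      proof (rule AE_mp, intro AE_I2 impI)
        fix z assume "z \<in> \<Omega>"
        then have "F z = f (fst z) (snd z) $ j" by (auto simp: F_def \<Omega>_iff indicator_def mem_Times_iff)
        then show "ennreal \<bar>f (fst z) (snd z) $ j - relu_net P v c w z\<bar> \<le> ennreal ((\<epsilon> + (?u z)\<^sup>2 / \<epsilon>) / 2)"
          using am[of "?u z"] by (intro ennreal_leI) simp
      qed
    qed
    also have "\<dots> = ennreal (\<integral>z. (\<epsilon> + (?u z)\<^sup>2 / \<epsilon>) / 2 \<partial>\<mu>)"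
      using usq \<epsilon> by (intro nn_integral_eq_integral) auto
    also have "(\<integral>z. (\<epsilon> + (?u z)\<^sup>2 / \<epsilon>) / 2 \<partial>\<mu>) = (\<epsilon> * m + (\<integral>z. (?u z)\<^sup>2 \<partial>\<mu>) / \<epsilon>) / 2"
      using usq by (simp add: m_def mult.commute)
    also have "ennreal \<dots> \<le> ennreal (((m + Q) / 2) / sqrt (real P))"
    proof (rule ennreal_leI)
      have "(\<integral>z. (?u z)\<^sup>2 \<partial>\<mu>) / \<epsilon> \<le> Q / real P / \<epsilon>" using err \<epsilon> by (intro divide_right_mono) auto
      also have "Q / real P / \<epsilon> = Q * \<epsilon>"
        using P by (simp add: \<epsilon>_def field_simps)
      finally have "(\<epsilon> * m + (\<integral>z. (?u z)\<^sup>2 \<partial>\<mu>) / \<epsilon>) / 2 \<le> (\<epsilon> * m + Q * \<epsilon>) / 2"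
        by (intro divide_right_mono add_left_mono) auto
      also have "\<dots> = ((m + Q) / 2) / sqrt (real P)" by (simp add: \<epsilon>_def add_divide_distrib)
      finally show "(\<epsilon> * m + (\<integral>z. (?u z)\<^sup>2 \<partial>\<mu>) / \<epsilon>) / 2 \<le> ((m + Q) / 2) / sqrt (real P)" .
    qed
    finally show ?thesis using vw unfolding net_fit_def by blast
  qed
  then show ?thesis by blast
qed

section \<open>Proof of the theorem\<close>

text \<open>The Hadamard product decouples the output coordinates: the j-th row of
  \<open>A1 i\<close> with the j-th entries of \<open>A2 i\<close>, \<open>B i\<close> and
  \<open>W i\<close> is neuron \<open>i\<close> of the j-th scalar network. Hence d scalar networks
  of width \<open>P\<close> fit into one vector network of the same width.\<close>

lemma net_field_component:
  fixes v :: "'n \<Rightarrow> nat \<Rightarrow> (real^'n) \<times> real"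
  shows "net_field P (\<lambda>i. \<chi> j. w j i) (\<lambda>i. \<chi> j. fst (v j i)) (\<lambda>i. \<chi> j. snd (v j i)) (\<lambda>i. \<chi> j. c j i) x t =
    (\<chi> j. relu_net P (v j) (c j) (w j) (x, t))"
  by (simp add: vec_eq_iff relu_net_def net_field_def hadamard_def relu_vec_def sum_component
      matrix_vector_mul_component inner_prod_def max.commute mult.commute)

text \<open>In each coordinate, \<open>P\<close> neurons with unit inner weights and outer weights
  at most \<open>M j / P\<close> contribute at most \<open>M j\<close> in total, whatever
  \<open>P\<close> is.\<close>

lemma net_lipschitz:
  fixes v :: "'n::finite \<Rightarrow> nat \<Rightarrow> (real^'n) \<times> real"
  assumes "\<And>i j. i < P \<Longrightarrow> norm (v j i) \<le> 1 \<and> \<bar>w j i\<bar> \<le> M j / real P" "P \<ge> 1"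
  shows "norm ((\<chi> j. relu_net P (v j) (c j) (w j) (x, t)) - (\<chi> j. relu_net P (v j) (c j) (w j) (y, t)))
    \<le> (\<Sum>j\<in>UNIV. M j) * norm (x - y)"
proof -
  have neuron: "\<bar>w j i * max 0 (v j i \<bullet> (x, t) + c j i) - w j i * max 0 (v j i \<bullet> (y, t) + c j i)\<bar> \<le> M j / real P * norm (x - y)"
    if i: "i < P" for i j
  proof -
    have "\<bar>max 0 (v j i \<bullet> (x, t) + c j i) - max 0 (v j i \<bullet> (y, t) + c j i)\<bar> \<le> \<bar>v j i \<bullet> (x, t) - v j i \<bullet> (y, t)\<bar>"
      by (auto simp: max_def)
    also have "\<dots> = \<bar>v j i \<bullet> (x - y, 0)\<bar>" by (simp add: inner_diff_right[symmetric])
    also have "\<dots> \<le> norm (v j i) * norm (x - y, 0::real)" by (rule Cauchy_Schwarz_ineq2)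
    also have "\<dots> \<le> 1 * norm (x - y)" using assms(1)[OF i, of j] by (intro mult_mono) (auto simp: norm_Pair)
    finally have "\<bar>w j i\<bar> * \<bar>max 0 (v j i \<bullet> (x, t) + c j i) - max 0 (v j i \<bullet> (y, t) + c j i)\<bar> \<le> M j / real P * norm (x - y)"
      using assms(1)[OF i, of j] by (intro mult_mono) auto
    then show ?thesis by (simp add: abs_mult right_diff_distrib[symmetric])
  qed
  have comp: "\<bar>relu_net P (v j) (c j) (w j) (x, t) - relu_net P (v j) (c j) (w j) (y, t)\<bar> \<le> M j * norm (x - y)" for j
  proof -
    have "\<bar>relu_net P (v j) (c j) (w j) (x, t) - relu_net P (v j) (c j) (w j) (y, t)\<bar> \<le>
      (\<Sum>i<P. M j / real P * norm (x - y))"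
      unfolding relu_net_def sum_subtractf[symmetric] by (rule order_trans[OF sum_abs sum_mono]) (use neuron in auto)
    also have "\<dots> = M j * norm (x - y)" using assms(2) by simp
    finally show ?thesis .
  qed
  have "norm ((\<chi> j. relu_net P (v j) (c j) (w j) (x, t)) - (\<chi> j. relu_net P (v j) (c j) (w j) (y, t)))
    \<le> (\<Sum>j\<in>UNIV. M j * norm (x - y))"
    by (rule order_trans[OF norm_le_l1_cart sum_mono]) (use comp in simp)
  then show ?thesis by (simp add: sum_distrib_right)
qed

lemma net_continuous:
  fixes v :: "'n::finite \<Rightarrow> nat \<Rightarrow> (real^'n) \<times> real"
  shows "continuous_on A (\<lambda>z. (\<chi> j. relu_net P (v j) (c j) (w j) z) :: real^'n)"
  by (intro continuous_on_vec_lambda relu_net_continuous)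

theorem theorem2p3:
  fixes f :: "real^'n \<Rightarrow> real \<Rightarrow> real^'n"
    and T :: real and k :: nat
    and \<rho>0 :: "(real^'n) measure" and K :: "(real^'n) set"
  assumes T_pos: "T > 0"
    and f_cont_t: "\<forall>x. continuous_on {0..T} (f x)"
    and f_lip: "\<exists>L>0. \<forall>x y. \<forall>t\<in>{0..T}. norm (f x t - f y t) \<le> L * norm (x - y)"
    and k_big: "real k > (real CARD('n) + 1) / 2 + 2"
    and f_sob: "H_loc k T f"
    and \<rho>0_prob: "prob_space \<rho>0" and \<rho>0_sets: "sets \<rho>0 = sets borel"
    and K_compact: "compact K" and \<rho>0_supp: "emeasure \<rho>0 (UNIV - K) = 0"
    and \<rho>0_dens: "\<exists>h :: real^'n \<Rightarrow> real. h \<in> borel_measurable borel \<and> (\<forall>x. h x \<ge> 0) \<and>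
                   \<rho>0 = density lborel (\<lambda>x. ennreal (h x)) \<and>
                   set_integrable lborel K (\<lambda>x. (h x)\<^sup>2)"
  shows "\<exists>C::real. \<forall>P::nat. P \<ge> 1 \<longrightarrow>
           (\<exists>(W :: nat \<Rightarrow> real^'n) (A1 :: nat \<Rightarrow> real^'n^'n) (A2 :: nat \<Rightarrow> real^'n) (B :: nat \<Rightarrow> real^'n).
              \<forall>\<phi> \<phi>\<Theta>. is_flow T f \<phi> \<and> is_flow T (net_field P W A1 A2 B) \<phi>\<Theta> \<longrightarrow>
                (\<forall>t\<in>{0..T}. W1 (distr \<rho>0 borel (\<phi> t)) (distr \<rho>0 borel (\<phi>\<Theta> t))
                               \<le> ennreal (C / sqrt (real P))))"
proof (cases "\<exists>\<phi>. is_flow T f \<phi>")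
  \<comment> \<open>Without a flow of \<open>f\<close> the claim is vacuous. Otherwise one flow can
    be fixed before \<open>P\<close>, and the measure \<mu> is built from it.\<close>
  case False
  then show ?thesis by blast
next
  case True
  then obtain \<phi>0 where \<phi>0: "is_flow T f \<phi>0" by blast
  obtain L where L: "L > 0" "\<And>x y t. t \<in> {0..T} \<Longrightarrow> norm (f x t - f y t) \<le> L * norm (x - y)"
    using f_lip by blast
  have fc: "continuous_on (UNIV \<times> {0..T}) (\<lambda>z. f (fst z) (snd z))"
    using f_cont_t by (intro lipschitz_joint_continuous[OF L(2)]) auto
  note flow_cont = flow_joint_continuous[OF _ fc L(2) less_imp_le[OF L(1)]]
  \<comment> \<open>Clamping time to [0, T] makes the flow map continuous on the whole product
    space, hence Borel, without changing it on the interval of interest.\<close>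
  define cl where "cl = (\<lambda>t. max 0 (min t T))"
  have cl: "cl t \<in> {0..T}" "t \<in> {0..T} \<Longrightarrow> cl t = t" for t using T_pos by (auto simp: cl_def)
  have cl_cont: "continuous_on A cl" for A unfolding cl_def by (intro continuous_intros)
  define \<psi> where "\<psi> = (\<lambda>z. \<phi>0 (cl (snd z)) (fst z))"
  have \<psi>_cont: "continuous_on UNIV \<psi>"
  proof -
    have "continuous_on UNIV (\<lambda>z::(real^'n) \<times> real. (fst z, cl (snd z)))"
      by (intro continuous_intros continuous_on_compose2[OF cl_cont[of UNIV]]) auto
    moreover have "range (\<lambda>z::(real^'n) \<times> real. (fst z, cl (snd z))) \<subseteq> UNIV \<times> {0..T}"
      unfolding image_subset_iff mem_Times_iff using cl(1) by simp
    ultimately show ?thesis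
      unfolding \<psi>_def using continuous_on_compose2[OF flow_cont[OF \<phi>0]] by fastforce
  qed
  define Z where "Z = (\<lambda>z. (\<psi> z, snd z))"
  have Z_cont: "continuous_on UNIV Z" unfolding Z_def by (intro continuous_intros \<psi>_cont)
  \<comment> \<open>Lebesgue measure on [0, T], left unnormalised so that integrals against it are
    exactly the time integrals of Gronwall's inequality.\<close>
  define N where "N = density lborel (\<lambda>t. ennreal (indicator {0..T} t))"
  define M1 where "M1 = \<rho>0 \<Otimes>\<^sub>M N"
  define \<mu> where "\<mu> = distr M1 borel Z"
  interpret R0: prob_space \<rho>0 by (rule \<rho>0_prob)
  have N_sets: "sets N = sets borel" by (simp add: N_def)
  have N_finite: "finite_measure N"
    unfolding N_def by (intro finite_measureI) (simp add: emeasure_density ennreal_indicator T_pos less_imp_le)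
  interpret N: finite_measure N by (rule N_finite)
  interpret pair: pair_sigma_finite \<rho>0 N ..
  have M1_sets: "sets M1 = sets borel"
    unfolding M1_def borel_prod[symmetric] by (rule sets_pair_measure_cong[OF \<rho>0_sets N_sets])
  have M1_meas: "measurable M1 B = measurable borel B" for B :: "'z measure"
    by (rule measurable_cong_sets[OF M1_sets refl])
  have Z_meas: "Z \<in> measurable M1 borel"
    unfolding M1_meas by (intro borel_measurable_continuous_onI Z_cont)
  have M1_finite: "finite_measure M1"
    unfolding M1_def by (intro finite_measure_pair_measure) (unfold_locales)
  have \<mu>_finite: "finite_measure \<mu>"
    unfolding \<mu>_def by (rule finite_measure.finite_measure_distr[OF M1_finite Z_meas])
  have \<mu>_sets: "sets \<mu> = sets borel" by (simp add: \<mu>_def)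
  \<comment> \<open>The trajectories starting in \<open>K\<close> sweep out a compact set of
    space-time; its radius is the \<rho> of the approximation result.\<close>
  have "compact ((\<lambda>z. (\<phi>0 (snd z) (fst z), snd z)) ` (K \<times> {0..T}))"
    using K_compact by (intro compact_continuous_image continuous_intros continuous_on_subset[OF flow_cont[OF \<phi>0]] compact_Times) auto
  then have "bounded ((\<lambda>z. (\<phi>0 (snd z) (fst z), snd z)) ` (K \<times> {0..T}))" by (rule compact_imp_bounded)
  then obtain \<rho> where \<rho>_im: "\<forall>y\<in>(\<lambda>z. (\<phi>0 (snd z) (fst z), snd z)) ` (K \<times> {0..T}). norm y \<le> \<rho>"
    unfolding bounded_iff ..
  have \<rho>: "norm (\<phi>0 t x, t) \<le> \<rho>" if "x \<in> K" "t \<in> {0..T}" for x t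
    using bspec[OF \<rho>_im imageI[of "(x, t)"]] that by simp
  define \<rho>' where "\<rho>' = max \<rho> 0"
  have AE_K: "AE x in \<rho>0. x \<in> K"
  proof (rule AE_I)
    show "{x \<in> space \<rho>0. \<not> x \<in> K} \<subseteq> UNIV - K" by auto
    show "emeasure \<rho>0 (UNIV - K) = 0" by (rule \<rho>0_supp)
    show "UNIV - K \<in> sets \<rho>0" using compact_imp_closed[OF K_compact] by (auto simp: \<rho>0_sets)
  qed
  \<comment> \<open>The two endpoints are discarded because the networks are fitted in the open slab
    only.\<close>
  have AE_N: "AE t in N. 0 < t \<and> t < T"
    unfolding N_def
    using AE_lborel_singleton[of "0::real"] AE_lborel_singleton[of T]
    by (subst AE_density) (auto simp: indicator_def)
  have AE_mu: "AE z in \<mu>. norm z \<le> \<rho>' \<and> 0 < snd z \<and> snd z < T"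
  proof -
    let ?P = "\<lambda>z::(real^'n) \<times> real. norm z \<le> \<rho>' \<and> 0 < snd z \<and> snd z < T"
    have Pm: "{z. ?P z} \<in> sets borel"
    proof -
      have "{z. ?P z} = cball 0 \<rho>' \<inter> (UNIV \<times> {0<..<T})" by (auto simp: mem_Times_iff)
      moreover have "open ((UNIV :: (real^'n) set) \<times> {0<..<T})" by (intro open_Times) auto
      ultimately show ?thesis by simp
    qed
    have "AE y in \<rho>0 \<Otimes>\<^sub>M N. ?P (Z y)"
    proof (rule pair.AE_pair_measure)
      show "{y \<in> space (\<rho>0 \<Otimes>\<^sub>M N). ?P (Z y)} \<in> sets (\<rho>0 \<Otimes>\<^sub>M N)"
        using measurable_sets[OF Z_meas Pm] unfolding M1_def by (simp add: vimage_def Int_def conj_commute)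
      show "AE x in \<rho>0. AE t in N. ?P (Z (x, t))"
        using AE_K
      proof (rule eventually_mono)
        fix x assume x: "x \<in> K"
        show "AE t in N. ?P (Z (x, t))"
          using AE_N
        proof (rule eventually_mono)
          fix t assume t: "0 < t \<and> t < T"
          then have "t \<in> {0..T}" by simp
          with \<rho>[OF x this] cl(2)[OF this] t show "?P (Z (x, t))" by (simp add: Z_def \<psi>_def \<rho>'_def)
        qed
      qed
    qed
    moreover have "{z \<in> space borel. ?P z} \<in> sets borel" using Pm by simp
    ultimately show ?thesis
      unfolding \<mu>_def by (subst AE_distr_iff[OF Z_meas]) (simp_all only: M1_def)
  qed
  have "\<forall>j. \<exists>C M. \<forall>P\<ge>1. \<exists>v c w. net_fit \<mu> (\<lambda>z. f (fst z) (snd z) $ j) P C M v c w"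
    using component_networks[OF T_pos fc f_sob k_big _ \<mu>_finite \<mu>_sets AE_mu] by (auto simp: \<rho>'_def)
  from choice[OF this] obtain C where "\<forall>j. \<exists>M. \<forall>P\<ge>1. \<exists>v c w. net_fit \<mu> (\<lambda>z. f (fst z) (snd z) $ j) P (C j) M v c w" ..
  from choice[OF this] obtain M where CM: "\<forall>j. \<forall>P\<ge>1. \<exists>v c w. net_fit \<mu> (\<lambda>z. f (fst z) (snd z) $ j) P (C j) (M j) v c w" ..
  \<comment> \<open>Absolute values are taken because the chosen constants \<open>M j\<close> and
    \<open>C j\<close> come without a sign. \<open>LM\<close> bounds the Lipschitz constant of every
    network, independently of \<open>P\<close>.\<close>
  define LM where "LM = (\<Sum>j\<in>UNIV. \<bar>M j\<bar>)"
  have LM: "LM \<ge> 0" unfolding LM_def by (intro sum_nonneg) auto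
  \<comment> \<open>The Gronwall factor at the final time, multiplied by the sum of the
    componentwise errors in mean.\<close>
  define Ctot where "Ctot = exp (LM * T) * (\<Sum>j\<in>UNIV. \<bar>C j\<bar>)"
  show ?thesis
  proof (intro exI[of _ Ctot] allI impI)
    fix P :: nat assume P: "P \<ge> 1"
    from CM P have "\<forall>j. \<exists>v c w. net_fit \<mu> (\<lambda>z. f (fst z) (snd z) $ j) P (C j) (M j) v c w" by blast
    from choice[OF this] obtain v where "\<forall>j. \<exists>c w. net_fit \<mu> (\<lambda>z. f (fst z) (snd z) $ j) P (C j) (M j) (v j) c w" ..
    from choice[OF this] obtain c where "\<forall>j. \<exists>w. net_fit \<mu> (\<lambda>z. f (fst z) (snd z) $ j) P (C j) (M j) (v j) (c j) w" ..
    from choice[OF this] obtain w where vcw: "\<forall>j. net_fit \<mu> (\<lambda>z. f (fst z) (snd z) $ j) P (C j) (M j) (v j) (c j) (w j)" ..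
    define net where "net = net_field P (\<lambda>i. \<chi> j. w j i) (\<lambda>i. \<chi> j. fst (v j i)) (\<lambda>i. \<chi> j. snd (v j i)) (\<lambda>i. \<chi> j. c j i)"
    define nt where "nt = (\<lambda>z. (\<chi> j. relu_net P (v j) (c j) (w j) z) :: real^'n)"
    have net_nt: "net x t = nt (x, t)" for x t unfolding net_def nt_def by (rule net_field_component)
    have nt_cont: "continuous_on A nt" for A unfolding nt_def by (rule net_continuous)
    have net_cont: "continuous_on (UNIV \<times> {0..T}) (\<lambda>z. net (fst z) (snd z))"
      unfolding net_nt using nt_cont by simp
    have net_lip: "norm (net x t - net y t) \<le> LM * norm (x - y)" for x y t
    proof -
      have "norm (net x t - net y t) \<le> (\<Sum>j\<in>UNIV. M j) * norm (x - y)"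
        unfolding net_nt nt_def by (rule net_lipschitz) (use vcw P in \<open>auto simp: net_fit_def\<close>)
      also have "\<dots> \<le> LM * norm (x - y)" unfolding LM_def by (intro mult_right_mono sum_mono) auto
      finally show ?thesis .
    qed
    define u where "u = (\<lambda>j (z::(real^'n) \<times> real). \<bar>f (fst z) (cl (snd z)) $ j - nt z $ j\<bar>)"
    have f_cl: "continuous_on UNIV (\<lambda>z::(real^'n) \<times> real. f (fst z) (cl (snd z)))"
    proof -
      have "continuous_on UNIV (\<lambda>z::(real^'n) \<times> real. (fst z, cl (snd z)))"
        by (intro continuous_intros continuous_on_compose2[OF cl_cont[of UNIV]]) auto
      moreover have "range (\<lambda>z::(real^'n) \<times> real. (fst z, cl (snd z))) \<subseteq> UNIV \<times> {0..T}"
        unfolding image_subset_iff mem_Times_iff using cl(1) by simp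
      ultimately show ?thesis using continuous_on_compose2[OF fc] by fastforce
    qed
    have u_meas: "(\<lambda>z. ennreal (u j z)) \<in> borel_measurable borel" for j
      unfolding u_def by (intro measurable_compose[OF _ measurable_ennreal] borel_measurable_continuous_onI continuous_intros f_cl nt_cont)
    have u_int: "(\<integral>\<^sup>+z. ennreal (u j z) \<partial>\<mu>) \<le> ennreal (\<bar>C j\<bar> / sqrt (real P))" for j
    proof -
      have "(\<integral>\<^sup>+z. ennreal (u j z) \<partial>\<mu>) = (\<integral>\<^sup>+z. ennreal \<bar>f (fst z) (snd z) $ j - relu_net P (v j) (c j) (w j) z\<bar> \<partial>\<mu>)"
      proof (rule nn_integral_cong_AE)
        show "AE z in \<mu>. ennreal (u j z) = ennreal \<bar>f (fst z) (snd z) $ j - relu_net P (v j) (c j) (w j) z\<bar>"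
          using AE_mu by (rule AE_mp) (intro AE_I2 impI, simp add: u_def nt_def cl_def)
      qed
      also have "\<dots> \<le> ennreal (C j / sqrt (real P))" using vcw unfolding net_fit_def by blast
      also have "\<dots> \<le> ennreal (\<bar>C j\<bar> / sqrt (real P))" by (intro ennreal_leI divide_right_mono) auto
      finally show ?thesis .
    qed
    have main: "W1 (distr \<rho>0 borel (\<phi> t)) (distr \<rho>0 borel (\<phi>\<Theta> t)) \<le> ennreal (Ctot / sqrt (real P))"
      if \<phi>: "is_flow T f \<phi>" and \<phi>\<Theta>: "is_flow T net \<phi>\<Theta>" and t: "t \<in> {0..T}" for \<phi> \<phi>\<Theta> t
    proof -
      have slice: "\<zeta> t \<in> measurable \<rho>0 borel" if "continuous_on (UNIV \<times> {0..T}) (\<lambda>z. \<zeta> (snd z) (fst z))" for \<zeta> :: "real \<Rightarrow> real^'n \<Rightarrow> real^'n"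
      proof -
        have pair: "continuous_on UNIV (\<lambda>x::real^'n. (x, t))" by (intro continuous_intros)
        have "range (\<lambda>x::real^'n. (x, t)) \<subseteq> UNIV \<times> {0..T}" using t by auto
        from continuous_on_compose2[OF that pair this] have "continuous_on UNIV (\<zeta> t)" by simp
        then show ?thesis
          unfolding measurable_cong_sets[OF \<rho>0_sets refl] by (rule borel_measurable_continuous_onI)
      qed
      have m: "\<phi> t \<in> measurable \<rho>0 borel" "\<phi>\<Theta> t \<in> measurable \<rho>0 borel"
        using slice[OF flow_cont[OF \<phi>]] slice[OF flow_joint_continuous[OF \<phi>\<Theta> net_cont net_lip LM]] by auto
      \<comment> \<open>By uniqueness every flow of \<open>f\<close> agrees with \<phi>0 on [0, T],
        so networks fitted to the measure of \<phi>0 serve any \<phi>.\<close>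
      have same: "\<phi> s x = \<psi> (x, s)" if "s \<in> {0..T}" for s x
        using flow_lipschitz[OF \<phi> \<phi>0 fc L(2) less_imp_le[OF L(1)] that, of x x] cl(2)[OF that] by (simp add: \<psi>_def)
      \<comment> \<open>The right-hand side is free of \<open>t\<close>, which gives the supremum
        over time, and its integral over the initial states is an integral against \<mu>.\<close>
      have pt: "ennreal (dist (\<phi> t x) (\<phi>\<Theta> t x)) \<le> ennreal (exp (LM * T)) * (\<integral>\<^sup>+s. (\<Sum>j\<in>UNIV. ennreal (u j (Z (x, s)))) \<partial>N)" for x
      proof -
        let ?g = "\<lambda>s. norm (f (\<phi> s x) s - net (\<phi> s x) s)"
        have \<phi>x: "continuous_on {0..T} (\<lambda>s. \<phi> s x)"
          unfolding continuous_on_eq_continuous_within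
          using \<phi> has_vector_derivative_continuous unfolding is_flow_def by blast
        have gc: "continuous_on {0..T} ?g"
          by (intro continuous_intros continuous_along[OF fc \<phi>x] continuous_along[OF net_cont \<phi>x])
        have "norm (\<phi> t x - \<phi>\<Theta> t x) \<le> (norm (\<phi> 0 x - \<phi>\<Theta> 0 x) + integral {0..T} ?g) * exp (LM * t)"
          by (rule ode_compare[of T "\<lambda>s. \<phi> s x" f "\<lambda>s. \<phi>\<Theta> s x" net]) (use \<phi> \<phi>\<Theta> fc net_cont net_lip LM t in \<open>auto simp: is_flow_def\<close>)
        also have "norm (\<phi> 0 x - \<phi>\<Theta> 0 x) = 0" using \<phi> \<phi>\<Theta> by (simp add: is_flow_def)
        finally have "dist (\<phi> t x) (\<phi>\<Theta> t x) \<le> integral {0..T} ?g * exp (LM * t)" by (simp add: dist_norm)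
        also have "\<dots> \<le> integral {0..T} ?g * exp (LM * T)"
        proof (rule mult_left_mono)
          show "exp (LM * t) \<le> exp (LM * T)" using t LM by (simp add: mult_left_mono)
          show "0 \<le> integral {0..T} ?g" 
            by (intro Henstock_Kurzweil_Integration.integral_nonneg integrable_continuous_interval gc) auto
        qed
        finally have d: "dist (\<phi> t x) (\<phi>\<Theta> t x) \<le> exp (LM * T) * integral {0..T} ?g" by (simp add: mult.commute)
        have gi: "set_integrable lborel {0..T} ?g" by (rule borel_integrable_atLeastAtMost'[OF gc])
        have "ennreal (integral {0..T} ?g) = ennreal (\<integral>s. indicator {0..T} s * ?g s \<partial>lborel)"
          using set_borel_integral_eq_integral(2)[OF gi] by (simp add: set_lebesgue_integral_def)
        also have "\<dots> = (\<integral>\<^sup>+s. ennreal (indicator {0..T} s * ?g s) \<partial>lborel)"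
          using gi by (intro nn_integral_eq_integral[symmetric]) (auto simp: set_integrable_def)
        also have "\<dots> \<le> (\<integral>\<^sup>+s. ennreal (indicator {0..T} s) * (\<Sum>j\<in>UNIV. ennreal (u j (Z (x, s)))) \<partial>lborel)"
        proof (rule nn_integral_mono)
          fix s :: real
          show "ennreal (indicator {0..T} s * ?g s) \<le> ennreal (indicator {0..T} s) * (\<Sum>j\<in>UNIV. ennreal (u j (Z (x, s))))"
          proof (cases "s \<in> {0..T}")
            case True
            have "?g s \<le> (\<Sum>j\<in>UNIV. \<bar>(f (\<phi> s x) s - net (\<phi> s x) s) $ j\<bar>)" by (rule norm_le_l1_cart)
            also have "\<dots> = (\<Sum>j\<in>UNIV. u j (Z (x, s)))"
              using same[OF True] cl(2)[OF True] by (simp add: u_def Z_def net_nt)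
            finally have "ennreal (?g s) \<le> ennreal (\<Sum>j\<in>UNIV. u j (Z (x, s)))" by (rule ennreal_leI)
            also have "\<dots> = (\<Sum>j\<in>UNIV. ennreal (u j (Z (x, s))))" by (rule sum_ennreal[symmetric]) (simp add: u_def)
            finally show ?thesis using True by simp
          qed simp
        qed
        also have "\<dots> = (\<integral>\<^sup>+s. (\<Sum>j\<in>UNIV. ennreal (u j (Z (x, s)))) \<partial>N)"
        proof -
          have Zx: "(\<lambda>s. Z (x, s)) \<in> borel_measurable borel"
            by (intro borel_measurable_continuous_onI continuous_on_compose2[OF Z_cont] continuous_intros) auto
          show ?thesis
            unfolding N_def
            by (rule nn_integral_density[symmetric]) (auto intro!: borel_measurable_sum measurable_compose[OF Zx u_meas])
        qed
        finally have "ennreal (integral {0..T} ?g) \<le> (\<integral>\<^sup>+s. (\<Sum>j\<in>UNIV. ennreal (u j (Z (x, s)))) \<partial>N)" .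
        then have "ennreal (exp (LM * T)) * ennreal (integral {0..T} ?g) \<le> ennreal (exp (LM * T)) * (\<integral>\<^sup>+s. (\<Sum>j\<in>UNIV. ennreal (u j (Z (x, s)))) \<partial>N)"
          by (rule mult_left_mono) simp
        moreover have "ennreal (dist (\<phi> t x) (\<phi>\<Theta> t x)) \<le> ennreal (exp (LM * T)) * ennreal (integral {0..T} ?g)"
          using ennreal_leI[OF d] by (simp add: ennreal_mult')
        ultimately show ?thesis by (rule order_trans[rotated])
      qed
      have W_meas: "(\<lambda>y. \<Sum>j\<in>UNIV. ennreal (u j (Z y))) \<in> borel_measurable M1"
        by (intro borel_measurable_sum measurable_compose[OF Z_meas u_meas])
      have "W1 (distr \<rho>0 borel (\<phi> t)) (distr \<rho>0 borel (\<phi>\<Theta> t)) \<le> (\<integral>\<^sup>+x. ennreal (dist (\<phi> t x) (\<phi>\<Theta> t x)) \<partial>\<rho>0)"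
        by (rule W1_pushforward_le[OF \<rho>0_prob m])
      also have "\<dots> \<le> (\<integral>\<^sup>+x. ennreal (exp (LM * T)) * (\<integral>\<^sup>+s. (\<Sum>j\<in>UNIV. ennreal (u j (Z (x, s)))) \<partial>N) \<partial>\<rho>0)"
        by (intro nn_integral_mono pt)
      also have "\<dots> = ennreal (exp (LM * T)) * (\<integral>\<^sup>+x. (\<integral>\<^sup>+s. (\<Sum>j\<in>UNIV. ennreal (u j (Z (x, s)))) \<partial>N) \<partial>\<rho>0)"
        using N.borel_measurable_nn_integral_fst[OF W_meas[unfolded M1_def]] by (intro nn_integral_cmult) simp
      also have "(\<integral>\<^sup>+x. (\<integral>\<^sup>+s. (\<Sum>j\<in>UNIV. ennreal (u j (Z (x, s)))) \<partial>N) \<partial>\<rho>0) = (\<integral>\<^sup>+y. (\<Sum>j\<in>UNIV. ennreal (u j (Z y))) \<partial>M1)"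
        using N.nn_integral_fst[OF W_meas[unfolded M1_def]] by (simp add: M1_def)
      also have "\<dots> = (\<Sum>j\<in>UNIV. \<integral>\<^sup>+y. ennreal (u j (Z y)) \<partial>M1)"
        by (rule nn_integral_sum) (rule measurable_compose[OF Z_meas u_meas])
      also have "\<dots> = (\<Sum>j\<in>UNIV. \<integral>\<^sup>+z. ennreal (u j z) \<partial>\<mu>)"
        unfolding \<mu>_def using u_meas by (simp add: nn_integral_distr[OF Z_meas])
      also have "ennreal (exp (LM * T)) * \<dots> \<le> ennreal (exp (LM * T)) * (\<Sum>j\<in>UNIV. ennreal (\<bar>C j\<bar> / sqrt (real P)))"
        by (intro mult_left_mono sum_mono u_int) simp
      also have "(\<Sum>j\<in>UNIV. ennreal (\<bar>C j\<bar> / sqrt (real P))) = ennreal ((\<Sum>j\<in>UNIV. \<bar>C j\<bar>) / sqrt (real P))"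
        unfolding sum_divide_distrib by (rule sum_ennreal) simp
      also have "ennreal (exp (LM * T)) * \<dots> = ennreal (Ctot / sqrt (real P))"
        by (simp add: Ctot_def ennreal_mult'[symmetric])
      finally show ?thesis .
    qed
    show "\<exists>W A1 A2 B. \<forall>\<phi> \<phi>\<Theta>. is_flow T f \<phi> \<and> is_flow T (net_field P W A1 A2 B) \<phi>\<Theta> \<longrightarrow>
      (\<forall>t\<in>{0..T}. W1 (distr \<rho>0 borel (\<phi> t)) (distr \<rho>0 borel (\<phi>\<Theta> t)) \<le> ennreal (Ctot / sqrt (real P)))"
      using main unfolding net_def by blast
  qed
qed

end
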